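(* Let $(\varepsilon_n)$ be a vanishing sequence of positive numbers and let $u_n\in AC([0,T];X)$ be corresponding viscous solutions, i.e. $$\partial\Psi_{\varepsilon_n}(\dot u_n(t))+D\mathcal E_t(u_n(t))\ni0\quad\text{in }X^*\ \text{for a.a. }t\in(0,T).$$ Let $\mathsf t_n:[0,\mathsf S]\to[0,T]$ be uniformly Lipschitz and surjective time rescalings and let $\mathsf u_n:[0,\mathsf S]\to X$ be defined by $\mathsf u_n(s):=u_n(\mathsf t_n(s))$ for all $s\in[0,\mathsf S]$. Suppose that there exists $\alpha>0$ such that for all $n\in\mathbb N$ $$\mathsf m_n(s):=\mathfrak P_{\varepsilon_n}\big(\dot{\mathsf t}_n(s),\dot{\mathsf u}_n(s);1,-D\mathcal E_{\mathsf t_n(s)}(\mathsf u_n(s))\big)\in[\alpha,\alpha^{-1}]\quad\text{for a.a. }s\in(0,\mathsf S).$$ If the functions $(\mathsf t_n,\mathsf u_n,\mathsf m_n)$ pointwise converge to $(\mathsf t,\mathsf u,\mathsf m)$ as $n\to\infty$, then $(\mathsf t,\mathsf u)$ is a nondegenerate, surjective parametrized rate-independent solution for the system $(X,\mathcal E,\mathfrak P)$, and $$\mathfrak P\big(\dot{\mathsf t}(s),\dot{\mathsf u}(s);1,-D\mathcal E_{\mathsf t(s)}(\mathsf u(s))\big)=\mathsf m(s)\quad\text{for a.a. }s\in(0,\mathsf S).$$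
   Context: Let $(X,\|\cdot\|_X)$ be a finite-dimensional real normed vector space with dual $X^*$ and pairing $\langle\cdot,\cdot\rangle$, and let $T>0$. $\Psi_0:X\to[0,+\infty)$ is a gauge: $\Psi_0(v)>0$ if $v\neq0$, $\Psi_0(v_1+v_2)\le\Psi_0(v_1)+\Psi_0(v_2)$, $\Psi_0(\lambda v)=\lambda\Psi_0(v)$ for all $\lambda\ge0$, $v,v_1,v_2\in X$. $\partial$ denotes the convex subdifferential, $K^*:=\partial\Psi_0(0)=\{w\in X^*:\langle w,z\rangle\le\Psi_0(z)\ \forall z\in X\}$, and $I_{K^*}$ is its indicator ($0$ on $K^*$, $+\infty$ elsewhere). The energy $\mathcal E\in C^1([0,T]\times X)$, written $\mathcal E_t(u)$, satisfies for some $C>0$ and all $(t,u)$: $\mathcal E_t(u)\ge -C$ and $|\partial_t\mathcal E_t(u)|\le C(1+\mathcal E_t(u)^+)$, with $(\cdot)^+$ the positive part; $D\mathcal E_t(u)\in X^*$ is the differential in $u$. Viscosity: $\Psi:X\to[0,+\infty)$ is convex, $\Psi(0)=0$, $\Psi(v)/\|v\|_X\to+\infty$ as $\|v\|_X\to+\infty$; for $\varepsilon>0$, $\Psi_\varepsilon(v):=\varepsilon^{-1}\Psi(\varepsilon v)$, and $\Psi_0(v)=\lim_{\varepsilon\downarrow0}\Psi_\varepsilon(v)$ for every $v$. The Legendre conjugate is $\Psi_\varepsilon^*=\varepsilon^{-1}\Psi^*$. The vanishing viscosity contact potential is $\mathfrak p(v,w):=\inf_{\varepsilon>0}\big(\Psi_\varepsilon(v)+\Psi_\varepsilon^*(w)\big)$,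 $v\in X$, $w\in X^*$. Space-time potentials: for $\varepsilon>0$, $\alpha>0$, $v\in X$, $p\in\mathbb R$, $w\in X^*$, $\mathfrak P_\varepsilon(\alpha,v;p,w):=\alpha\Psi_\varepsilon(v/\alpha)+\alpha\Psi^*_\varepsilon(w)+\alpha p$. The augmented potential $\mathfrak P:[0,+\infty)\times X\times\mathbb R\times X^*\to(-\infty,+\infty]$ is $\mathfrak P(\alpha,v;p,w):=\Psi_0(v)+I_{K^*}(w)+\alpha p$ if $\alpha>0$ and $\mathfrak P(0,v;p,w):=\mathfrak p(v,w)$. Time rescalings are nondecreasing, and the condition on $\mathsf m_n$ presupposes $\dot{\mathsf t}_n>0$ a.e. so that $\mathsf m_n$ is defined. Parametrized solutions: a Lipschitz continuous curve $(\mathsf t,\mathsf u):[a,b]\to[0,T]\times X$ is a parametrized rate-independent solution for $(X,\mathcal E,\mathfrak P)$ if $\mathsf t$ is nondecreasing and, with $\mathsf p(s)=-\partial_t\mathcal E_{\mathsf t(s)}(\mathsf u(s))$, $\mathsf w(s)=-D\mathcal E_{\mathsf t(s)}(\mathsf u(s))$, $$\int_{s_1}^{s_2}\mathfrak P(\dot{\mathsf t}(s),\dot{\mathsf u}(s);\mathsf p(s),\mathsf w(s))\,\mathrm ds+\mathcal E_{\mathsf t(s_2)}(\mathsf u(s_2))\le\mathcal E_{\mathsf t(s_1)}(\mathsf u(s_1))\quad\forall\,a\le s_1\le s_2\le b.$$ It is nondegenerate if $\dot{\mathsf t}(s)+\Psi_0(\dot{\mathsf u}(s))>0$ for a.a.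 $s\in(a,b)$, and surjective if $\mathsf t(a)=0$, $\mathsf t(b)=T$. *)

theory Defs
  imports "HOL-Analysis.Analysis"
begin

text \<open>
  The dual of a (finite-dimensional) normed space \<open>'x\<close> is the type \<open>'x \<Rightarrow>\<^sub>L real\<close> of bounded
  linear functionals.
\<close>

definition gauge_fun :: "('x::real_normed_vector \<Rightarrow> real) \<Rightarrow> bool" where
  "gauge_fun g \<longleftrightarrow>
     (\<forall>v. 0 \<le> g v) \<and>
     (\<forall>v. v \<noteq> 0 \<longrightarrow> 0 < g v) \<and>
     (\<forall>v1 v2. g (v1 + v2) \<le> g v1 + g v2) \<and>
     (\<forall>c v. 0 \<le> c \<longrightarrow> g (c *\<^sub>R v) = c * g v)"

definition subdifferential ::
  "('x::real_normed_vector \<Rightarrow> real) \<Rightarrow> 'x \<Rightarrow> ('x \<Rightarrow>\<^sub>L real) set" where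
  "subdifferential f v = {w. \<forall>z. f v + blinfun_apply w (z - v) \<le> f z}"

definition legendre_conjugate ::
  "('x::real_normed_vector \<Rightarrow> real) \<Rightarrow> ('x \<Rightarrow>\<^sub>L real) \<Rightarrow> ereal" where
  "legendre_conjugate f w = (SUP v. ereal (blinfun_apply w v - f v))"

definition convex_indicator :: "'a set \<Rightarrow> 'a \<Rightarrow> ereal" where
  "convex_indicator K w = (if w \<in> K then 0 else \<infinity>)"

text \<open>For a trivial space \<^term>\<open>at_infinity\<close> is the bottom filter, so superlinearity is then void.\<close>

definition superlinear_dissipation :: "('x::real_normed_vector \<Rightarrow> real) \<Rightarrow> bool" where
  "superlinear_dissipation \<Psi> \<longleftrightarrow>
     (\<forall>v. 0 \<le> \<Psi> v) \<and> convex_on UNIV \<Psi> \<and> \<Psi> 0 = 0 \<and>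
     filterlim (\<lambda>v. \<Psi> v / norm v) at_top at_infinity"

definition scaled_dissipation ::
  "('x::real_normed_vector \<Rightarrow> real) \<Rightarrow> real \<Rightarrow> 'x \<Rightarrow> real" where
  "scaled_dissipation \<Psi> \<epsilon> v = \<Psi> (\<epsilon> *\<^sub>R v) / \<epsilon>"

definition vv_contact_potential ::
  "('x::real_normed_vector \<Rightarrow> real) \<Rightarrow> 'x \<Rightarrow> ('x \<Rightarrow>\<^sub>L real) \<Rightarrow> ereal" where
  "vv_contact_potential \<Psi> v w =
     (INF \<epsilon>\<in>{0<..}. ereal (scaled_dissipation \<Psi> \<epsilon> v)
                      + legendre_conjugate (scaled_dissipation \<Psi> \<epsilon>) w)"

text \<open>
  Only meaningful for \<open>\<alpha> > 0\<close>; at \<open>\<alpha> = 0\<close> the totality of division yields the dummy value \<open>0\<close>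
  (when the conjugate is finite).
\<close>

definition viscous_space_time_potential ::
  "('x::real_normed_vector \<Rightarrow> real) \<Rightarrow> real \<Rightarrow>
   real \<Rightarrow> 'x \<Rightarrow> real \<Rightarrow> ('x \<Rightarrow>\<^sub>L real) \<Rightarrow> ereal" where
  "viscous_space_time_potential \<Psi> \<epsilon> \<alpha> v p w =
     ereal (\<alpha> * scaled_dissipation \<Psi> \<epsilon> (v /\<^sub>R \<alpha>))
     + ereal \<alpha> * legendre_conjugate (scaled_dissipation \<Psi> \<epsilon>) w
     + ereal (\<alpha> * p)"

text \<open>
  Only meaningful for \<open>\<alpha> \<ge> 0\<close>; the second branch is the case \<open>\<alpha> = 0\<close>.
\<close>

definition augmented_potential ::
  "('x::real_normed_vector \<Rightarrow> real) \<Rightarrow> ('x \<Rightarrow> real) \<Rightarrow>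
   real \<Rightarrow> 'x \<Rightarrow> real \<Rightarrow> ('x \<Rightarrow>\<^sub>L real) \<Rightarrow> ereal" where
  "augmented_potential \<Psi>0 \<Psi> \<alpha> v p w =
     (if \<alpha> > 0
      then ereal (\<Psi>0 v) + convex_indicator (subdifferential \<Psi>0 0) w + ereal (\<alpha> * p)
      else vv_contact_potential \<Psi> v w)"

text \<open>
  \<open>E t u\<close> is the energy, \<open>dE\<close> its partial time derivative and \<open>DE\<close> its differential in the state
  variable.  On \<open>[0,T] \<times> X\<close> with \<open>T > 0\<close> both are uniquely determined by \<open>E\<close>
  (one-sided in time at \<open>0\<close> and \<open>T\<close>).
\<close>

definition C1_energy ::
  "real \<Rightarrow> (real \<Rightarrow> 'x::real_normed_vector \<Rightarrow> real) \<Rightarrow> (real \<Rightarrow> 'x \<Rightarrow> real) \<Rightarrow>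
   (real \<Rightarrow> 'x \<Rightarrow> ('x \<Rightarrow>\<^sub>L real)) \<Rightarrow> bool" where
  "C1_energy T E dE DE \<longleftrightarrow>
     (\<forall>t\<in>{0..T}. \<forall>u.
        ((\<lambda>(r, x). E r x) has_derivative (\<lambda>(h, v). h * dE t u + blinfun_apply (DE t u) v))
          (at (t, u) within {0..T} \<times> UNIV)) \<and>
     continuous_on ({0..T} \<times> UNIV) (\<lambda>(t, u). dE t u) \<and>
     continuous_on ({0..T} \<times> UNIV) (\<lambda>(t, u). DE t u)"

definition energy_bounds ::
  "real \<Rightarrow> (real \<Rightarrow> 'x::real_normed_vector \<Rightarrow> real) \<Rightarrow> (real \<Rightarrow> 'x \<Rightarrow> real) \<Rightarrow> bool" where
  "energy_bounds T E dE \<longleftrightarrow>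
     (\<exists>C>0. \<forall>t\<in>{0..T}. \<forall>u.
        - C \<le> E t u \<and> \<bar>dE t u\<bar> \<le> C * (1 + max (E t u) 0))"

definition abs_continuous_curve ::
  "real \<Rightarrow> real \<Rightarrow> (real \<Rightarrow> 'x::real_normed_vector) \<Rightarrow> bool" where
  "abs_continuous_curve a b f \<longleftrightarrow>
     (\<forall>e>0. \<exists>d>0. \<forall>D. finite D \<and> (\<forall>(x, y)\<in>D. a \<le> x \<and> x \<le> y \<and> y \<le> b) \<and>
        disjoint_family_on (\<lambda>(x, y). {x<..<y}) D \<and> (\<Sum>(x, y)\<in>D. y - x) < d \<longrightarrow>
        (\<Sum>(x, y)\<in>D. norm (f y - f x)) < e)"

definition viscous_solution ::
  "real \<Rightarrow> (real \<Rightarrow> 'x::real_normed_vector \<Rightarrow> ('x \<Rightarrow>\<^sub>L real)) \<Rightarrow> ('x \<Rightarrow> real) \<Rightarrow> real \<Rightarrow>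
   (real \<Rightarrow> 'x) \<Rightarrow> bool" where
  "viscous_solution T DE \<Psi> \<epsilon> u \<longleftrightarrow>
     abs_continuous_curve 0 T u \<and>
     (AE t in lebesgue. t \<in> {0<..<T} \<longrightarrow>
        0 \<in> (\<lambda>\<xi>. \<xi> + DE t (u t)) `
            subdifferential (scaled_dissipation \<Psi> \<epsilon>) (vector_derivative u (at t)))"

text \<open>
  The integral of an extended-real function as the difference of the integrals of its positive and
  negative parts (\<^const>\<open>e2ennreal\<close> sends negative numbers to \<open>0\<close>).  Below, the negative part
  always has a finite integral.
\<close>

definition ereal_integral :: "'a measure \<Rightarrow> ('a \<Rightarrow> ereal) \<Rightarrow> ereal" where
  "ereal_integral M f =
     enn2ereal (\<integral>\<^sup>+ x. e2ennreal (f x) \<partial>M) - enn2ereal (\<integral>\<^sup>+ x. e2ennreal (- f x) \<partial>M)"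

definition parametrized_solution ::
  "real \<Rightarrow> (real \<Rightarrow> 'x::real_normed_vector \<Rightarrow> real) \<Rightarrow> (real \<Rightarrow> 'x \<Rightarrow> real) \<Rightarrow>
   (real \<Rightarrow> 'x \<Rightarrow> ('x \<Rightarrow>\<^sub>L real)) \<Rightarrow>
   (real \<Rightarrow> 'x \<Rightarrow> real \<Rightarrow> ('x \<Rightarrow>\<^sub>L real) \<Rightarrow> ereal) \<Rightarrow>
   real \<Rightarrow> real \<Rightarrow> (real \<Rightarrow> real) \<Rightarrow> (real \<Rightarrow> 'x) \<Rightarrow> bool" where
  "parametrized_solution T E dE DE P a b t u \<longleftrightarrow>
     (\<exists>L. L-lipschitz_on {a..b} (\<lambda>s. (t s, u s))) \<and>
     t ` {a..b} \<subseteq> {0..T} \<and>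
     mono_on {a..b} t \<and>
     (\<forall>s1 s2. a \<le> s1 \<and> s1 \<le> s2 \<and> s2 \<le> b \<longrightarrow>
        ereal_integral (lebesgue_on {s1..s2})
          (\<lambda>s. P (vector_derivative t (at s)) (vector_derivative u (at s))
                 (- dE (t s) (u s)) (- DE (t s) (u s)))
        + ereal (E (t s2) (u s2)) \<le> ereal (E (t s1) (u s1)))"

definition nondegenerate_curve ::
  "('x::real_normed_vector \<Rightarrow> real) \<Rightarrow> real \<Rightarrow> real \<Rightarrow> (real \<Rightarrow> real) \<Rightarrow> (real \<Rightarrow> 'x) \<Rightarrow> bool" where
  "nondegenerate_curve \<Psi>0 a b t u \<longleftrightarrow>
     (AE s in lebesgue. s \<in> {a<..<b} \<longrightarrow>
        0 < vector_derivative t (at s) + \<Psi>0 (vector_derivative u (at s)))"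

definition surjective_curve :: "real \<Rightarrow> real \<Rightarrow> real \<Rightarrow> (real \<Rightarrow> real) \<Rightarrow> bool" where
  "surjective_curve T a b t \<longleftrightarrow> t a = 0 \<and> t b = T"

end

theory Submission
  imports Defs
begin

text \<open>
  Write \<open>w\<^sub>n = - DE (tn n) (un n)\<close> for the driving force and \<open>\<tau>\<^sub>n\<close>, \<open>\<upsilon>\<^sub>n\<close> for the derivatives of \<open>tn n\<close>,
  \<open>un n\<close>. The viscous inclusion says that \<open>w\<^sub>n\<close> is a subgradient of the scaled potential at
  \<open>\<upsilon>\<^sub>n / \<tau>\<^sub>n\<close>, so the Fenchel inequality is an equality there and
  \<open>m\<^sub>n = \<langle>w\<^sub>n, \<upsilon>\<^sub>n\<rangle> + \<tau>\<^sub>n\<close> almost everywhere (\<open>viscous_space_time_potential_eq\<close>). Hence the upper bound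
  on \<open>m\<^sub>n\<close> makes the curves uniformly Lipschitz, the limits are Lipschitz too, and it remains to
  identify \<open>m\<close> at almost every \<open>s\<close>, where \<open>t\<close>, \<open>u\<close> and the primitive of \<open>m\<close> are differentiable.
  Write \<open>w\<close> for the limiting force at \<open>s\<close>.

  \<^item> Energy balance: the chain rule turns the identity for \<open>m\<^sub>n\<close> into
    \<open>(E (tn n) (un n))' = \<tau>\<^sub>n (dE + 1) - m\<^sub>n\<close>. On a short interval to the right of \<open>s\<close> the factor \<open>dE + 1\<close>
    is nearly constant, uniformly in large \<open>n\<close>, so the limit involves only increments of \<open>tn n\<close>.
    Comparing with the chain rule for the limit gives
    \<open>m s = \<langle>w, u'\<rangle> + t'\<close> (\<open>limit_energy_balance\<close>).
  \<^item> Lower bounds: if a gauge \<open>q\<close> satisfies \<open>q \<upsilon>\<^sub>n \<le> \<langle>w\<^sub>n, \<upsilon>\<^sub>n\<rangle>\<close> near \<open>s\<close>, then convexity in the form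
    \<open>q (un n b - un n s) \<le> \<integral> q \<upsilon>\<^sub>n\<close> survives the limit and gives \<open>q u' + t' \<le> m s\<close> (\<open>limit_gauge_le\<close>). This is
    used with \<open>q = \<Psi>0\<close> and with the gauges \<open>contact_gauge \<Psi> c\<close>, the infimum of \<open>(\<Psi> (\<delta> v) + c) / \<delta>\<close> over
    all \<open>\<delta> > 0\<close>, for \<open>c\<close> below the conjugate of \<open>\<Psi>\<close> at \<open>w\<close>; the parameter \<open>\<delta> = \<epsilon> n / \<tau>\<^sub>n\<close> is the one that
    the viscous problem selects. At \<open>c\<close> equal to the conjugate this gauge is the contact potential.
  \<^item> Local stability: if \<open>w\<close> is outside the stable set, then \<open>\<tau>\<^sub>n\<close> is of order \<open>\<epsilon> n\<close> near \<open>s\<close>, so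
    \<open>t' = 0\<close> (\<open>limit_local_stability\<close>).

  Both branches of the augmented potential are at least \<open>\<langle>w, u'\<rangle> + t'\<close>, which the balance equates
  with \<open>m s\<close>, and by the lower bounds they are at most \<open>m s\<close>. So the potential equals \<open>m\<close> almost
  everywhere, the energy inequality holds as an equality, and the curve is nondegenerate because
  \<open>t' = 0\<close> and \<open>u' = 0\<close> would give \<open>m s = 0\<close>.

  The argument rests on differentiation theory on the line: absolutely continuous curves in a
  finite-dimensional space are differentiable almost everywhere and are recovered by integrating
  their derivative, and indefinite integrals have the integrand as derivative almost everywhere.
  All three are proved below from Vitali's covering theorem or from gauge divisions.
\<close>

section \<open>Vitali coverings by intervals\<close>

definition disjoint_intervals :: "(real \<times> real) set \<Rightarrow> bool" where
  "disjoint_intervals F \<longleftrightarrow> pairwise (\<lambda>I J. disjnt {fst I..snd I} {fst J..snd J}) F"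

lemma disjoint_intervalsD:
  "disjoint_intervals F \<Longrightarrow> I \<in> F \<Longrightarrow> J \<in> F \<Longrightarrow> I \<noteq> J \<Longrightarrow> disjnt {fst I..snd I} {fst J..snd J}"
  by (simp add: disjoint_intervals_def pairwise_def)

lemma disjoint_intervals_subset:
  "disjoint_intervals F \<Longrightarrow> G \<subseteq> F \<Longrightarrow> disjoint_intervals G"
  unfolding disjoint_intervals_def by (rule pairwise_subset)

text \<open>
  Vitali's theorem extracts countably many disjoint intervals that cover all of \<open>S\<close> except for a
  null set; the bound on finite subfamilies passes to their union. The exceptional set in most of
  the differentiation theorems below is caught in this way by intervals on which some increment
  misbehaves, with \<open>P\<close> describing the misbehaviour.
\<close>

lemma Vitali_interval_cover_measure:
  fixes S :: "real set" and P :: "real \<Rightarrow> real \<Rightarrow> bool"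
  assumes cover: "\<And>x d. x \<in> S \<Longrightarrow> 0 < d \<Longrightarrow> \<exists>l r. l < r \<and> l \<le> x \<and> x \<le> r \<and> r - l < d \<and> P l r"
    and bound: "\<And>F. finite F \<Longrightarrow> (\<forall>(l, r)\<in>F. l < r \<and> P l r) \<Longrightarrow>
        disjoint_intervals F \<Longrightarrow> (\<Sum>(l, r)\<in>F. r - l) \<le> e"
  shows "\<exists>T. S \<subseteq> T \<and> T \<in> lmeasurable \<and> measure lebesgue T \<le> e"
proof -
  define K where "K = {I. fst I < snd I \<and> P (fst I) (snd I)}"
  define mid where "mid I = (fst I + snd I) / 2" for I :: "real \<times> real"
  define rad where "rad I = (snd I - fst I) / 2" for I :: "real \<times> real"
  have cb: "cball (mid I) (rad I) = {fst I..snd I}" for I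
    unfolding mid_def rad_def cball_eq_atLeastAtMost by (simp add: field_simps)
  obtain C where C: "countable C" "C \<subseteq> K"
     "pairwise (\<lambda>i j. disjnt (cball (mid i) (rad i)) (cball (mid j) (rad j))) C"
     "negligible (S - (\<Union>i \<in> C. cball (mid i) (rad i)))"
  proof (rule Vitali_covering_theorem_cballs [of K rad S mid])
    show "0 < rad I" if "I \<in> K" for I using that by (simp add: K_def rad_def)
    fix x d :: real assume "x \<in> S" "0 < d"
    then obtain l r where lr: "l < r" "l \<le> x" "x \<le> r" "r - l < d" "P l r"
      using cover by blast
    show "\<exists>I. I \<in> K \<and> x \<in> cball (mid I) (rad I) \<and> rad I < d"
      unfolding cb by (rule exI[of _ "(l, r)"]) (use lr in \<open>simp add: K_def rad_def\<close>)
  qed blast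
  define U where "U = (\<Union>I \<in> C. {fst I..snd I})"
  have fin: "measure lebesgue (\<Union>I \<in> D. {fst I..snd I}) \<le> e" if D: "D \<subseteq> C" "finite D" for D
  proof -
    have "measure lebesgue (\<Union>I \<in> D. {fst I..snd I}) \<le> (\<Sum>I\<in>D. measure lebesgue {fst I..snd I})"
      by (rule measure_UNION_le) (use D in auto)
    also have "\<dots> = (\<Sum>(l, r)\<in>D. r - l)"
      by (rule sum.cong) (use D C(2) in \<open>auto simp: K_def\<close>)
    also have "\<dots> \<le> e"
    proof (rule bound[OF D(2)])
      show "\<forall>(l, r)\<in>D. l < r \<and> P l r" using D C(2) by (auto simp: K_def)
      show "disjoint_intervals D"
        using C(3) D(1) unfolding cb disjoint_intervals_def by (rule pairwise_subset)
    qed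
    finally show ?thesis .
  qed
  have U: "U \<in> lmeasurable" "measure lebesgue U \<le> e"
    unfolding U_def by (rule fmeasurable_UN_bound[OF C(1)] measure_UN_bound[OF C(1)]; use fin in auto)+
  have N: "negligible (S - U)" using C(4) unfolding cb U_def .
  have "(S - U) \<union> U \<in> lmeasurable"
    using negligible_imp_measurable[OF N] U(1) by (rule fmeasurable.Un)
  moreover have "measure lebesgue ((S - U) \<union> U) \<le> e"
    using U negligible_imp_measurable[OF N] negligible_imp_measure0[OF N]
      measure_Un_le[of "S - U" lebesgue U]
    by (simp add: fmeasurableD)
  ultimately show ?thesis
    by (intro exI[of _ "(S - U) \<union> U"] conjI) simp_all
qed

corollary negligible_if_Vitali_intervals_short:
  fixes S :: "real set" and P :: "real \<Rightarrow> real \<Rightarrow> real \<Rightarrow> bool"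
  assumes "\<And>e x d. 0 < e \<Longrightarrow> x \<in> S \<Longrightarrow> 0 < d \<Longrightarrow> \<exists>l r. l < r \<and> l \<le> x \<and> x \<le> r \<and> r - l < d \<and> P e l r"
    and "\<And>e F. 0 < e \<Longrightarrow> finite F \<Longrightarrow> (\<forall>(l, r)\<in>F. l < r \<and> P e l r) \<Longrightarrow>
        disjoint_intervals F \<Longrightarrow> (\<Sum>(l, r)\<in>F. r - l) \<le> e"
  shows "negligible S"
  unfolding negligible_outer_le
proof (intro allI impI)
  fix e :: real assume e: "0 < e"
  show "\<exists>T. S \<subseteq> T \<and> T \<in> lmeasurable \<and> measure lebesgue T \<le> e"
  proof (rule Vitali_interval_cover_measure[of S "P e" e])
    fix x d :: real assume "x \<in> S" "0 < d"
    then show "\<exists>l r. l < r \<and> l \<le> x \<and> x \<le> r \<and> r - l < d \<and> P e l r"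
      using assms(1)[OF e] by simp
  next
    fix F :: "(real \<times> real) set"
    assume "finite F" "\<forall>(l, r)\<in>F. l < r \<and> P e l r"
      "disjoint_intervals F"
    then show "(\<Sum>(l, r)\<in>F. r - l) \<le> e" by (rule assms(2)[OF e])
  qed
qed

lemma negligible_outer_modulo_finite:
  fixes S :: "real set"
  assumes "\<And>e. 0 < e \<Longrightarrow> \<exists>N T. finite N \<and> S - N \<subseteq> T \<and> T \<in> lmeasurable \<and> measure lebesgue T \<le> e"
  shows "negligible S"
  unfolding negligible_outer_le
proof (intro allI impI)
  fix e :: real assume "0 < e"
  then obtain N T where NT: "finite N" "S - N \<subseteq> T" "T \<in> lmeasurable" "measure lebesgue T \<le> e"
    using assms[OF \<open>0 < e\<close>] by (elim exE conjE)
  have N: "negligible N" using NT(1) by (rule negligible_finite)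
  have "S \<subseteq> T \<union> N" using NT(2) by blast
  moreover have "T \<union> N \<in> lmeasurable"
    using NT(3) negligible_imp_measurable[OF N] by (rule fmeasurable.Un)
  moreover have "measure lebesgue (T \<union> N) \<le> e"
    using NT negligible_imp_measurable[OF N] negligible_imp_measure0[OF N]
      measure_Un_le[of T lebesgue N]
    by (simp add: fmeasurableD)
  ultimately show "\<exists>T. S \<subseteq> T \<and> T \<in> lmeasurable \<and> measure lebesgue T \<le> e"
    by (intro exI[of _ "T \<union> N"] conjI)
qed

text \<open>
  Peel off the rightmost interval: by disjointness the others end before it begins.
\<close>

lemma mono_sum_increments_le:
  fixes h :: "real \<Rightarrow> real"
  assumes "finite F" "\<forall>(l, r)\<in>F. a \<le> l \<and> l < r \<and> r \<le> b"
    and "disjoint_intervals F"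
    and "mono_on {a..b} h" "a \<le> b"
  shows "(\<Sum>(l, r)\<in>F. h r - h l) \<le> h b - h a"
  using assms
proof (induction "card F" arbitrary: F b)
  case 0
  then show ?case by (auto simp: mono_on_def)
next
  case (Suc n)
  then have ne: "F \<noteq> {}" by auto
  have "Max (snd ` F) \<in> snd ` F" using Suc.prems(1) ne by (intro Max_in) auto
  then obtain l r where lr: "(l, r) \<in> F" "r = Max (snd ` F)" by force
  let ?G = "F - {(l, r)}"
  have lr': "a \<le> l" "l < r" "r \<le> b" using Suc.prems(2) lr(1) by auto
  have left: "r' < l" if "(l', r') \<in> ?G" for l' r'
  proof -
    have "disjnt {l'..r'} {l..r}"
      using disjoint_intervalsD[OF Suc.prems(3), of "(l', r')" "(l, r)"] that lr(1) by auto
    moreover have "r' \<le> r" unfolding lr(2) using that Suc.prems(1) by (intro Max_ge) force+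
    moreover have "l' < r'" using Suc.prems(2) that by auto
    ultimately show ?thesis by (auto simp: disjnt_iff not_less dest: spec[of _ r'])
  qed
  have "(\<Sum>(l, r)\<in>?G. h r - h l) \<le> h l - h a"
  proof (rule Suc.hyps(1))
    show "n = card ?G" using Suc.hyps(2) lr(1) Suc.prems(1) by simp
    show "\<forall>(l', r')\<in>?G. a \<le> l' \<and> l' < r' \<and> r' \<le> l"
      using Suc.prems(2) left by fastforce
    show "disjoint_intervals ?G"
      using Suc.prems(3) by (rule disjoint_intervals_subset) auto
    show "mono_on {a..l} h" using Suc.prems(4) lr' by (auto intro: mono_on_subset)
  qed (use Suc.prems lr' in auto)
  moreover have "(\<Sum>(l, r)\<in>F. h r - h l) = h r - h l + (\<Sum>(l, r)\<in>?G. h r - h l)"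
    using sum.remove[OF Suc.prems(1) lr(1), of "\<lambda>(l, r). h r - h l"] by simp
  moreover have "h r \<le> h b" using Suc.prems(4,5) lr' by (auto simp: mono_on_def)
  ultimately show ?case by linarith
qed

section \<open>Almost everywhere differentiability of functions of bounded variation\<close>

definition is_partition :: "real \<Rightarrow> real \<Rightarrow> nat \<Rightarrow> (nat \<Rightarrow> real) \<Rightarrow> bool" where
  "is_partition a b N X \<longleftrightarrow> X 0 = a \<and> X N = b \<and> (\<forall>i<N. X i < X (Suc i))"

definition partition_variation :: "(real \<Rightarrow> real) \<Rightarrow> nat \<Rightarrow> (nat \<Rightarrow> real) \<Rightarrow> real" where
  "partition_variation g N X = (\<Sum>i<N. \<bar>g (X (Suc i)) - g (X i)\<bar>)"

lemma is_partition_mono: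
  assumes "is_partition a b N X" "i \<le> j" "j \<le> N"
  shows "X i \<le> X j"
  using assms(2,3)
proof (induction rule: dec_induct)
  case (step k)
  then have "X k < X (Suc k)" using assms(1) by (auto simp: is_partition_def)
  then show ?case using step by auto
qed auto

text \<open>
  \<open>T\<close> is the variation function, the supremum of the variations of the partitions of \<open>{a..y}\<close>.
  Of its properties only two matter: it dominates the increments of \<open>g\<close>, and its total increment
  is nearly attained by a single partition.
\<close>

lemma bounded_variation_function:
  fixes g :: "real \<Rightarrow> real"
  assumes bd: "\<forall>y N X. a \<le> y \<and> y \<le> b \<and> is_partition a y N X \<longrightarrow> partition_variation g N X \<le> B"
    and ab: "a < b"
  obtains T where "T a = 0" "\<And>y z. a \<le> y \<Longrightarrow> y \<le> z \<Longrightarrow> z \<le> b \<Longrightarrow> \<bar>g z - g y\<bar> \<le> T z - T y"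
    "\<And>e. 0 < e \<Longrightarrow> \<exists>N X. is_partition a b N X \<and> T b - e < partition_variation g N X"
proof -
  define VS where "VS y = {partition_variation g N X | N X. is_partition a y N X}" for y
  define T where "T y = Sup (VS y)" for y
  have ne: "VS y \<noteq> {}" if y: "a \<le> y" for y
  proof (cases "y = a")
    case True
    then have "is_partition a y 0 (\<lambda>_. a)" by (simp add: is_partition_def)
    then show ?thesis by (auto simp: VS_def)
  next
    case False
    with y have "is_partition a y 1 (\<lambda>i. if i = 0 then a else y)" by (auto simp: is_partition_def)
    then show ?thesis by (auto simp: VS_def)
  qed
  have bdd: "bdd_above (VS y)" if "a \<le> y" "y \<le> b" for y
    by (rule bdd_aboveI[of _ B]) (use bd that in \<open>auto simp: VS_def\<close>)
  show ?thesis
  proof (rule that[of T])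
    have "VS a = {0}"
    proof -
      have "N = 0" if "is_partition a a N X" for N X
      proof (rule ccontr)
        assume "N \<noteq> 0"
        then have "X 0 < X (Suc 0)" using that by (auto simp: is_partition_def)
        also have "\<dots> \<le> X N" using \<open>N \<noteq> 0\<close> by (intro is_partition_mono[OF that]) auto
        finally show False using that by (auto simp: is_partition_def)
      qed
      then have "v = 0" if "v \<in> VS a" for v
        using that by (force simp: VS_def partition_variation_def)
      then show ?thesis using ne[of a] by auto
    qed
    then show "T a = 0" by (simp add: T_def)
    fix y z assume yz: "a \<le> y" "y \<le> z" "z \<le> b"
    show "\<bar>g z - g y\<bar> \<le> T z - T y"
    proof (cases "y = z")
      case False
      have "T y \<le> T z - \<bar>g z - g y\<bar>"
        unfolding T_def[of y]
      proof (rule cSup_least)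
        fix v assume "v \<in> VS y"
        then obtain N X where X: "is_partition a y N X" "v = partition_variation g N X"
          by (auto simp: VS_def)
        let ?X = "X(Suc N := z)"
        have "is_partition a z (Suc N) ?X"
          using X(1) yz False by (auto simp: is_partition_def less_Suc_eq)
        moreover have "partition_variation g (Suc N) ?X = v + \<bar>g z - g y\<bar>"
          using X by (auto simp: partition_variation_def is_partition_def)
        ultimately have "v + \<bar>g z - g y\<bar> \<in> VS z" by (force simp: VS_def)
        then have "v + \<bar>g z - g y\<bar> \<le> T z" unfolding T_def using bdd yz
          by (intro cSup_upper) auto
        then show "v \<le> T z - \<bar>g z - g y\<bar>" by simp
      qed (use ne yz in auto)
      then show ?thesis by simp
    qed simp
  next
    fix e :: real assume "0 < e"
    then have "T b - e < Sup (VS b)" by (simp add: T_def)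
    then obtain v where "v \<in> VS b" "T b - e < v"
      using less_cSupD ne ab by (metis less_imp_le)
    then show "\<exists>N X. is_partition a b N X \<and> T b - e < partition_variation g N X"
      by (auto simp: VS_def)
  qed
qed

text \<open>
  This is Austin's proof of Lebesgue's differentiation theorem. Take a partition whose variation
  is within \<open>2 q e\<close> of the total. On each of its cells the points in question lie in short
  intervals on which \<open>g\<close> moves with slope at least \<open>q\<close> against its net direction on the cell, and
  each of them costs twice its increment in variation. Since the partition is nearly optimal, their
  total length is at most \<open>e\<close>.
\<close>

lemma Austin_two_slopes_negligible:
  fixes g T :: "real \<Rightarrow> real"
  assumes T0: "T a = 0"
    and T: "\<And>y z. a \<le> y \<Longrightarrow> y \<le> z \<Longrightarrow> z \<le> b \<Longrightarrow> \<bar>g z - g y\<bar> \<le> T z - T y"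
    and Tapp: "\<And>e. 0 < e \<Longrightarrow> \<exists>N X. is_partition a b N X \<and> T b - e < partition_variation g N X"
    and q: "0 < q"
  shows "negligible {x. a < x \<and> x < b \<and>
     (\<forall>d>0. \<exists>l r. l < r \<and> l \<le> x \<and> x \<le> r \<and> r - l < d \<and> q * (r - l) \<le> g r - g l) \<and>
     (\<forall>d>0. \<exists>l r. l < r \<and> l \<le> x \<and> x \<le> r \<and> r - l < d \<and> g r - g l \<le> - (q * (r - l)))}"
    (is "negligible ?S")
proof (rule negligible_outer_modulo_finite)
  fix e :: real assume e: "0 < e"
  obtain N X where X: "is_partition a b N X" and var: "T b - 2 * q * e < partition_variation g N X"
    using Tapp[of "2 * q * e"] e q by auto
  \<comment> \<open>the net direction of \<open>g\<close> on the cell with index \<open>i\<close>\<close>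
  define \<sigma> where "\<sigma> i = (if 0 \<le> g (X (Suc i)) - g (X i) then 1 else (-1::real))" for i
  define P where "P l r = (\<exists>i<N. X i < l \<and> r < X (Suc i) \<and> \<sigma> i * (g r - g l) \<le> - (q * (r - l)))" for l r
  have Xab: "a \<le> X i \<and> X i \<le> b" if "i \<le> N" for i
    using is_partition_mono[OF X, of 0 i] is_partition_mono[OF X, of i N] that X
    by (auto simp: is_partition_def)
  have loc: "\<exists>i<N. X i < x \<and> x < X (Suc i)" if x: "a < x" "x < b" "x \<notin> X ` {..N}" for x
  proof -
    define i where "i = Max {j. j \<le> N \<and> X j < x}"
    have fin: "finite {j. j \<le> N \<and> X j < x}" by simp
    have "0 \<in> {j. j \<le> N \<and> X j < x}" using x X by (auto simp: is_partition_def)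
    then have i: "i \<le> N" "X i < x" using Max_in[OF fin] unfolding i_def by blast+
    have "i \<noteq> N" using i x X by (auto simp: is_partition_def)
    with i have iN: "i < N" by simp
    have "\<not> X (Suc i) < x"
    proof
      assume "X (Suc i) < x"
      then have "Suc i \<le> i" unfolding i_def using iN by (intro Max_ge[OF fin]) (auto simp: i_def)
      then show False by simp
    qed
    moreover have "X (Suc i) \<noteq> x" using x(3) iN by (auto simp: image_iff)
    ultimately show ?thesis using iN i by (auto intro!: exI[of _ i])
  qed
  have "\<exists>U. ?S - X ` {..N} \<subseteq> U \<and> U \<in> lmeasurable \<and> measure lebesgue U \<le> e"
  proof (rule Vitali_interval_cover_measure[where P=P])
    fix x d :: real assume x: "x \<in> ?S - X ` {..N}" and d: "0 < d"
    then obtain i where i: "i < N" "X i < x" "x < X (Suc i)" using loc by blast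
    define d' where "d' = min d (min (x - X i) (X (Suc i) - x))"
    have d': "0 < d'" using d i by (simp add: d'_def)
    have "\<exists>l r. l < r \<and> l \<le> x \<and> x \<le> r \<and> r - l < d' \<and> \<sigma> i * (g r - g l) \<le> - (q * (r - l))"
    proof (cases "\<sigma> i = 1")
      case True
      then show ?thesis using x d' by auto
    next
      case False
      then have s: "\<sigma> i = -1" by (auto simp: \<sigma>_def split: if_splits)
      obtain l r where "l < r" "l \<le> x" "x \<le> r" "r - l < d'" "q * (r - l) \<le> g r - g l"
        using x d' by blast
      then show ?thesis by (intro exI[of _ l] exI[of _ r]) (simp add: s)
    qed
    then obtain l r where lr: "l < r" "l \<le> x" "x \<le> r" "r - l < d'" "\<sigma> i * (g r - g l) \<le> - (q * (r - l))"
      by blast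
    then have "P l r" unfolding P_def using i by (auto simp: d'_def intro!: exI[of _ i])
    then show "\<exists>l r. l < r \<and> l \<le> x \<and> x \<le> r \<and> r - l < d \<and> P l r"
      using lr by (auto simp: d'_def)
  next
    fix F :: "(real \<times> real) set"
    assume F: "finite F" "\<forall>(l, r)\<in>F. l < r \<and> P l r"
      and dis: "disjoint_intervals F"
    have "\<forall>I\<in>F. \<exists>i<N. X i < fst I \<and> snd I < X (Suc i) \<and>
        \<sigma> i * (g (snd I) - g (fst I)) \<le> - (q * (snd I - fst I))"
      using F(2) by (force simp: P_def)
    then obtain \<iota> where \<iota>: "\<And>I. I \<in> F \<Longrightarrow> \<iota> I < N \<and> X (\<iota> I) < fst I \<and> snd I < X (Suc (\<iota> I)) \<and>
        \<sigma> (\<iota> I) * (g (snd I) - g (fst I)) \<le> - (q * (snd I - fst I))"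
      by metis
    have one: "(\<Sum>I | I \<in> F \<and> \<iota> I = i. 2 * q * (snd I - fst I))
        \<le> T (X (Suc i)) - T (X i) - \<bar>g (X (Suc i)) - g (X i)\<bar>" if i: "i < N" for i
    proof -
      let ?G = "{I. I \<in> F \<and> \<iota> I = i}"
      \<comment> \<open>nondecreasing, with increment at least \<open>2 q (r - l)\<close> on each bad interval \<open>{l..r}\<close>\<close>
      let ?h = "\<lambda>x. T x - \<sigma> i * g x"
      have Xi: "a \<le> X i" "X i < X (Suc i)" "X (Suc i) \<le> b"
        using Xab[of i] Xab[of "Suc i"] i X by (auto simp: is_partition_def)
      have s1: "\<bar>\<sigma> i\<bar> = 1" by (simp add: \<sigma>_def)
      have sle: "\<sigma> i * y \<le> \<bar>y\<bar>" for y by (auto simp: \<sigma>_def)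
      have "(\<Sum>I\<in>?G. 2 * q * (snd I - fst I)) \<le> (\<Sum>(l, r)\<in>?G. ?h r - ?h l)"
      proof (rule sum_mono)
        fix I assume I: "I \<in> ?G"
        obtain l r where [simp]: "I = (l, r)" by fastforce
        have "l < r" using F(2) I by auto
        have lr: "X i < l" "r < X (Suc i)" "\<sigma> i * (g r - g l) \<le> - (q * (r - l))"
          using \<iota>[of I] I by auto
        have "\<bar>g r - g l\<bar> \<le> T r - T l" using lr Xi \<open>l < r\<close> by (intro T) auto
        moreover have "\<bar>g r - g l\<bar> = \<bar>\<sigma> i * (g r - g l)\<bar>" by (simp add: abs_mult s1)
        ultimately have "2 * (q * (r - l)) \<le> (T r - T l) - \<sigma> i * (g r - g l)"
          using lr(3) by linarith
        then show "2 * q * (snd I - fst I) \<le> (case I of (l, r) \<Rightarrow> ?h r - ?h l)"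
          by (simp add: algebra_simps)
      qed
      also have "\<dots> \<le> ?h (X (Suc i)) - ?h (X i)"
      proof (rule mono_sum_increments_le)
        show "finite ?G" using F(1) by simp
        show "\<forall>(l, r)\<in>?G. X i \<le> l \<and> l < r \<and> r \<le> X (Suc i)"
          using F(2) \<iota> by fastforce
        show "disjoint_intervals ?G"
          using dis by (rule disjoint_intervals_subset) auto
        show "mono_on {X i..X (Suc i)} ?h"
        proof (rule mono_onI)
          fix y z assume yz: "y \<in> {X i..X (Suc i)}" "z \<in> {X i..X (Suc i)}" "y \<le> z"
          have "\<sigma> i * (g z - g y) \<le> \<bar>g z - g y\<bar>" by (rule sle)
          also have "\<dots> \<le> T z - T y" using yz Xi by (intro T) auto
          finally show "?h y \<le> ?h z" by (simp add: algebra_simps)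
        qed
      qed (use Xi in auto)
      also have "\<dots> = T (X (Suc i)) - T (X i) - \<bar>g (X (Suc i)) - g (X i)\<bar>"
        by (auto simp: \<sigma>_def)
      finally show ?thesis .
    qed
    have "2 * q * (\<Sum>(l, r)\<in>F. r - l) = (\<Sum>I\<in>F. 2 * q * (snd I - fst I))"
      by (simp add: sum_distrib_left split_def)
    also have "\<dots> = (\<Sum>i<N. \<Sum>I | I \<in> F \<and> \<iota> I = i. 2 * q * (snd I - fst I))"
      by (rule sum.group[symmetric]) (use F \<iota> in auto)
    also have "\<dots> \<le> (\<Sum>i<N. T (X (Suc i)) - T (X i) - \<bar>g (X (Suc i)) - g (X i)\<bar>)"
      by (rule sum_mono) (use one in auto)
    also have "\<dots> = T (X N) - T (X 0) - partition_variation g N X"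
      using sum_lessThan_telescope[of "\<lambda>i. T (X i)" N]
      by (simp add: sum_subtractf partition_variation_def)
    also have "\<dots> \<le> 2 * q * e"
    proof -
      have "T (X N) = T b" "T (X 0) = 0" using X T0 by (auto simp: is_partition_def)
      then show ?thesis using var by linarith
    qed
    finally show "(\<Sum>(l, r)\<in>F. r - l) \<le> e" using q by simp
  qed
  moreover have "finite (X ` {..N})" by simp
  ultimately show "\<exists>N U. finite N \<and> ?S - N \<subseteq> U \<and> U \<in> lmeasurable \<and> measure lebesgue U \<le> e"
    by (elim exE) (rule exI, rule exI, rule conjI)
qed

lemma is_partition_diff_sum:
  assumes "is_partition a b N X"
  shows "(\<Sum>i<N. X (Suc i) - X i) = b - a"
  using assms sum_lessThan_telescope[of X N] by (simp add: is_partition_def)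

definition interval_family :: "real \<Rightarrow> real \<Rightarrow> (real \<times> real) set \<Rightarrow> bool" where
  "interval_family a b D \<longleftrightarrow> finite D \<and> (\<forall>(x, y)\<in>D. a \<le> x \<and> x \<le> y \<and> y \<le> b) \<and>
     disjoint_family_on (\<lambda>(x, y). {x<..<y}) D"

lemma abs_continuous_curve_alt:
  "abs_continuous_curve a b f \<longleftrightarrow> (\<forall>e>0. \<exists>d>0. \<forall>D. interval_family a b D \<and> (\<Sum>(x, y)\<in>D. y - x) < d \<longrightarrow>
     (\<Sum>(x, y)\<in>D. norm (f y - f x)) < e)"
  unfolding abs_continuous_curve_def interval_family_def conj_assoc ..

lemma abs_continuous_curve_short_variation:
  fixes f :: "real \<Rightarrow> real"
  assumes ac: "abs_continuous_curve a b f"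
  shows "\<exists>d>0. \<forall>c y N X. a \<le> c \<and> y \<le> b \<and> y - c < d \<and> is_partition c y N X \<longrightarrow>
    partition_variation f N X \<le> 1"
proof -
  obtain d where d: "0 < d" and D: "\<And>D. interval_family a b D \<Longrightarrow> (\<Sum>(x, y)\<in>D. y - x) < d \<Longrightarrow>
        (\<Sum>(x, y)\<in>D. norm (f y - f x)) < 1"
    using ac zero_less_one unfolding abs_continuous_curve_alt by blast
  show ?thesis
  proof (intro exI[of _ d] conjI allI impI d, elim conjE)
    fix c y N X assume cy: "a \<le> c" "y \<le> b" "y - c < d" and X: "is_partition c y N X"
    let ?D = "(\<lambda>i. (X i, X (Suc i))) ` {..<N}"
    have less: "X i < X j" if "i < j" "j \<le> N" for i j
    proof -
      have "X i < X (Suc i)" using that X by (auto simp: is_partition_def)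
      also have "\<dots> \<le> X j" using is_partition_mono[OF X] that by simp
      finally show ?thesis .
    qed
    have inj: "inj_on (\<lambda>i. (X i, X (Suc i))) {..<N}"
    proof (rule inj_onI)
      fix i j assume ij: "i \<in> {..<N}" "j \<in> {..<N}" "(X i, X (Suc i)) = (X j, X (Suc j))"
      show "i = j"
        using less[of i j] less[of j i] ij by (cases i j rule: linorder_cases) auto
    qed
    have bds: "c \<le> X i" "X i \<le> y" if "i \<le> N" for i
      using is_partition_mono[OF X, of 0 i] is_partition_mono[OF X, of i N] that X
      by (auto simp: is_partition_def)
    have "(\<Sum>(x, y)\<in>?D. norm (f y - f x)) < 1"
    proof (rule D)
      have "a \<le> x \<and> x \<le> z \<and> z \<le> b" if xz: "(x, z) \<in> ?D" for x z
      proof -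
        obtain i where "i < N" "x = X i" "z = X (Suc i)" using xz by (elim imageE) auto
        then show ?thesis using bds[of i] bds[of "Suc i"] less[of i "Suc i"] cy by auto
      qed
      then have ord: "\<forall>(x, z)\<in>?D. a \<le> x \<and> x \<le> z \<and> z \<le> b" by blast
      have "{X i<..<X (Suc i)} \<inter> {X j<..<X (Suc j)} = {}" if "i < j" "j < N" for i j
        using is_partition_mono[OF X, of "Suc i" j] that by auto
      then have dis: "{X i<..<X (Suc i)} \<inter> {X j<..<X (Suc j)} = {}" if "i \<noteq> j" "i < N" "j < N" for i j
        using that by (cases i j rule: linorder_cases) (blast, blast, blast)
      have "disjoint_family_on (\<lambda>(x, y). {x<..<y}) ?D"
        unfolding disjoint_family_on_def
      proof (intro ballI impI)
        fix I J assume "I \<in> ?D" "J \<in> ?D" "I \<noteq> J"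
        then obtain i j where "i < N" "j < N" "I = (X i, X (Suc i))" "J = (X j, X (Suc j))" "i \<noteq> j"
          by (elim imageE) auto
        then show "(case I of (x, y) \<Rightarrow> {x<..<y}) \<inter> (case J of (x, y) \<Rightarrow> {x<..<y}) = {}"
          using dis by simp
      qed
      then show "interval_family a b ?D" using ord by (simp add: interval_family_def)
      show "(\<Sum>(x, y)\<in>?D. y - x) < d"
        using is_partition_diff_sum[OF X] cy(3) by (simp add: sum.reindex[OF inj])
    qed
    then show "partition_variation f N X \<le> 1"
      by (simp add: sum.reindex[OF inj] partition_variation_def)
  qed
qed

text \<open>
  Intervals with slope at least \<open>V / e\<close> have total length at most \<open>e\<close>, because their
  increments are paid for by the total variation.
\<close>

lemma steep_points_negligible:
  fixes f T :: "real \<Rightarrow> real"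
  assumes T: "\<And>y z. a \<le> y \<Longrightarrow> y \<le> z \<Longrightarrow> z \<le> b \<Longrightarrow> \<bar>f z - f y\<bar> \<le> T z - T y"
  shows "negligible {x. a < x \<and> x < b \<and>
     (\<forall>M d. 0 < d \<longrightarrow> (\<exists>l r. l < r \<and> l \<le> x \<and> x \<le> r \<and> r - l < d \<and> M * (r - l) \<le> \<bar>f r - f l\<bar>))}"
    (is "negligible ?S")
proof (cases "a < b")
  case True
  define V where "V = T b - T a + 1"
  have V: "0 < V" using T[of a b] True unfolding V_def by auto
  show ?thesis
  proof (rule negligible_if_Vitali_intervals_short
      [where P="\<lambda>e l r. a \<le> l \<and> r \<le> b \<and> (V / e) * (r - l) \<le> \<bar>f r - f l\<bar>"])
    fix e x d :: real assume e: "0 < e" and x: "x \<in> ?S" and d: "0 < d"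
    define d' where "d' = min d (min (x - a) (b - x))"
    have "0 < d'" using d x by (auto simp: d'_def)
    then obtain l r where lr: "l < r" "l \<le> x" "x \<le> r" "r - l < d'" "V / e * (r - l) \<le> \<bar>f r - f l\<bar>"
      using x by blast
    have "a \<le> l" "r \<le> b" "r - l < d" using lr by (auto simp: d'_def)
    with lr show "\<exists>l r. l < r \<and> l \<le> x \<and> x \<le> r \<and> r - l < d \<and>
        a \<le> l \<and> r \<le> b \<and> (V / e) * (r - l) \<le> \<bar>f r - f l\<bar>" by blast
  next
    fix e and F :: "(real \<times> real) set"
    assume e: "0 < e" and F: "finite F"
      "\<forall>(l, r)\<in>F. l < r \<and> a \<le> l \<and> r \<le> b \<and> (V / e) * (r - l) \<le> \<bar>f r - f l\<bar>"
      "disjoint_intervals F"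
    have "(V / e) * (\<Sum>(l, r)\<in>F. r - l) = (\<Sum>(l, r)\<in>F. (V / e) * (r - l))"
      by (simp add: sum_distrib_left split_def)
    also have "\<dots> \<le> (\<Sum>(l, r)\<in>F. T r - T l)"
    proof (rule sum_mono)
      fix I assume I: "I \<in> F"
      obtain l r where lr: "I = (l, r)" by fastforce
      have "l < r" "a \<le> l" "r \<le> b" "(V / e) * (r - l) \<le> \<bar>f r - f l\<bar>" using F(2) I lr by auto
      then show "(case I of (l, r) \<Rightarrow> (V / e) * (r - l)) \<le> (case I of (l, r) \<Rightarrow> T r - T l)"
        using T[of l r] lr by auto
    qed
    also have "\<dots> \<le> T b - T a"
    proof (rule mono_sum_increments_le[OF F(1) _ F(3)])
      show "mono_on {a..b} T"
      proof (rule mono_onI)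
        fix y z assume "y \<in> {a..b}" "z \<in> {a..b}" "y \<le> z"
        then have "0 \<le> T z - T y" using T[of y z] abs_ge_zero[of "f z - f y"] by auto
        then show "T y \<le> T z" by simp
      qed
    qed (use F(2) True in auto)
    also have "\<dots> \<le> V" by (simp add: V_def)
    finally show "(\<Sum>(l, r)\<in>F. r - l) \<le> e" using V e by (simp add: field_simps)
  qed
next
  case False
  then show ?thesis by (intro negligible_subset[OF negligible_empty] subsetI) auto
qed

lemma convergent_if_no_rational_gap:
  fixes Q :: "real \<Rightarrow> real"
  assumes bdd: "eventually (\<lambda>y. \<bar>Q y\<bar> \<le> M) F" and nt: "F \<noteq> bot"
    and gap: "\<And>k1 k2 :: rat. k1 < k2 \<Longrightarrow> frequently (\<lambda>y. Q y < of_rat k1) F \<Longrightarrow>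
        frequently (\<lambda>y. of_rat k2 < Q y) F \<Longrightarrow> False"
  shows "\<exists>D. (Q \<longlongrightarrow> D) F"
proof -
  let ?A = "Limsup F (\<lambda>y. ereal (Q y))" and ?B = "Liminf F (\<lambda>y. ereal (Q y))"
  have "\<not> ?B < ?A"
  proof
    assume BA: "?B < ?A"
    then obtain k1 :: rat where k1: "?B < real_of_rat k1" "real_of_rat k1 < ?A" using ereal_dense3 by blast
    then obtain k2 :: rat where k2: "real_of_rat k1 < ereal (real_of_rat k2)" "real_of_rat k2 < ?A"
      using ereal_dense3 by blast
    have "k1 < k2" using k2(1) by (simp add: of_rat_less)
    moreover have "frequently (\<lambda>y. Q y < of_rat k1) F"
    proof (rule ccontr)
      assume "\<not> ?thesis"
      then have "eventually (\<lambda>y. ereal (of_rat k1) \<le> ereal (Q y)) F"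
        by (simp add: not_frequently not_less)
      then show False using Liminf_bounded k1(1) by (metis not_less)
    qed
    moreover have "frequently (\<lambda>y. of_rat k2 < Q y) F"
    proof (rule ccontr)
      assume "\<not> ?thesis"
      then have "eventually (\<lambda>y. ereal (Q y) \<le> ereal (of_rat k2)) F"
        by (simp add: not_frequently not_less)
      then show False using Limsup_bounded k2(2) by (metis not_less)
    qed
    ultimately show False by (rule gap)
  qed
  with Liminf_le_Limsup[of F "\<lambda>y. ereal (Q y)"] nt have eq: "?B = ?A" by (simp add: trivial_limit_def)
  have "?A \<le> ereal M"
    by (rule Limsup_bounded) (use bdd in \<open>auto elim!: eventually_mono\<close>)
  moreover have "ereal (- M) \<le> ?B"
    by (rule Liminf_bounded) (use bdd in \<open>auto elim!: eventually_mono\<close>)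
  ultimately obtain D where "?A = ereal D" using eq by (cases ?A) auto
  then have "((\<lambda>y. ereal (Q y)) \<longlongrightarrow> ereal D) F"
    using eq nt by (intro Liminf_eq_Limsup) auto
  then show ?thesis by auto
qed

text \<open>
  Where the difference quotients are bounded and do not converge, some rational line \<open>k x\<close>
  separates their lower and upper limits, and \<open>f - k x\<close> has slopes of both signs there.
\<close>

lemma bounded_variation_differentiable_ae:
  fixes f :: "real \<Rightarrow> real"
  assumes ab: "a < b"
    and bd: "\<forall>y N X. a \<le> y \<and> y \<le> b \<and> is_partition a y N X \<longrightarrow> partition_variation f N X \<le> B"
  shows "negligible {x. a < x \<and> x < b \<and> \<not> f differentiable (at x)}"
proof -
  obtain T where T: "\<And>y z. a \<le> y \<Longrightarrow> y \<le> z \<Longrightarrow> z \<le> b \<Longrightarrow> \<bar>f z - f y\<bar> \<le> T z - T y"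
    by (rule bounded_variation_function[OF bd ab]) (rule that)
  define S1 where "S1 = {x. a < x \<and> x < b \<and>
     (\<forall>M d. 0 < d \<longrightarrow> (\<exists>l r. l < r \<and> l \<le> x \<and> x \<le> r \<and> r - l < d \<and> M * (r - l) \<le> \<bar>f r - f l\<bar>))}"
  define g where "g k x = f x - k * x" for k x
  define S2 where "S2 k q = {x. a < x \<and> x < b \<and>
     (\<forall>d>0. \<exists>l r. l < r \<and> l \<le> x \<and> x \<le> r \<and> r - l < d \<and> q * (r - l) \<le> g k r - g k l) \<and>
     (\<forall>d>0. \<exists>l r. l < r \<and> l \<le> x \<and> x \<le> r \<and> r - l < d \<and> g k r - g k l \<le> - (q * (r - l)))}" for k q
  have n1: "negligible S1" unfolding S1_def using T by (rule steep_points_negligible)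
  have n2: "negligible (S2 k q)" if q: "0 < q" for k q
  proof -
    have bdg: "\<forall>y N X. a \<le> y \<and> y \<le> b \<and> is_partition a y N X \<longrightarrow>
        partition_variation (g k) N X \<le> B + \<bar>k\<bar> * (b - a)"
    proof (intro allI impI, elim conjE)
      fix y N X assume y: "a \<le> y" "y \<le> b" "is_partition a y N X"
      have "partition_variation (g k) N X \<le> (\<Sum>i<N. \<bar>f (X (Suc i)) - f (X i)\<bar> + \<bar>k\<bar> * (X (Suc i) - X i))"
        unfolding partition_variation_def
      proof (rule sum_mono)
        fix i assume "i \<in> {..<N}"
        then have "X i < X (Suc i)" using y by (auto simp: is_partition_def)
        then have "\<bar>k * (X (Suc i) - X i)\<bar> = \<bar>k\<bar> * (X (Suc i) - X i)" by (simp add: abs_mult)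
        moreover have "g k (X (Suc i)) - g k (X i) = (f (X (Suc i)) - f (X i)) - k * (X (Suc i) - X i)"
          by (simp add: g_def algebra_simps)
        ultimately show "\<bar>g k (X (Suc i)) - g k (X i)\<bar> \<le> \<bar>f (X (Suc i)) - f (X i)\<bar> + \<bar>k\<bar> * (X (Suc i) - X i)"
          using abs_triangle_ineq4 by metis
      qed
      also have "\<dots> = partition_variation f N X + \<bar>k\<bar> * (y - a)"
        using is_partition_diff_sum[OF y(3)]
        by (simp add: sum.distrib partition_variation_def sum_distrib_left[symmetric])
      also have "\<dots> \<le> B + \<bar>k\<bar> * (b - a)"
        using bd y by (intro add_mono mult_left_mono) auto
      finally show "partition_variation (g k) N X \<le> B + \<bar>k\<bar> * (b - a)" .
    qed
    obtain Tg where Tg: "Tg a = 0"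
      "\<And>y z. a \<le> y \<Longrightarrow> y \<le> z \<Longrightarrow> z \<le> b \<Longrightarrow> \<bar>g k z - g k y\<bar> \<le> Tg z - Tg y"
      "\<And>e. 0 < e \<Longrightarrow> \<exists>N X. is_partition a b N X \<and> Tg b - e < partition_variation (g k) N X"
      by (rule bounded_variation_function[OF bdg ab]) (rule that)
    show ?thesis unfolding S2_def by (rule Austin_two_slopes_negligible[OF Tg q])
  qed
  have "negligible (\<Union>p\<in>{p :: rat \<times> rat. 0 < snd p}. S2 (of_rat (fst p)) (of_rat (snd p)))"
  proof (rule negligible_countable_Union)
    show "countable ((\<lambda>p. S2 (of_rat (fst p)) (of_rat (snd p))) ` {p :: rat \<times> rat. 0 < snd p})"
      by simp
  qed (use n2 in auto)
  then have "negligible (S1 \<union> (\<Union>p\<in>{p :: rat \<times> rat. 0 < snd p}. S2 (of_rat (fst p)) (of_rat (snd p))))"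
    using n1 by simp
  moreover have "{x. a < x \<and> x < b \<and> \<not> f differentiable (at x)} \<subseteq>
      S1 \<union> (\<Union>p\<in>{p :: rat \<times> rat. 0 < snd p}. S2 (of_rat (fst p)) (of_rat (snd p)))"
  proof (rule subsetI, rule ccontr)
    fix x assume x: "x \<in> {x. a < x \<and> x < b \<and> \<not> f differentiable (at x)}"
      and nx: "x \<notin> S1 \<union> (\<Union>p\<in>{p :: rat \<times> rat. 0 < snd p}. S2 (of_rat (fst p)) (of_rat (snd p)))"
    define Q where "Q y = (f y - f x) / (y - x)" for y
    have "x \<notin> S1" using nx by blast
    then obtain M d where M: "0 < d" "\<And>l r. l < r \<Longrightarrow> l \<le> x \<Longrightarrow> x \<le> r \<Longrightarrow> r - l < d \<Longrightarrow> \<bar>f r - f l\<bar> < M * (r - l)"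
      using x unfolding S1_def mem_Collect_eq not_le[symmetric] by blast
    have "\<exists>D. (Q \<longlongrightarrow> D) (at x)"
    proof (rule convergent_if_no_rational_gap)
      have "\<bar>Q y\<bar> \<le> M" if y: "y \<noteq> x" "dist y x < d" for y
        using M(2)[of "min x y" "max x y"] y
        by (cases "x < y") (auto simp: Q_def dist_real_def field_simps abs_minus_commute)
      then show "eventually (\<lambda>y. \<bar>Q y\<bar> \<le> M) (at x)"
        unfolding eventually_at using M(1) by auto
      fix k1 k2 :: rat
      assume k: "k1 < k2" and f1: "frequently (\<lambda>y. Q y < of_rat k1) (at x)"
        and f2: "frequently (\<lambda>y. of_rat k2 < Q y) (at x)"
      define k where "k = (k1 + k2) / 2"
      define q where "q = (k2 - k1) / 2"
      have "0 < q" using k by (simp add: q_def)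
      have k1: "real_of_rat k1 = of_rat k - of_rat q" and k2: "real_of_rat k2 = of_rat k + of_rat q"
        unfolding k_def q_def by (simp_all flip: of_rat_diff of_rat_add add: field_simps)
      have "x \<in> S2 (of_rat k) (of_rat q)"
        unfolding S2_def
      proof (intro CollectI conjI allI impI)
        show "a < x" "x < b" using x by auto
        fix d :: real assume d: "0 < d"
        obtain y where y: "y \<noteq> x" "dist y x < d" "of_rat k2 < Q y"
          using f2 d unfolding frequently_at by blast
        show "\<exists>l r. l < r \<and> l \<le> x \<and> x \<le> r \<and> r - l < d \<and>
            of_rat q * (r - l) \<le> g (of_rat k) r - g (of_rat k) l"
          by (rule exI[of _ "min x y"], rule exI[of _ "max x y"])
             (use y in \<open>cases "x < y"; auto simp: Q_def g_def k2 dist_real_def field_simps\<close>)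
        obtain y where y: "y \<noteq> x" "dist y x < d" "Q y < of_rat k1"
          using f1 d unfolding frequently_at by blast
        show "\<exists>l r. l < r \<and> l \<le> x \<and> x \<le> r \<and> r - l < d \<and>
            g (of_rat k) r - g (of_rat k) l \<le> - (of_rat q * (r - l))"
          by (rule exI[of _ "min x y"], rule exI[of _ "max x y"])
             (use y in \<open>cases "x < y"; auto simp: Q_def g_def k1 dist_real_def field_simps\<close>)
      qed
      then show False using nx \<open>0 < q\<close> by force
    qed simp
    then obtain D where "(Q \<longlongrightarrow> D) (at x)" by blast
    then have "(f has_field_derivative D) (at x)"
      unfolding has_field_derivative_iff Q_def .
    then have "f differentiable (at x)" by (auto simp: real_differentiable_def)
    then show False using x by simp
  qed
  ultimately show ?thesis by (rule negligible_subset)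
qed

text \<open>
  On intervals shorter than the \<open>d\<close> that absolute continuity provides for tolerance 1 the
  variation is at most 1, and being negligible is a local property.
\<close>

theorem abs_continuous_real_differentiable_ae:
  fixes f :: "real \<Rightarrow> real"
  assumes ac: "abs_continuous_curve a b f"
  shows "negligible {x. a < x \<and> x < b \<and> \<not> f differentiable (at x)}" (is "negligible ?S")
proof (subst locally_negligible_alt, rule ballI)
  obtain d where d: "0 < d" and var: "\<And>c y N X. a \<le> c \<and> y \<le> b \<and> y - c < d \<and> is_partition c y N X \<Longrightarrow>
    partition_variation f N X \<le> 1"
    using abs_continuous_curve_short_variation[OF ac] by blast
  fix x assume x: "x \<in> ?S"
  define l where "l = max a (x - d / 4)"
  define r where "r = min b (x + d / 4)"
  have lr: "a \<le> l" "l < x" "x < r" "r \<le> b" "r - l < d" using x d by (auto simp: l_def r_def)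
  have "negligible {x. l < x \<and> x < r \<and> \<not> f differentiable (at x)}"
  proof (rule bounded_variation_differentiable_ae)
    show "l < r" using lr by simp
    show "\<forall>y N X. l \<le> y \<and> y \<le> r \<and> is_partition l y N X \<longrightarrow> partition_variation f N X \<le> 1"
    proof (intro allI impI)
      fix y N X assume "l \<le> y \<and> y \<le> r \<and> is_partition l y N X"
      then show "partition_variation f N X \<le> 1"
        using lr by (intro var[of l y]) auto
    qed
  qed
  then have "negligible (?S \<inter> {l<..<r})"
    by (rule negligible_subset) auto
  moreover have "openin (top_of_set ?S) (?S \<inter> {l<..<r})" by (intro openin_open_Int) simp
  ultimately show "\<exists>U. openin (top_of_set ?S) U \<and> x \<in> U \<and> negligible U"
    using x lr by (intro exI[of _ "?S \<inter> {l<..<r}"]) auto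
qed

section \<open>The fundamental theorem of calculus for absolutely continuous curves\<close>

lemma interval_family_total_length_le:
  assumes D: "interval_family a b D" and U: "U \<in> lmeasurable" "\<And>x y. (x, y) \<in> D \<Longrightarrow> {x<..<y} \<subseteq> U"
  shows "(\<Sum>(x, y)\<in>D. y - x) \<le> measure lebesgue U"
proof -
  let ?I = "\<lambda>(x, y). {x<..<y::real}"
  have "(\<Sum>(x, y)\<in>D. y - x) = (\<Sum>p\<in>D. measure lebesgue (?I p))"
    by (rule sum.cong) (use D in \<open>auto simp: interval_family_def\<close>)
  also have "\<dots> = measure lebesgue (\<Union>p\<in>D. ?I p)"
    by (rule measure_finite_Union[symmetric])
       (use D in \<open>auto simp: interval_family_def\<close>)
  also have "\<dots> \<le> measure lebesgue U"
  proof (rule measure_mono_fmeasurable)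
    show "(\<Union>p\<in>D. ?I p) \<subseteq> U" using U(2) by auto
    show "(\<Union>p\<in>D. ?I p) \<in> sets lebesgue"
      by (rule sets.finite_UN) (use D in \<open>auto simp: interval_family_def\<close>)
  qed (rule U)
  finally show ?thesis .
qed

text \<open>
  The gauge is the usual one at points of differentiability, and on \<open>N\<close> an open neighbourhood
  \<open>U\<close> of small measure. Cells tagged in \<open>N\<close> lie in \<open>U\<close>, so absolute continuity makes the sum of
  their increments small.
\<close>

theorem abs_continuous_has_integral_derivative:
  fixes f :: "real \<Rightarrow> 'x::real_normed_vector"
  assumes ab: "a \<le> b" and ac: "abs_continuous_curve a b f" and N: "negligible N"
    and der: "\<And>x. x \<in> {a..b} - N \<Longrightarrow> (f has_vector_derivative f' x) (at x within {a..b})"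
  shows "(f' has_integral f b - f a) {a..b}"
proof -
  define g where "g x = (if x \<in> N then 0 else f' x)" for x
  have "(g has_integral f b - f a) {a..b}"
    unfolding has_integral_real
  proof (intro allI impI)
    fix e :: real assume e: "0 < e"
    define e1 where "e1 = e / (2 * (b - a + 1))"
    have e1: "0 < e1" "e1 * (b - a) < e / 2"
      using e ab by (auto simp: e1_def field_simps)
    have "\<exists>d>0. x \<in> {a..b} - N \<longrightarrow>
         (\<forall>y\<in>{a..b}. norm (y-x) < d \<longrightarrow> norm (f y - f x - (y-x) *\<^sub>R f' x) \<le> e1 * norm (y-x))" for x
      using der[of x] e1(1) unfolding has_vector_derivative_def has_derivative_within_alt
      by (cases "x \<in> {a..b} - N") (auto intro: zero_less_one)
    then obtain d where d: "\<And>x. 0 < d x"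
      "\<And>x y. x \<in> {a..b} - N \<Longrightarrow> y \<in> {a..b} \<Longrightarrow> norm (y-x) < d x
         \<Longrightarrow> norm (f y - f x - (y-x) *\<^sub>R f' x) \<le> e1 * norm (y-x)"
      by metis
    obtain \<eta> where \<eta>: "0 < \<eta>" and AC: "\<And>D. interval_family a b D \<Longrightarrow> (\<Sum>(x, y)\<in>D. y - x) < \<eta> \<Longrightarrow>
        (\<Sum>(x, y)\<in>D. norm (f y - f x)) < e / 2"
      using ac half_gt_zero[OF e] unfolding abs_continuous_curve_alt by blast
    obtain U where U: "open U" "N \<subseteq> U" "U - N \<in> lmeasurable" "emeasure lebesgue (U - N) < ennreal \<eta>"
      using sets_lebesgue_outer_open[OF negligible_imp_sets[OF N] \<eta>] by metis
    have Um: "U \<in> lmeasurable"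
    proof -
      have "(U - N) \<union> N \<in> lmeasurable" using U(3) negligible_imp_measurable[OF N] by (rule fmeasurable.Un)
      moreover have "(U - N) \<union> N = U" using U(2) by blast
      ultimately show ?thesis by simp
    qed
    have mU: "measure lebesgue U < \<eta>"
    proof -
      have "measure lebesgue U \<le> measure lebesgue (U - N) + measure lebesgue N"
        using measure_Un_le[of "U - N" lebesgue N] U(2,3) negligible_imp_sets[OF N]
        by (simp add: fmeasurableD Un_absorb2)
      moreover have "measure lebesgue (U - N) < \<eta>"
        using U(4) \<eta> unfolding emeasure_eq_measure2[OF U(3)] by (simp add: ennreal_less_iff)
      ultimately show ?thesis using negligible_imp_measure0[OF N] by simp
    qed
    define \<gamma> where "\<gamma> x = (if x \<in> N then U else ball x (d x))" for x
    show "\<exists>\<gamma>. gauge \<gamma> \<and> (\<forall>\<D>. \<D> tagged_division_of {a..b} \<and> \<gamma> fine \<D> \<longrightarrow>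
        norm ((\<Sum>(x, k)\<in>\<D>. measure lborel k *\<^sub>R g x) - (f b - f a)) < e)"
    proof (intro exI[of _ \<gamma>] conjI allI impI, goal_cases)
      case 1
      show ?case using U(1,2) d(1) by (auto simp: gauge_def \<gamma>_def)
    next
      case (2 p)
      then have p: "p tagged_division_of {a..b}" and fine: "\<gamma> fine p" by auto
      note pD = tagged_division_ofD[OF p]
      let ?err = "\<lambda>(x, K). measure lborel K *\<^sub>R g x - (f (Sup K) - f (Inf K))"
      let ?pN = "{t \<in> p. fst t \<in> N}"
      have interval: "\<exists>u v. K = {u..v} \<and> u \<le> v \<and> a \<le> u \<and> v \<le> b \<and> u \<le> x \<and> x \<le> v" if xK: "(x, K) \<in> p" for x K
      proof -
        obtain u v where "K = {u..v}" using pD(4)[OF xK] by (auto simp: box_real)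
        then show ?thesis using pD(2,3)[OF xK] by auto
      qed
      have fineD: "K \<subseteq> \<gamma> x" if "(x, K) \<in> p" for x K
        using fine that by (auto simp: fine_def)
      have good: "norm (?err t) \<le> e1 * (case t of (x, K) \<Rightarrow> Sup K - Inf K)" if t: "t \<in> p - ?pN" for t
      proof -
        obtain x K where xK: "t = (x, K)" by fastforce
        then obtain u v where K: "K = {u..v}" "u \<le> v" "a \<le> u" "v \<le> b" "u \<le> x" "x \<le> v"
          using interval t by blast
        have xN: "x \<in> {a..b} - N" using t xK K by auto
        have "K \<subseteq> ball x (d x)" using fineD[of x K] t xK xN by (simp add: \<gamma>_def)
        moreover have "u \<in> K" "v \<in> K" using K by simp_all
        ultimately have "u \<in> ball x (d x)" "v \<in> ball x (d x)" by blast+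
        then have uv: "norm (u - x) < d x" "norm (v - x) < d x"
          by (simp_all add: dist_real_def abs_minus_commute)
        have "norm ((v - u) *\<^sub>R f' x - (f v - f u))
            = norm ((f u - f x - (u - x) *\<^sub>R f' x) - (f v - f x - (v - x) *\<^sub>R f' x))"
          by (rule arg_cong[of _ _ norm]) (simp add: algebra_simps)
        also have "\<dots> \<le> norm (f u - f x - (u - x) *\<^sub>R f' x) + norm (f v - f x - (v - x) *\<^sub>R f' x)"
          by (rule norm_triangle_ineq4)
        also have "\<dots> \<le> e1 * norm (u - x) + e1 * norm (v - x)"
          using xN K uv by (intro add_mono d(2)) auto
        also have "\<dots> = e1 * (v - u)" using K by (simp add: algebra_simps)
        finally show ?thesis using K xN by (simp add: xK g_def)
      qed
      have "norm (\<Sum>t\<in>p - ?pN. ?err t) \<le> (\<Sum>t\<in>p - ?pN. e1 * (case t of (x, K) \<Rightarrow> Sup K - Inf K))"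
        by (rule sum_norm_le) (use good in auto)
      also have "\<dots> \<le> (\<Sum>t\<in>p. e1 * (case t of (x, K) \<Rightarrow> Sup K - Inf K))"
      proof (rule sum_mono2)
        show "0 \<le> e1 * (case t of (x, K) \<Rightarrow> Sup K - Inf K)" if t: "t \<in> p - (p - ?pN)" for t
        proof -
          obtain x K where xK: "t = (x, K)" by fastforce
          then obtain u v where K: "K = {u..v}" "u \<le> v" using interval t by blast
          then show ?thesis using e1 by (simp add: xK)
        qed
      qed (use pD(1) in auto)
      also have "\<dots> = e1 * (b - a)"
        using additive_tagged_division_1[OF ab p, of "\<lambda>x. x"]
        by (simp add: sum_distrib_left[symmetric])
      finally have sum_good: "norm (\<Sum>t\<in>p - ?pN. ?err t) < e / 2" using e1(2) by simp
      have "norm (\<Sum>t\<in>?pN. ?err t) < e / 2"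
      proof -
        \<comment> \<open>degenerate cells have zero increment; the others are determined by their endpoints\<close>
        let ?q = "{t \<in> ?pN. interior (snd t) \<noteq> {}}"
        let ?\<iota> = "\<lambda>t. (Inf (snd t), Sup (snd t))"
        have qI: "\<exists>x u v. t = (x, {u..v}) \<and> x \<in> N \<and> u < v \<and> a \<le> u \<and> v \<le> b \<and> {u..v} \<subseteq> U" if t: "t \<in> ?q" for t
        proof -
          obtain x K where xK: "t = (x, K)" by fastforce
          then obtain u v where K: "K = {u..v}" "u \<le> v" "a \<le> u" "v \<le> b" "u \<le> x" "x \<le> v"
            using interval t by blast
          have "K \<subseteq> U" using fineD[of x K] t xK by (simp add: \<gamma>_def)
          moreover have "u < v" using t xK K by auto
          ultimately show ?thesis using K xK t by auto
        qed
        have sep: "interior (snd s) \<inter> interior (snd t) = {}" if "s \<in> ?q" "t \<in> ?q" "s \<noteq> t" for s t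
          using pD(5)[of "fst s" "snd s" "fst t" "snd t"] that by (auto simp: prod_eq_iff)
        have inj: "inj_on ?\<iota> ?q"
        proof (rule inj_onI, rule ccontr)
          fix s t assume st: "s \<in> ?q" "t \<in> ?q" "?\<iota> s = ?\<iota> t" "s \<noteq> t"
          obtain x u v where s: "s = (x, {u..v})" "u < v" using qI[OF st(1)] by blast
          obtain y u' v' where t: "t = (y, {u'..v'})" "u' < v'" using qI[OF st(2)] by blast
          have "interior (snd s) \<inter> interior (snd t) = {u<..<v}" using s t st(3) by simp
          then show False using sep[OF st(1,2,4)] s(2) by simp
        qed
        have fin: "finite ?q" using pD(1) by simp
        have elt: "\<exists>x. (x, {u..v}) \<in> ?q \<and> u < v \<and> a \<le> u \<and> v \<le> b \<and> {u..v} \<subseteq> U" if uv: "(u, v) \<in> ?\<iota> ` ?q" for u v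
        proof -
          obtain t where t: "t \<in> ?q" "(u, v) = ?\<iota> t" using uv by (elim imageE)
          obtain x u' v' where "t = (x, {u'..v'})" "u' < v'" "a \<le> u'" "v' \<le> b" "{u'..v'} \<subseteq> U"
            using qI[OF t(1)] by blast
          then show ?thesis using t by (intro exI[of _ x]) auto
        qed
        have fam: "interval_family a b (?\<iota> ` ?q)"
          unfolding interval_family_def
        proof (intro conjI)
          have "a \<le> u \<and> u \<le> v \<and> v \<le> b" if "(u, v) \<in> ?\<iota> ` ?q" for u v
            using elt[OF that] by auto
          then show "\<forall>(u, v)\<in>?\<iota> ` ?q. a \<le> u \<and> u \<le> v \<and> v \<le> b" by blast
          show "disjoint_family_on (\<lambda>(x, y). {x<..<y}) (?\<iota> ` ?q)"
            unfolding disjoint_family_on_def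
          proof (intro ballI impI)
            fix I J assume IJ: "I \<in> ?\<iota> ` ?q" "J \<in> ?\<iota> ` ?q" "I \<noteq> J"
            obtain u v u' v' where I: "I = (u, v)" and J: "J = (u', v')" by fastforce
            obtain x where x: "(x, {u..v}) \<in> ?q" using elt IJ(1) I by blast
            obtain y where y: "(y, {u'..v'}) \<in> ?q" using elt IJ(2) J by blast
            have "u < v" "u' < v'" using elt IJ I J by blast+
            then have "(x, {u..v}) \<noteq> (y, {u'..v'})" using IJ(3) I J by auto
            from sep[OF x y this] show "(case I of (x, y) \<Rightarrow> {x<..<y}) \<inter> (case J of (x, y) \<Rightarrow> {x<..<y}) = {}"
              by (simp only: I J prod.case snd_conv interior_atLeastAtMost_real)
          qed
        qed (use fin in simp)
        have "(\<Sum>(x, y)\<in>?\<iota> ` ?q. y - x) \<le> measure lebesgue U"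
        proof (rule interval_family_total_length_le[OF fam Um])
          show "{u<..<v} \<subseteq> U" if "(u, v) \<in> ?\<iota> ` ?q" for u v
            using elt[OF that] greaterThanLessThan_subseteq_atLeastAtMost_iff[of u v u v] by auto
        qed
        then have A: "(\<Sum>(x, y)\<in>?\<iota> ` ?q. norm (f y - f x)) < e / 2"
          using AC[OF fam] mU by simp
        have B: "(\<Sum>t\<in>?pN. ?err t) = (\<Sum>t\<in>?q. ?err t)"
        proof (rule sum.mono_neutral_right)
          show "\<forall>t\<in>?pN - ?q. ?err t = 0"
          proof
            fix t assume t: "t \<in> ?pN - ?q"
            obtain x K where xK: "t = (x, K)" by fastforce
            then obtain u v where K: "K = {u..v}" "u \<le> v" using interval t by blast
            have "u = v" using t xK K by (auto simp: interior_atLeastAtMost_real not_less)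
            then show "?err t = 0" using xK K by simp
          qed
        qed (use pD(1) in auto)
        have C: "norm (\<Sum>t\<in>?q. ?err t) \<le> (\<Sum>t\<in>?q. norm (f (Sup (snd t)) - f (Inf (snd t))))"
        proof (rule sum_norm_le)
          fix t assume "t \<in> ?q"
          then show "norm (?err t) \<le> norm (f (Sup (snd t)) - f (Inf (snd t)))"
            by (cases t) (simp add: g_def norm_minus_commute)
        qed
        have D: "(\<Sum>(x, y)\<in>?\<iota> ` ?q. norm (f y - f x)) = (\<Sum>t\<in>?q. norm (f (Sup (snd t)) - f (Inf (snd t))))"
          by (subst sum.reindex[OF inj]) simp
        show ?thesis unfolding B using C A unfolding D by (rule le_less_trans)
      qed
      with sum_good have "norm (\<Sum>t\<in>p - ?pN. ?err t) + norm (\<Sum>t\<in>?pN. ?err t) < e / 2 + e / 2"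
        by (rule add_strict_mono)
      with norm_triangle_ineq have "norm ((\<Sum>t\<in>p - ?pN. ?err t) + (\<Sum>t\<in>?pN. ?err t)) < e / 2 + e / 2"
        by (rule le_less_trans)
      moreover have "(\<Sum>t\<in>p. ?err t) = (\<Sum>t\<in>p - ?pN. ?err t) + (\<Sum>t\<in>?pN. ?err t)"
        by (rule sum.subset_diff) (use pD(1) in auto)
      moreover have "(\<Sum>t\<in>p. ?err t) = (\<Sum>(x, k)\<in>p. measure lborel k *\<^sub>R g x) - (f b - f a)"
        using additive_tagged_division_1[OF ab p, of f] by (simp add: split_def sum_subtractf)
      ultimately show ?case by simp
    qed
  qed
  then show ?thesis by (rule has_integral_spike[OF N, rotated]) (simp add: g_def)
qed

section \<open>Differentiation of indefinite Henstock-Kurzweil integrals\<close>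

text \<open>
  Intervals with an endpoint \<open>x\<close> on which \<open>F\<close> deviates from slope \<open>f x\<close> by at least \<open>c\<close>
  form, when disjoint and fine, a tagged partial division. Henstock's lemma bounds the sum of the
  deviations by \<open>e c\<close>, so the total length is at most \<open>e\<close>.
\<close>

theorem indefinite_integral_has_derivative_ae:
  fixes f :: "real \<Rightarrow> real"
  assumes f: "f integrable_on {a..b}"
  shows "negligible {x. a < x \<and> x < b \<and>
     \<not> ((\<lambda>s. integral {a..s} f) has_real_derivative f x) (at x)}"
proof -
  define F where "F s = integral {a..s} f" for s
  define S where "S c = {x. a < x \<and> x < b \<and> (\<forall>d>0. \<exists>l r. l < r \<and> r - l < d \<and> (x = l \<or> x = r) \<and>
      c * (r - l) \<le> \<bar>F r - F l - (r - l) * f x\<bar>)}" for c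
  have Fdiff: "F r - F l = integral {l..r} f" if lr: "a \<le> l" "l \<le> r" "r \<le> b" for l r
  proof -
    have "f integrable_on {a..r}" using f lr by (auto intro: integrable_subinterval_real)
    then have "F l + integral {l..r} f = F r" unfolding F_def
      using lr by (intro Henstock_Kurzweil_Integration.integral_combine) auto
    then show ?thesis by simp
  qed
  have neg: "negligible (S c)" if c: "0 < c" for c
  proof -
    have "\<exists>\<gamma>. 0 < e \<longrightarrow> gauge \<gamma> \<and> (\<forall>p. p tagged_partial_division_of {a..b} \<longrightarrow> \<gamma> fine p \<longrightarrow>
        (\<Sum>(x, k)\<in>p. norm (measure lborel k *\<^sub>R f x - integral k f)) < e * c)" for e
    proof (cases "0 < e")
      case True
      then have ec: "0 < e * c" using c by simp
      have f': "f integrable_on cbox a b" using f by simp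
      obtain \<gamma> where "gauge \<gamma>" "\<And>p. p tagged_partial_division_of (cbox a b) \<Longrightarrow> \<gamma> fine p \<Longrightarrow>
          (\<Sum>(x, k)\<in>p. norm (measure lborel k *\<^sub>R f x - integral k f)) < e * c"
        by (rule Henstock_lemma[OF f' ec]) (rule that)
      then show ?thesis unfolding box_real by (intro exI[of _ \<gamma>]) simp
    qed simp
    then have "\<exists>\<gamma>. \<forall>e. 0 < e \<longrightarrow> gauge (\<gamma> e) \<and> (\<forall>p. p tagged_partial_division_of {a..b} \<longrightarrow> \<gamma> e fine p \<longrightarrow>
        (\<Sum>(x, k)\<in>p. norm (measure lborel k *\<^sub>R f x - integral k f)) < e * c)"
      by (intro choice allI)
    then obtain \<gamma> where \<gamma>: "\<And>e. 0 < e \<Longrightarrow> gauge (\<gamma> e)"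
      "\<And>e p. 0 < e \<Longrightarrow> p tagged_partial_division_of {a..b} \<Longrightarrow> \<gamma> e fine p \<Longrightarrow>
        (\<Sum>(x, k)\<in>p. norm (measure lborel k *\<^sub>R f x - integral k f)) < e * c"
      by blast
    show ?thesis
    proof (rule negligible_if_Vitali_intervals_short[where P="\<lambda>e l r. a \<le> l \<and> r \<le> b \<and>
        (\<exists>x. (x = l \<or> x = r) \<and> {l..r} \<subseteq> \<gamma> e x \<and> c * (r - l) \<le> \<bar>F r - F l - (r - l) * f x\<bar>)"])
      fix e x d :: real assume e: "0 < e" and x: "x \<in> S c" and d: "0 < d"
      obtain d1 where d1: "0 < d1" "ball x d1 \<subseteq> \<gamma> e x"
        using gaugeD[OF \<gamma>(1)[OF e]] open_contains_ball by blast
      define d' where "d' = min (min d d1) (min (x - a) (b - x))"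
      have "0 < d'" using d d1 x by (auto simp: d'_def S_def)
      then obtain l r where lr: "l < r" "r - l < d'" "x = l \<or> x = r"
          "c * (r - l) \<le> \<bar>F r - F l - (r - l) * f x\<bar>"
        using x unfolding S_def by blast
      have "{l..r} \<subseteq> ball x d1" using lr by (auto simp: dist_real_def d'_def)
      then have sub: "{l..r} \<subseteq> \<gamma> e x" using d1(2) by (rule order_trans)
      have "l \<le> x" "x \<le> r" "r - l < d" "a \<le> l" "r \<le> b" using lr by (auto simp: d'_def)
      show "\<exists>l r. l < r \<and> l \<le> x \<and> x \<le> r \<and> r - l < d \<and> a \<le> l \<and> r \<le> b \<and>
          (\<exists>x. (x = l \<or> x = r) \<and> {l..r} \<subseteq> \<gamma> e x \<and> c * (r - l) \<le> \<bar>F r - F l - (r - l) * f x\<bar>)"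
      proof (rule exI[of _ l], rule exI[of _ r], intro conjI)
        show "\<exists>x. (x = l \<or> x = r) \<and> {l..r} \<subseteq> \<gamma> e x \<and> c * (r - l) \<le> \<bar>F r - F l - (r - l) * f x\<bar>"
          using lr(3,4) sub by (intro exI[of _ x] conjI)
      qed fact+
    next
      fix e and G :: "(real \<times> real) set"
      assume e: "0 < e" and G: "finite G"
        "\<forall>(l, r)\<in>G. l < r \<and> a \<le> l \<and> r \<le> b \<and>
          (\<exists>x. (x = l \<or> x = r) \<and> {l..r} \<subseteq> \<gamma> e x \<and> c * (r - l) \<le> \<bar>F r - F l - (r - l) * f x\<bar>)"
        "disjoint_intervals G"
      have "\<forall>I\<in>G. \<exists>x. (x = fst I \<or> x = snd I) \<and> {fst I..snd I} \<subseteq> \<gamma> e x \<and>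
          c * (snd I - fst I) \<le> \<bar>F (snd I) - F (fst I) - (snd I - fst I) * f x\<bar>"
        using G(2) by fastforce
      then obtain \<tau> where \<tau>: "\<And>I. I \<in> G \<Longrightarrow> (\<tau> I = fst I \<or> \<tau> I = snd I) \<and> {fst I..snd I} \<subseteq> \<gamma> e (\<tau> I) \<and>
          c * (snd I - fst I) \<le> \<bar>F (snd I) - F (fst I) - (snd I - fst I) * f (\<tau> I)\<bar>"
        by metis
      have ord: "a \<le> fst I \<and> fst I < snd I \<and> snd I \<le> b" if "I \<in> G" for I using G(2) that by auto
      let ?\<iota> = "\<lambda>I. (\<tau> I, {fst I..snd I})"
      have inj: "inj_on ?\<iota> G"
      proof (rule inj_onI)
        fix I J assume "I \<in> G" "J \<in> G" "?\<iota> I = ?\<iota> J"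
        then show "I = J" using ord[of I] ord[of J] by (simp add: Icc_eq_Icc prod_eq_iff)
      qed
      have part: "?\<iota> ` G tagged_partial_division_of {a..b}"
        unfolding tagged_partial_division_of_def
      proof (intro conjI allI impI)
        show "finite (?\<iota> ` G)" using G(1) by simp
      next
        fix x K assume "(x, K) \<in> ?\<iota> ` G"
        then obtain I where I: "I \<in> G" "x = \<tau> I" "K = {fst I..snd I}" by (elim imageE) simp
        then show "x \<in> K" "K \<subseteq> {a..b}" "\<exists>a b. K = cbox a b"
          using \<tau>[of I] ord[of I] by (auto simp: box_real)
      next
        fix x1 K1 x2 K2
        assume as: "(x1, K1) \<in> ?\<iota> ` G \<and> (x2, K2) \<in> ?\<iota> ` G \<and> (x1, K1) \<noteq> (x2, K2)"
        then obtain I J where IJ: "I \<in> G" "J \<in> G" "(x1, K1) = ?\<iota> I" "(x2, K2) = ?\<iota> J"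
          by (elim conjE imageE)
        then have "I \<noteq> J" using as by auto
        then have "disjnt K1 K2" using disjoint_intervalsD[OF G(3) IJ(1,2)] IJ(3,4) by simp
        then show "interior K1 \<inter> interior K2 = {}"
          using interior_subset[of K1] interior_subset[of K2] unfolding disjnt_def by blast
      qed
      have fine: "\<gamma> e fine ?\<iota> ` G" using \<tau> by (auto simp: fine_def)
      have "c * (\<Sum>(l, r)\<in>G. r - l) = (\<Sum>I\<in>G. c * (snd I - fst I))"
        by (simp add: sum_distrib_left split_def)
      also have "\<dots> \<le> (\<Sum>I\<in>G. norm (measure lborel {fst I..snd I} *\<^sub>R f (\<tau> I) - integral {fst I..snd I} f))"
      proof (rule sum_mono)
        fix I assume I: "I \<in> G"
        have "F (snd I) - F (fst I) = integral {fst I..snd I} f"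
          using ord[OF I] by (intro Fdiff) auto
        then show "c * (snd I - fst I) \<le> norm (measure lborel {fst I..snd I} *\<^sub>R f (\<tau> I) - integral {fst I..snd I} f)"
          using \<tau>[OF I] ord[OF I] by (simp add: abs_minus_commute)
      qed
      also have "\<dots> = (\<Sum>(x, k)\<in>?\<iota> ` G. norm (measure lborel k *\<^sub>R f x - integral k f))"
        by (simp add: sum.reindex[OF inj])
      also have "\<dots> < e * c" by (rule \<gamma>(2)[OF e part fine])
      finally show "(\<Sum>(l, r)\<in>G. r - l) \<le> e" using c by (simp add: mult.commute)
    qed
  qed
  have "negligible (\<Union>n. S (inverse (real (Suc n))))"
    by (rule negligible_countable_Union) (use neg in auto)
  moreover have "{x. a < x \<and> x < b \<and> \<not> (F has_real_derivative f x) (at x)} \<subseteq> (\<Union>n. S (inverse (real (Suc n))))"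
  proof (rule subsetI, rule ccontr)
    fix x assume x: "x \<in> {x. a < x \<and> x < b \<and> \<not> (F has_real_derivative f x) (at x)}"
      and nx: "x \<notin> (\<Union>n. S (inverse (real (Suc n))))"
    have "((\<lambda>y. (F y - F x) / (y - x)) \<longlongrightarrow> f x) (at x)"
    proof (rule tendstoI)
      fix e :: real assume "0 < e"
      then obtain n where n: "inverse (real (Suc n)) < e" using reals_Archimedean by blast
      have "x \<notin> S (inverse (real (Suc n)))" using nx by blast
      then obtain d where d: "0 < d" "\<And>l r. l < r \<Longrightarrow> r - l < d \<Longrightarrow> x = l \<or> x = r \<Longrightarrow>
          \<bar>F r - F l - (r - l) * f x\<bar> < inverse (real (Suc n)) * (r - l)"
        using x unfolding S_def mem_Collect_eq not_le[symmetric] by blast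
      have "dist ((F y - F x) / (y - x)) (f x) < e" if y: "y \<noteq> x" "dist y x < d" for y
      proof -
        have "\<bar>F y - F x - (y - x) * f x\<bar> < inverse (real (Suc n)) * \<bar>y - x\<bar>"
        proof (cases "x < y")
          case True
          then show ?thesis using d(2)[of x y] y by (simp add: dist_real_def)
        next
          case False
          then have "\<bar>F x - F y - (x - y) * f x\<bar> < inverse (real (Suc n)) * (x - y)"
            using d(2)[of y x] y by (simp add: dist_real_def)
          moreover have "F x - F y - (x - y) * f x = - (F y - F x - (y - x) * f x)"
            by (simp add: algebra_simps)
          ultimately show ?thesis using False by (simp del: of_nat_Suc)
        qed
        also have "\<dots> < e * \<bar>y - x\<bar>" using n y by (intro mult_strict_right_mono) auto
        finally have "\<bar>F y - F x - (y - x) * f x\<bar> / \<bar>y - x\<bar> < e"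
          using y by (simp add: pos_divide_less_eq)
        moreover have "(F y - F x) / (y - x) - f x = (F y - F x - (y - x) * f x) / (y - x)"
          using y by (simp add: field_simps)
        ultimately show ?thesis by (simp add: dist_real_def abs_divide)
      qed
      then show "eventually (\<lambda>y. dist ((F y - F x) / (y - x)) (f x) < e) (at x)"
        unfolding eventually_at using d(1) by auto
    qed
    then show False using x by (simp add: has_field_derivative_iff)
  qed
  ultimately show ?thesis unfolding F_def by (rule negligible_subset)
qed

section \<open>Finite-dimensional normed spaces and gauges\<close>

lemma compact_coefficient_cube:
  fixes B :: "'x::real_normed_vector set"
  assumes "finite B"
  shows "compact {(\<Sum>b\<in>B. x b *\<^sub>R b) | x. \<forall>b\<in>B. \<bar>x b\<bar> \<le> (r::real)}"
  using assms
proof (induction B)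
  case empty
  then show ?case by simp
next
  case (insert c B)
  let ?Q = "\<lambda>B. {(\<Sum>b\<in>B. x b *\<^sub>R b) | x. \<forall>b\<in>B. \<bar>x b\<bar> \<le> r}"
  have "compact ((\<lambda>t. t *\<^sub>R c) ` {-r..r})"
    by (intro compact_continuous_image continuous_intros) simp
  then have "compact {s + t | s t. s \<in> (\<lambda>t. t *\<^sub>R c) ` {-r..r} \<and> t \<in> ?Q B}"
    using insert.IH by (rule compact_sums)
  moreover have "?Q (insert c B) = {s + t | s t. s \<in> (\<lambda>t. t *\<^sub>R c) ` {-r..r} \<and> t \<in> ?Q B}"
  proof (intro equalityI subsetI)
    fix z assume "z \<in> ?Q (insert c B)"
    then obtain x where x: "z = (\<Sum>b\<in>insert c B. x b *\<^sub>R b)" "\<forall>b\<in>insert c B. \<bar>x b\<bar> \<le> r" by blast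
    have "z = x c *\<^sub>R c + (\<Sum>b\<in>B. x b *\<^sub>R b)" using x(1) insert.hyps by simp
    moreover have "x c *\<^sub>R c \<in> (\<lambda>t. t *\<^sub>R c) ` {-r..r}" using x(2) by (intro imageI) (auto simp: abs_le_iff)
    ultimately show "z \<in> {s + t | s t. s \<in> (\<lambda>t. t *\<^sub>R c) ` {-r..r} \<and> t \<in> ?Q B}" using x(2) by blast
  next
    fix z assume "z \<in> {s + t | s t. s \<in> (\<lambda>t. t *\<^sub>R c) ` {-r..r} \<and> t \<in> ?Q B}"
    then obtain t x where t: "z = t *\<^sub>R c + (\<Sum>b\<in>B. x b *\<^sub>R b)" "\<bar>t\<bar> \<le> r" "\<forall>b\<in>B. \<bar>x b\<bar> \<le> r"
      by (auto simp: abs_le_iff)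
    have "(\<Sum>b\<in>B. (x(c := t)) b *\<^sub>R b) = (\<Sum>b\<in>B. x b *\<^sub>R b)"
      using insert.hyps by (intro sum.cong) auto
    then have "z = (\<Sum>b\<in>insert c B. (x(c := t)) b *\<^sub>R b)" using t(1) insert.hyps by simp
    then show "z \<in> ?Q (insert c B)" using t by (intro CollectI exI[of _ "x(c := t)"]) auto
  qed
  ultimately show ?case by simp
qed

text \<open>
  Dividing \<open>v\<close> by its largest coordinate, at \<open>m\<close> say, gives a point of \<open>m\<close> plus the
  unit coefficient cube of the other basis vectors. That set is compact and, by independence, avoids
  the origin, so its points have norm at least some \<open>d m > 0\<close>. The same cubes give compactness of
  closed balls below.
\<close>

lemma finite_dim_bounded_coordinates:
  assumes "\<exists>B :: 'x::real_normed_vector set. finite B \<and> span B = UNIV"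
  shows "\<exists>(B :: 'x set) coord K. finite B \<and> (0::real) < K \<and> (\<forall>v. v = (\<Sum>b\<in>B. coord b v *\<^sub>R b)) \<and>
    (\<forall>v w. \<forall>b\<in>B. coord b (v - w) = coord b v - coord b w) \<and> (\<forall>v. \<forall>b\<in>B. \<bar>coord b v\<bar> \<le> K * norm v)"
proof -
  obtain B0 :: "'x set" where B0: "finite B0" "span B0 = UNIV" using assms by blast
  obtain B where B: "B \<subseteq> B0" "independent B" "B0 \<subseteq> span B"
    using maximal_independent_subset[of B0] by blast
  have fin: "finite B" using B(1) B0(1) by (rule finite_subset)
  have sp: "v \<in> span B" for v
    using span_mono[OF B(3)] B0(2) unfolding span_span by blast
  let ?c = "\<lambda>b v. representation B v b"
  have rep: "(\<Sum>b\<in>B. ?c b v *\<^sub>R b) = v" for v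
    using sum_representation_eq[OF B(2) sp fin order_refl] .
  let ?Q = "\<lambda>A. {(\<Sum>b\<in>A. x b *\<^sub>R b) | x. \<forall>b\<in>A. \<bar>x b\<bar> \<le> (1::real)}"
  have "\<exists>d>0. \<forall>y\<in>?Q (B - {b}). d \<le> norm (b + y)" if b: "b \<in> B" for b
  proof -
    let ?C = "(+) b ` ?Q (B - {b})"
    have "compact ?C" using fin by (intro compact_translation compact_coefficient_cube) simp
    moreover have "0 \<notin> ?C"
    proof
      assume "0 \<in> ?C"
      then obtain x where "0 = b + (\<Sum>c\<in>B - {b}. x c *\<^sub>R c)" by blast
      then have "b = - (\<Sum>c\<in>B - {b}. x c *\<^sub>R c)" by (simp add: eq_neg_iff_add_eq_0)
      also have "\<dots> \<in> span (B - {b})" by (intro span_neg span_sum span_scale span_base)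
      finally show False using B(2) b unfolding dependent_def by blast
    qed
    ultimately have "open (- ?C)" "0 \<in> - ?C" by (simp_all add: compact_imp_closed open_Compl)
    then obtain d where d: "0 < d" "ball 0 d \<subseteq> - ?C" by (rule openE)
    have "d \<le> norm (b + y)" if y: "y \<in> ?Q (B - {b})" for y
    proof (rule ccontr)
      assume "\<not> d \<le> norm (b + y)"
      then have "b + y \<in> - ?C" using d(2) by (intro subsetD[OF d(2)]) simp
      then show False using imageI[OF y, of "(+) b"] by simp
    qed
    then show ?thesis using d(1) by (intro exI[of _ d] conjI ballI)
  qed
  then have "\<exists>d. \<forall>b\<in>B. 0 < d b \<and> (\<forall>y\<in>?Q (B - {b}). d b \<le> norm (b + y))" by (intro bchoice ballI)
  then obtain d where "\<forall>b\<in>B. 0 < d b \<and> (\<forall>y\<in>?Q (B - {b}). d b \<le> norm (b + y))" by (elim exE)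
  then have d: "0 < d b" "y \<in> ?Q (B - {b}) \<Longrightarrow> d b \<le> norm (b + y)" if "b \<in> B" for b y
    using that by simp_all
  define K where "K = 1 + (\<Sum>b\<in>B. inverse (d b))"
  have Kb: "inverse (d b) \<le> K" if "b \<in> B" for b
  proof -
    have "inverse (d b) \<le> (\<Sum>b\<in>B. inverse (d b))"
      by (rule member_le_sum) (use fin that d(1) in \<open>auto intro: less_imp_le\<close>)
    then show ?thesis by (simp add: K_def)
  qed
  have Kpos: "0 < K" using sum_nonneg[of B "\<lambda>b. inverse (d b)"] d(1)
    by (auto simp: K_def less_imp_le intro!: add_pos_nonneg)
  have bound: "\<bar>?c b v\<bar> \<le> K * norm v" if b: "b \<in> B" for b v
  proof -
    have ne: "B \<noteq> {}" using b by blast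
    obtain m where m: "m \<in> B" "\<And>c. c \<in> B \<Longrightarrow> \<bar>?c c v\<bar> \<le> \<bar>?c m v\<bar>"
    proof -
      have "Max ((\<lambda>c. \<bar>?c c v\<bar>) ` B) \<in> (\<lambda>c. \<bar>?c c v\<bar>) ` B" using fin ne by (intro Max_in) auto
      then obtain m where "m \<in> B" "\<bar>?c m v\<bar> = Max ((\<lambda>c. \<bar>?c c v\<bar>) ` B)" by (elim imageE) simp
      then show ?thesis using fin by (intro that[of m]) auto
    qed
    show ?thesis
    proof (cases "?c m v = 0")
      case True
      then show ?thesis using m(2)[OF b] Kpos by (auto intro: order_trans[OF _ mult_nonneg_nonneg])
    next
      case False
      let ?y = "\<Sum>c\<in>B - {m}. (?c c v / ?c m v) *\<^sub>R c"
      have "\<bar>?c c v / ?c m v\<bar> \<le> 1" if "c \<in> B - {m}" for c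
        using m(2)[of c] that False by (simp add: abs_divide divide_le_eq)
      then have "?y \<in> ?Q (B - {m})" by (intro CollectI exI[of _ "\<lambda>c. ?c c v / ?c m v"]) simp
      then have "d m \<le> norm (m + ?y)" by (rule d(2)[OF m(1)])
      also have "m + ?y = inverse (?c m v) *\<^sub>R v"
      proof -
        have "inverse (?c m v) *\<^sub>R v = inverse (?c m v) *\<^sub>R (\<Sum>c\<in>B. ?c c v *\<^sub>R c)" using rep by simp
        also have "\<dots> = (\<Sum>c\<in>B. (?c c v / ?c m v) *\<^sub>R c)"
          by (simp add: scaleR_sum_right divide_inverse mult.commute)
        also have "\<dots> = m + ?y" using sum.remove[OF fin m(1), of "\<lambda>c. (?c c v / ?c m v) *\<^sub>R c"] False by simp
        finally show ?thesis by simp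
      qed
      finally have "d m * \<bar>?c m v\<bar> \<le> norm v" using False by (simp add: field_simps)
      then have "\<bar>?c m v\<bar> \<le> inverse (d m) * norm v" using d(1)[OF m(1)] by (simp add: field_simps)
      also have "\<dots> \<le> K * norm v" by (rule mult_right_mono[OF Kb[OF m(1)]]) simp
      finally show ?thesis using m(2)[OF b] by linarith
    qed
  qed
  have diff: "?c b (v - w) = ?c b v - ?c b w" for b v w
    using B(2) sp by (simp add: representation_diff)
  show ?thesis
    by (intro exI[of _ B] exI[of _ ?c] exI[of _ K] conjI allI ballI fin Kpos rep[symmetric] diff bound)
qed

lemma finite_dim_compact_cball:
  assumes fd: "\<exists>B :: 'x::real_normed_vector set. finite B \<and> span B = UNIV"
  shows "compact (cball (0::'x) R)"
proof -
  obtain B :: "'x set" and coord K where B: "finite B" "(0::real) < K" "\<And>v. v = (\<Sum>b\<in>B. coord b v *\<^sub>R b)"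
     "\<And>v b. b \<in> B \<Longrightarrow> \<bar>coord b v\<bar> \<le> K * norm v"
    using finite_dim_bounded_coordinates[OF fd] by blast
  let ?Q = "{(\<Sum>b\<in>B. x b *\<^sub>R b) | x. \<forall>b\<in>B. \<bar>x b\<bar> \<le> K * R}"
  have "cball 0 R \<subseteq> ?Q"
  proof
    fix v :: 'x assume v: "v \<in> cball 0 R"
    have "\<bar>coord b v\<bar> \<le> K * R" if "b \<in> B" for b
    proof -
      have "K * norm v \<le> K * R" using v B(2) by simp
      then show ?thesis using B(4)[OF that, of v] by linarith
    qed
    then show "v \<in> ?Q" using B(3)[of v] by (intro CollectI exI[of _ "\<lambda>b. coord b v"]) simp
  qed
  moreover have "compact ?Q" using B(1) by (rule compact_coefficient_cube)
  ultimately show ?thesis 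
    using compact_Int_closed[of ?Q "cball 0 R"] by (simp only: closed_cball Int_absorb1)
qed

lemma gauge_funD:
  assumes "gauge_fun g"
  shows "0 \<le> g v" "v \<noteq> 0 \<Longrightarrow> 0 < g v" "g (v + w) \<le> g v + g w" "0 \<le> c \<Longrightarrow> g (c *\<^sub>R v) = c * g v"
  using assms by (auto simp: gauge_fun_def)

text \<open>
  Subadditivity and homogeneity reduce the estimate to the finitely many values \<open>g (\<plusminus> b)\<close>
  at basis vectors.
\<close>

lemma gauge_fun_upper_bound:
  fixes g :: "'x::real_normed_vector \<Rightarrow> real"
  assumes fd: "\<exists>B :: 'x set. finite B \<and> span B = UNIV" and g: "gauge_fun g"
  shows "\<exists>K>0. \<forall>v. g v \<le> K * norm v"
proof -
  obtain B :: "'x set" and coord K where B: "finite B" "(0::real) < K" "\<And>v. v = (\<Sum>b\<in>B. coord b v *\<^sub>R b)"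
     "\<And>v b. b \<in> B \<Longrightarrow> \<bar>coord b v\<bar> \<le> K * norm v"
    using finite_dim_bounded_coordinates[OF fd] by blast
  note gD = gauge_funD[OF g]
  have g0: "g 0 = 0" using gD(4)[of 0 0] by simp
  have one: "g (c *\<^sub>R b) \<le> \<bar>c\<bar> * (g b + g (- b))" for c b
  proof (cases "0 \<le> c")
    case True
    then show ?thesis using gD(4)[of c b] gD(1)[of "- b"] by (simp add: distrib_left)
  next
    case False
    then have "g (c *\<^sub>R b) = (- c) * g (- b)" using gD(4)[of "- c" "- b"] by simp
    then show ?thesis using False mult_nonneg_nonneg[of "- c" "g b"] gD(1)[of b] by (simp add: distrib_left)
  qed
  have sum: "g (\<Sum>b\<in>A. x b *\<^sub>R b) \<le> (\<Sum>b\<in>A. \<bar>x b\<bar> * (g b + g (- b)))" if "finite A" for A x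
    using that
  proof (induction A)
    case (insert a A)
    then show ?case using gD(3)[of "x a *\<^sub>R a" "\<Sum>b\<in>A. x b *\<^sub>R b"] one[of "x a" a] by simp
  qed (simp add: g0)
  define M where "M = 1 + (\<Sum>b\<in>B. K * (g b + g (- b)))"
  have M0: "0 \<le> (\<Sum>b\<in>B. K * (g b + g (- b)))"
    using B(2) gD(1) by (intro sum_nonneg mult_nonneg_nonneg add_nonneg_nonneg) auto
  have "g v \<le> M * norm v" for v
  proof -
    have "g v = g (\<Sum>b\<in>B. coord b v *\<^sub>R b)" using B(3) by simp
    also have "\<dots> \<le> (\<Sum>b\<in>B. \<bar>coord b v\<bar> * (g b + g (- b)))" using sum B(1) by simp
    also have "\<dots> \<le> (\<Sum>b\<in>B. (K * norm v) * (g b + g (- b)))"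
      using B(4) gD(1) by (intro sum_mono mult_right_mono add_nonneg_nonneg) auto
    also have "\<dots> = (\<Sum>b\<in>B. K * (g b + g (- b))) * norm v"
      unfolding sum_distrib_right by (intro sum.cong refl) (simp only: mult_ac)
    also have "\<dots> \<le> M * norm v" by (intro mult_right_mono) (auto simp: M_def)
    finally show ?thesis .
  qed
  moreover have "0 < M" using M0 by (simp add: M_def)
  ultimately show ?thesis by blast
qed

lemma gauge_fun_lipschitz:
  fixes g :: "'x::real_normed_vector \<Rightarrow> real"
  assumes g: "gauge_fun g" and K: "\<And>v. g v \<le> K * norm v"
  shows "\<bar>g v - g w\<bar> \<le> K * norm (v - w)"
  using gauge_funD(3)[OF g, of "v - w" w] gauge_funD(3)[OF g, of "w - v" v] K[of "v - w"] K[of "w - v"]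
  by (simp add: norm_minus_commute)

lemma gauge_fun_continuous:
  fixes g :: "'x::real_normed_vector \<Rightarrow> real"
  assumes fd: "\<exists>B :: 'x set. finite B \<and> span B = UNIV" and g: "gauge_fun g"
  shows "continuous_on A g"
proof -
  obtain K where K: "0 < K" "\<And>v. g v \<le> K * norm v" using gauge_fun_upper_bound[OF fd g] by blast
  have "K-lipschitz_on A g"
    using gauge_fun_lipschitz[OF g K(2)] K(1) by (intro lipschitz_onI) (auto simp: dist_norm)
  then show ?thesis by (rule lipschitz_on_continuous_on)
qed

lemma gauge_fun_lower_bound:
  fixes g :: "'x::real_normed_vector \<Rightarrow> real"
  assumes fd: "\<exists>B :: 'x set. finite B \<and> span B = UNIV" and g: "gauge_fun g"
  shows "\<exists>c>0. \<forall>v. norm v \<le> c * g v"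
proof (cases "\<exists>v::'x. norm v = 1")
  case False
  have zero: "v = 0" for v :: 'x
  proof (rule ccontr)
    assume "v \<noteq> 0"
    then have "norm (v /\<^sub>R norm v) = 1" by simp
    then show False using False by blast
  qed
  have "norm v \<le> 1 * g v" for v using gauge_funD(1)[OF g, of v] by (subst zero[of v]) simp
  then show ?thesis using zero_less_one by blast
next
  case True
  have "closed {v :: 'x. norm v = 1}" by (intro closed_Collect_eq continuous_intros)
  then have closed: "closed (sphere (0::'x) 1)" by (simp add: sphere_def)
  have "sphere (0::'x) 1 = cball 0 1 \<inter> sphere 0 1" by auto
  moreover have "compact (cball (0::'x) 1 \<inter> sphere 0 1)"
    by (rule compact_Int_closed[OF finite_dim_compact_cball[OF fd] closed])
  ultimately have "compact (sphere (0::'x) 1)" by simp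
  moreover have "sphere (0::'x) 1 \<noteq> {}" using True by auto
  ultimately obtain w where w: "w \<in> sphere 0 1" "\<And>v. v \<in> sphere 0 1 \<Longrightarrow> g w \<le> g v"
    using continuous_attains_inf[OF _ _ gauge_fun_continuous[OF fd g]] by metis
  have "w \<noteq> 0" using w(1) by auto
  then have gw: "0 < g w" using gauge_funD(2)[OF g] by simp
  have "norm v \<le> inverse (g w) * g v" for v
  proof (cases "v = 0")
    case False
    then have "g w \<le> g (inverse (norm v) *\<^sub>R v)" by (intro w(2)) simp
    also have "\<dots> = inverse (norm v) * g v" using gauge_funD(4)[OF g] by simp
    finally show ?thesis using False gw by (simp add: field_simps)
  qed (use gauge_funD(1)[OF g] gw in auto)
  then show ?thesis using gw by (intro exI[of _ "inverse (g w)"]) auto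
qed

section \<open>Absolutely continuous and Lipschitz curves\<close>

lemma abs_continuous_curve_if_norm_le:
  fixes f :: "real \<Rightarrow> 'x::real_normed_vector" and g :: "real \<Rightarrow> 'y::real_normed_vector"
  assumes ac: "abs_continuous_curve a b f"
    and le: "\<And>x y. x \<in> {a..b} \<Longrightarrow> y \<in> {a..b} \<Longrightarrow> norm (g y - g x) \<le> K * norm (f y - f x)"
  shows "abs_continuous_curve a b g"
  unfolding abs_continuous_curve_alt
proof (intro allI impI)
  fix e :: real assume e: "0 < e"
  define M where "M = \<bar>K\<bar> + 1"
  have M: "0 < M" by (simp add: M_def)
  obtain d where d: "0 < d" "\<And>D. interval_family a b D \<Longrightarrow> (\<Sum>(x, y)\<in>D. y - x) < d \<Longrightarrow>
      (\<Sum>(x, y)\<in>D. norm (f y - f x)) < e / M"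
    using ac divide_pos_pos[OF e M] unfolding abs_continuous_curve_alt by blast
  have "(\<Sum>(x, y)\<in>D. norm (g y - g x)) < e" if D: "interval_family a b D" "(\<Sum>(x, y)\<in>D. y - x) < d" for D
  proof -
    have "(\<Sum>(x, y)\<in>D. norm (g y - g x)) \<le> (\<Sum>(x, y)\<in>D. M * norm (f y - f x))"
    proof (rule sum_mono)
      fix p assume p: "p \<in> D"
      obtain x y where xy: "p = (x, y)" by fastforce
      have "norm (g y - g x) \<le> K * norm (f y - f x)"
        using D(1) p xy by (intro le) (auto simp: interval_family_def)
      also have "\<dots> \<le> M * norm (f y - f x)" by (intro mult_right_mono) (auto simp: M_def)
      finally show "(case p of (x, y) \<Rightarrow> norm (g y - g x)) \<le> (case p of (x, y) \<Rightarrow> M * norm (f y - f x))"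
        by (simp add: xy)
    qed
    also have "\<dots> = M * (\<Sum>(x, y)\<in>D. norm (f y - f x))" by (simp add: sum_distrib_left split_def)
    also have "\<dots> < e" using d(2)[OF D] M by (simp add: field_simps)
    finally show ?thesis .
  qed
  then show "\<exists>d>0. \<forall>D. interval_family a b D \<and> (\<Sum>(x, y)\<in>D. y - x) < d \<longrightarrow>
      (\<Sum>(x, y)\<in>D. norm (g y - g x)) < e"
    using d(1) by blast
qed

text \<open>
  The coordinates are absolutely continuous real functions.
\<close>

theorem abs_continuous_curve_differentiable_ae:
  fixes f :: "real \<Rightarrow> 'x::real_normed_vector"
  assumes fd: "\<exists>B :: 'x set. finite B \<and> span B = UNIV" and ac: "abs_continuous_curve a b f"
  shows "negligible {x. a < x \<and> x < b \<and> \<not> f differentiable (at x)}"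
proof -
  obtain B :: "'x set" and coord K where B: "finite B" "(0::real) < K" "\<And>v. v = (\<Sum>b\<in>B. coord b v *\<^sub>R b)"
     "\<And>v w b. b \<in> B \<Longrightarrow> coord b (v - w) = coord b v - coord b w"
     "\<And>v b. b \<in> B \<Longrightarrow> \<bar>coord b v\<bar> \<le> K * norm v"
    using finite_dim_bounded_coordinates[OF fd] by blast
  let ?N = "\<lambda>c. {x. a < x \<and> x < b \<and> \<not> (\<lambda>x. coord c (f x)) differentiable (at x)}"
  have "negligible (?N c)" if c: "c \<in> B" for c
  proof (intro abs_continuous_real_differentiable_ae abs_continuous_curve_if_norm_le[OF ac, of _ K])
    show "norm (coord c (f y) - coord c (f x)) \<le> K * norm (f y - f x)" for x y
      using B(5)[OF c, of "f y - f x"] B(4)[OF c] by simp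
  qed
  then have "negligible (\<Union>c\<in>B. ?N c)" using B(1) by (intro negligible_Union) auto
  moreover have "{x. a < x \<and> x < b \<and> \<not> f differentiable (at x)} \<subseteq> (\<Union>c\<in>B. ?N c)"
  proof (rule subsetI, rule ccontr)
    fix x assume x: "x \<in> {x. a < x \<and> x < b \<and> \<not> f differentiable (at x)}" and "x \<notin> (\<Union>c\<in>B. ?N c)"
    then have "(\<lambda>x. coord c (f x)) differentiable (at x)" if "c \<in> B" for c using that by blast
    then have "(\<lambda>x. \<Sum>c\<in>B. coord c (f x) *\<^sub>R c) differentiable (at x)"
      using B(1) by (intro differentiable_sum ballI differentiable_scaleR) auto
    then show False using x B(3)[symmetric] by simp
  qed
  ultimately show ?thesis by (rule negligible_subset)
qed

lemma AE_lebesgue_iff_negligible: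
  "(AE x in lebesgue. P x) \<longleftrightarrow> negligible {x. \<not> P x}"
proof
  assume "AE x in lebesgue. P x"
  then obtain M where "M \<in> null_sets lebesgue" "{x. \<not> P x} \<subseteq> M"
    unfolding eventually_ae_filter by auto
  then show "negligible {x. \<not> P x}" by (meson negligible_iff_null_sets negligible_subset)
next
  assume "negligible {x. \<not> P x}"
  then show "AE x in lebesgue. P x"
    unfolding eventually_ae_filter negligible_iff_null_sets by auto
qed

lemma lipschitz_on_imp_abs_continuous_curve:
  fixes f :: "real \<Rightarrow> 'x::real_normed_vector"
  assumes L: "L-lipschitz_on {a..b} f"
  shows "abs_continuous_curve a b f"
proof (rule abs_continuous_curve_if_norm_le)
  show "abs_continuous_curve a b (\<lambda>x::real. x)"
    unfolding abs_continuous_curve_alt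
  proof (intro allI impI)
    fix e :: real assume "0 < e"
    have "(\<Sum>(x, y)\<in>D. norm (y - x)) = (\<Sum>(x, y)\<in>D. y - x)" if "interval_family a b D" for D
      by (rule sum.cong) (use that in \<open>auto simp: interval_family_def\<close>)
    then show "\<exists>d>0. \<forall>D. interval_family a b D \<and> (\<Sum>(x, y)\<in>D. y - x) < d \<longrightarrow>
        (\<Sum>(x, y)\<in>D. norm (y - x)) < e"
      using \<open>0 < e\<close> by (intro exI[of _ e]) auto
  qed
  show "norm (f y - f x) \<le> L * norm (y - x)" if "x \<in> {a..b}" "y \<in> {a..b}" for x y
    using lipschitz_onD[OF L that(2,1)] by (simp add: dist_norm)
qed

lemma interval_family_mono:
  assumes "interval_family c d D" "a \<le> c" "d \<le> b"
  shows "interval_family a b D"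
  using assms unfolding interval_family_def by fastforce

lemma abs_continuous_curve_subinterval:
  assumes "abs_continuous_curve a b f" "a \<le> c" "d \<le> b"
  shows "abs_continuous_curve c d f"
  unfolding abs_continuous_curve_alt
proof (intro allI impI)
  fix e :: real assume "0 < e"
  then obtain \<delta> where "0 < \<delta>" "\<And>D. interval_family a b D \<Longrightarrow> (\<Sum>(x, y)\<in>D. y - x) < \<delta> \<Longrightarrow>
      (\<Sum>(x, y)\<in>D. norm (f y - f x)) < e"
    using assms(1) unfolding abs_continuous_curve_alt by blast
  then show "\<exists>\<delta>>0. \<forall>D. interval_family c d D \<and> (\<Sum>(x, y)\<in>D. y - x) < \<delta> \<longrightarrow>
      (\<Sum>(x, y)\<in>D. norm (f y - f x)) < e"
    using interval_family_mono[OF _ assms(2,3)] by blast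
qed

text \<open>
  Monotonicity keeps the image intervals disjoint. Intervals that \<open>\<tau>\<close> collapses to a point are
  dropped first: they contribute nothing, and without them the image map is injective.
\<close>

lemma abs_continuous_curve_compose_mono_lipschitz:
  fixes v :: "real \<Rightarrow> 'x::real_normed_vector" and \<tau> :: "real \<Rightarrow> real"
  assumes ac: "abs_continuous_curve a b v" and L: "L-lipschitz_on {c..d} \<tau>"
    and mono: "mono_on {c..d} \<tau>" and sub: "\<tau> ` {c..d} \<subseteq> {a..b}"
  shows "abs_continuous_curve c d (\<lambda>s. v (\<tau> s))"
  unfolding abs_continuous_curve_alt
proof (intro allI impI)
  fix e :: real assume "0 < e"
  then obtain \<delta> where \<delta>: "0 < \<delta>" "\<And>D. interval_family a b D \<Longrightarrow> (\<Sum>(x, y)\<in>D. y - x) < \<delta> \<Longrightarrow>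
      (\<Sum>(x, y)\<in>D. norm (v y - v x)) < e"
    using ac unfolding abs_continuous_curve_alt by blast
  define M where "M = L + 1"
  have M: "0 < M" using lipschitz_on_nonneg[OF L] by (simp add: M_def)
  have "(\<Sum>(x, y)\<in>D. norm (v (\<tau> y) - v (\<tau> x))) < e"
    if D: "interval_family c d D" and len: "(\<Sum>(x, y)\<in>D. y - x) < \<delta> / M" for D
  proof -
    let ?D = "{p \<in> D. \<tau> (fst p) \<noteq> \<tau> (snd p)}"
    let ?\<iota> = "\<lambda>p. (\<tau> (fst p), \<tau> (snd p))"
    have fin: "finite D" using D by (simp add: interval_family_def)
    have ord: "c \<le> fst p \<and> fst p \<le> snd p \<and> snd p \<le> d" if "p \<in> D" for p
      using D that unfolding interval_family_def by auto
    have mon: "\<tau> x \<le> \<tau> y" if "c \<le> x" "x \<le> y" "y \<le> d" for x y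
      using mono that by (auto simp: mono_on_def)
    have lt: "fst p < snd p \<and> \<tau> (fst p) < \<tau> (snd p)" if "p \<in> ?D" for p
      using that ord[of p] mon[of "fst p" "snd p"] by (auto simp: less_le)
    have sep: "snd p \<le> fst q \<or> snd q \<le> fst p" if pq: "p \<in> ?D" "q \<in> ?D" "p \<noteq> q" for p q
    proof (rule ccontr)
      assume n: "\<not> ?thesis"
      have "{fst p<..<snd p} \<inter> {fst q<..<snd q} = {}"
        using D pq unfolding interval_family_def disjoint_family_on_def split_def by blast
      moreover have "max (fst p) (fst q) < min (snd p) (snd q)"
        using n lt[OF pq(1)] lt[OF pq(2)] by auto
      then obtain z where "max (fst p) (fst q) < z" "z < min (snd p) (snd q)" using dense by blast
      then have "z \<in> {fst p<..<snd p} \<inter> {fst q<..<snd q}" by simp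
      ultimately show False by simp
    qed
    have sep': "\<tau> (snd p) \<le> \<tau> (fst q) \<or> \<tau> (snd q) \<le> \<tau> (fst p)" if pq: "p \<in> ?D" "q \<in> ?D" "p \<noteq> q" for p q
      using sep[OF pq] mon[of "snd p" "fst q"] mon[of "snd q" "fst p"] ord[of p] ord[of q] pq by auto
    have inj: "inj_on ?\<iota> ?D"
    proof (rule inj_onI, rule ccontr)
      fix p q assume "p \<in> ?D" "q \<in> ?D" "?\<iota> p = ?\<iota> q" "p \<noteq> q"
      then show False using sep'[of p q] lt[of p] lt[of q] by auto
    qed
    have fam: "interval_family a b (?\<iota> ` ?D)"
      unfolding interval_family_def
    proof (intro conjI)
      have "a \<le> x \<and> x \<le> y \<and> y \<le> b" if xy: "(x, y) \<in> ?\<iota> ` ?D" for x y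
      proof -
        obtain p where p: "p \<in> ?D" "x = \<tau> (fst p)" "y = \<tau> (snd p)" using xy by blast
        have "fst p \<in> {c..d}" "snd p \<in> {c..d}" using ord[of p] p(1) by auto
        then have "x \<in> {a..b}" "y \<in> {a..b}" using sub p by blast+
        then show ?thesis using lt[OF p(1)] p by auto
      qed
      then show "\<forall>(x, y)\<in>?\<iota> ` ?D. a \<le> x \<and> x \<le> y \<and> y \<le> b" by blast
      show "disjoint_family_on (\<lambda>(x, y). {x<..<y}) (?\<iota> ` ?D)"
        unfolding disjoint_family_on_def
      proof (intro ballI impI)
        fix I J assume "I \<in> ?\<iota> ` ?D" "J \<in> ?\<iota> ` ?D" "I \<noteq> J"
        then obtain p q where pq: "p \<in> ?D" "q \<in> ?D" "I = ?\<iota> p" "J = ?\<iota> q" "p \<noteq> q" by (elim imageE) auto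
        then show "(case I of (x, y) \<Rightarrow> {x<..<y}) \<inter> (case J of (x, y) \<Rightarrow> {x<..<y}) = {}"
          using sep'[OF pq(1,2,5)] by auto
      qed
    qed (use fin in simp)
    have "(\<Sum>(x, y)\<in>?\<iota> ` ?D. y - x) = (\<Sum>p\<in>?D. \<tau> (snd p) - \<tau> (fst p))"
      by (subst sum.reindex[OF inj]) simp
    also have "\<dots> \<le> (\<Sum>p\<in>?D. M * (snd p - fst p))"
    proof (rule sum_mono)
      fix p assume p: "p \<in> ?D"
      have "\<tau> (snd p) - \<tau> (fst p) \<le> L * (snd p - fst p)"
        using lipschitz_onD[OF L, of "snd p" "fst p"] ord[of p] p lt[OF p] by (auto simp: dist_real_def)
      also have "\<dots> \<le> M * (snd p - fst p)" using ord[of p] p by (intro mult_right_mono) (auto simp: M_def)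
      finally show "\<tau> (snd p) - \<tau> (fst p) \<le> M * (snd p - fst p)" .
    qed
    also have "\<dots> \<le> (\<Sum>p\<in>D. M * (snd p - fst p))"
      by (rule sum_mono2) (use fin ord M in auto)
    also have "\<dots> = M * (\<Sum>(x, y)\<in>D. y - x)" by (simp add: sum_distrib_left split_def)
    also have "\<dots> < \<delta>" using len M by (simp add: field_simps)
    finally have "(\<Sum>(x, y)\<in>?\<iota> ` ?D. norm (v y - v x)) < e" by (rule \<delta>(2)[OF fam])
    moreover have "(\<Sum>(x, y)\<in>?\<iota> ` ?D. norm (v y - v x)) = (\<Sum>p\<in>?D. norm (v (\<tau> (snd p)) - v (\<tau> (fst p))))"
      by (subst sum.reindex[OF inj]) simp
    moreover have "(\<Sum>p\<in>?D. norm (v (\<tau> (snd p)) - v (\<tau> (fst p)))) = (\<Sum>p\<in>D. norm (v (\<tau> (snd p)) - v (\<tau> (fst p))))"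
      by (rule sum.mono_neutral_left) (use fin in auto)
    ultimately show ?thesis by (simp add: split_def)
  qed
  then show "\<exists>\<delta>>0. \<forall>D. interval_family c d D \<and> (\<Sum>(x, y)\<in>D. y - x) < \<delta> \<longrightarrow>
      (\<Sum>(x, y)\<in>D. norm (v (\<tau> y) - v (\<tau> x))) < e"
    using divide_pos_pos[OF \<delta>(1) M] by blast
qed

lemma lipschitz_on_if_ae_derivative_bounded:
  fixes f :: "real \<Rightarrow> 'x::real_normed_vector"
  assumes ac: "abs_continuous_curve a b f" and N: "negligible N"
    and der: "\<And>x. x \<in> {a..b} - N \<Longrightarrow> (f has_vector_derivative f' x) (at x)"
    and bd: "\<And>x. x \<in> {a..b} - N \<Longrightarrow> norm (f' x) \<le> C" and C: "0 \<le> C"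
  shows "C-lipschitz_on {a..b} f"
proof (rule lipschitz_onI[OF _ C])
  have le: "dist (f x) (f y) \<le> C * dist x y" if xy: "a \<le> x" "x \<le> y" "y \<le> b" for x y
  proof -
    let ?g = "\<lambda>s. if s \<in> N then 0 else f' s"
    have "(f' has_integral f y - f x) {x..y}"
      by (rule abs_continuous_has_integral_derivative
          [OF xy(2) abs_continuous_curve_subinterval[OF ac xy(1,3)] N])
         (use der xy in \<open>auto intro: has_vector_derivative_at_within\<close>)
    then have "(?g has_integral f y - f x) (cbox x y)"
      unfolding box_real by (rule has_integral_spike[OF N, rotated]) simp
    then have "norm (f y - f x) \<le> C * measure lborel (cbox x y)"
      by (rule has_integral_bound[OF C]) (use bd C xy in auto)
    then show ?thesis using xy by (simp add: dist_norm norm_minus_commute)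
  qed
  show "dist (f x) (f y) \<le> C * dist x y" if "x \<in> {a..b}" "y \<in> {a..b}" for x y
    using le[of x y] le[of y x] that by (cases "x \<le> y") (auto simp: dist_commute)
qed

lemma lipschitz_has_integral_derivative:
  fixes f :: "real \<Rightarrow> 'x::real_normed_vector"
  assumes L: "L-lipschitz_on {a..b} f" and N: "negligible N"
    and der: "\<And>x. x \<in> {a..b} - N \<Longrightarrow> (f has_vector_derivative f' x) (at x)"
    and cd: "a \<le> c" "c \<le> d" "d \<le> b"
  shows "(f' has_integral f d - f c) {c..d}"
  by (rule abs_continuous_has_integral_derivative[OF cd(2)
        lipschitz_on_imp_abs_continuous_curve[OF lipschitz_on_subset[OF L]] N])
     (use der cd in \<open>auto intro: has_vector_derivative_at_within\<close>)

lemma lipschitz_differentiable_ae: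
  fixes f :: "real \<Rightarrow> 'x::real_normed_vector"
  assumes fd: "\<exists>B :: 'x set. finite B \<and> span B = UNIV" and L: "L-lipschitz_on {a..b} f"
  shows "\<exists>N. negligible N \<and> (\<forall>x\<in>{a..b} - N. a < x \<and> x < b \<and>
      (f has_vector_derivative vector_derivative f (at x)) (at x))"
proof (intro exI conjI ballI)
  let ?N = "{x. a < x \<and> x < b \<and> \<not> f differentiable (at x)} \<union> {a, b}"
  show "negligible ?N"
    using abs_continuous_curve_differentiable_ae[OF fd lipschitz_on_imp_abs_continuous_curve[OF L]]
    by (rule negligible_Un) (intro negligible_finite, simp)
  fix x assume x: "x \<in> {a..b} - ?N"
  then show "a < x" "x < b" by auto
  then show "(f has_vector_derivative vector_derivative f (at x)) (at x)"
    using x by (simp add: vector_derivative_works)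
qed

lemma finite_dim_real: "\<exists>B :: real set. finite B \<and> span B = UNIV"
proof (intro exI[of _ "{1::real}"] conjI)
  have "x \<in> span {1::real}" for x using span_scale[OF span_base[of 1 "{1::real}"], of x] by simp
  then show "span {1::real} = UNIV" by blast
qed simp

lemma right_difference_quotient_tendsto:
  fixes f :: "real \<Rightarrow> 'x::real_normed_vector"
  assumes "(f has_vector_derivative D) (at x)"
  shows "((\<lambda>y. (f y - f x) /\<^sub>R (y - x)) \<longlongrightarrow> D) (at_right x)"
proof -
  have lim: "((\<lambda>y. norm (f y - f x - (y - x) *\<^sub>R D) / norm (y - x)) \<longlongrightarrow> 0) (at_right x)"
    using has_vector_derivative_at_within[OF assms, of "{x<..}"]
    unfolding has_vector_derivative_def has_derivative_iff_norm by simp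
  have "((\<lambda>y. (f y - f x) /\<^sub>R (y - x) - D) \<longlongrightarrow> 0) (at_right x)"
  proof (rule Lim_null_comparison[OF _ lim])
    show "eventually (\<lambda>y. norm ((f y - f x) /\<^sub>R (y - x) - D) \<le> norm (f y - f x - (y - x) *\<^sub>R D) / norm (y - x)) (at_right x)"
      unfolding eventually_at_right_field
    proof (intro exI[of _ "x + 1"] conjI allI impI)
      fix y assume y: "x < y"
      have "(f y - f x) /\<^sub>R (y - x) - D = (f y - f x - (y - x) *\<^sub>R D) /\<^sub>R (y - x)"
        using y by (simp add: scaleR_diff_right)
      then show "norm ((f y - f x) /\<^sub>R (y - x) - D) \<le> norm (f y - f x - (y - x) *\<^sub>R D) / norm (y - x)"
        by (simp only: norm_scaleR) (simp add: divide_inverse mult.commute)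
    qed simp
  qed
  then show ?thesis by (simp add: LIM_zero_iff)
qed

lemma derivative_le_if_right_increments_le:
  fixes \<phi> :: "real \<Rightarrow> real"
  assumes der: "(\<phi> has_vector_derivative D) (at x)"
    and le: "eventually (\<lambda>y. \<phi> y - \<phi> x \<le> c * (y - x)) (at_right x)"
  shows "D \<le> c"
proof (rule tendsto_upperbound[OF right_difference_quotient_tendsto[OF der]])
  show "eventually (\<lambda>y. (\<phi> y - \<phi> x) /\<^sub>R (y - x) \<le> c) (at_right x)"
    using le eventually_at_right_less[of x]
    by eventually_elim (simp add: field_simps)
qed simp

lemma gauge_derivative_le_if_right_increments_le:
  fixes f :: "real \<Rightarrow> 'x::real_normed_vector"
  assumes fd: "\<exists>B :: 'x set. finite B \<and> span B = UNIV" and q: "gauge_fun q"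
    and f: "(f has_vector_derivative f') (at x)" and \<phi>: "(\<phi> has_vector_derivative D) (at x)"
    and le: "eventually (\<lambda>y. q (f y - f x) \<le> \<phi> y - \<phi> x) (at_right x)"
  shows "q f' \<le> D"
proof (rule tendsto_le[OF _ right_difference_quotient_tendsto[OF \<phi>]])
  have "isCont q f'" using gauge_fun_continuous[OF fd q, of UNIV] by (simp add: continuous_on_eq_continuous_at)
  then show "((\<lambda>y. q ((f y - f x) /\<^sub>R (y - x))) \<longlongrightarrow> q f') (at_right x)"
    by (rule isCont_tendsto_compose) (rule right_difference_quotient_tendsto[OF f])
  show "eventually (\<lambda>y. q ((f y - f x) /\<^sub>R (y - x)) \<le> (\<phi> y - \<phi> x) /\<^sub>R (y - x)) (at_right x)"
    using le eventually_at_right_less[of x]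
  proof eventually_elim
    case (elim y)
    then have "q ((f y - f x) /\<^sub>R (y - x)) = inverse (y - x) * q (f y - f x)"
      by (intro gauge_funD(4)[OF q]) simp
    then show ?case using elim by simp
  qed
qed simp

text \<open>
  Jensen's inequality for a sublinear function, without vector-valued integrals: the real function
  \<open>s \<mapsto> q (f s - f a)\<close> is Lipschitz, and by subadditivity its derivative is at most \<open>q (f' s)\<close>
  almost everywhere.
\<close>

lemma gauge_increment_le_integral:
  fixes f :: "real \<Rightarrow> 'x::real_normed_vector"
  assumes fd: "\<exists>B :: 'x set. finite B \<and> span B = UNIV" and q: "gauge_fun q"
    and L: "L-lipschitz_on {a..b} f" and ab: "a \<le> b" and N: "negligible N"
    and der: "\<And>s. s \<in> {a..b} - N \<Longrightarrow> (f has_vector_derivative f' s) (at s)"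
    and le: "\<And>s. s \<in> {a..b} - N \<Longrightarrow> q (f' s) \<le> \<mu> s"
    and \<mu>: "(\<mu> has_integral I) {a..b}"
  shows "q (f b - f a) \<le> I"
proof -
  obtain K where K: "0 < K" "\<And>v. q v \<le> K * norm v" using gauge_fun_upper_bound[OF fd q] by blast
  define \<phi> where "\<phi> s = q (f s - f a)" for s
  have L\<phi>: "(K * L)-lipschitz_on {a..b} \<phi>"
  proof (rule lipschitz_onI)
    fix x y assume xy: "x \<in> {a..b}" "y \<in> {a..b}"
    have "dist (\<phi> x) (\<phi> y) \<le> K * dist (f x) (f y)"
      using gauge_fun_lipschitz[OF q K(2), of "f x - f a" "f y - f a"]
      by (simp add: \<phi>_def dist_norm)
    also have "\<dots> \<le> K * (L * dist x y)" using lipschitz_onD[OF L xy] K(1) by (intro mult_left_mono) auto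
    finally show "dist (\<phi> x) (\<phi> y) \<le> K * L * dist x y" by (simp add: mult.assoc)
  qed (use K(1) lipschitz_on_nonneg[OF L] in simp)
  obtain N' where N': "negligible N'" "\<And>s. s \<in> {a..b} - N' \<Longrightarrow> a < s \<and> s < b \<and>
      (\<phi> has_vector_derivative vector_derivative \<phi> (at s)) (at s)"
    using lipschitz_differentiable_ae[OF finite_dim_real L\<phi>] by blast
  let ?N = "N \<union> N'"
  have N'': "negligible ?N" using N N'(1) by simp
  let ?D = "\<lambda>s. if s \<in> ?N then 0 else vector_derivative \<phi> (at s)"
  have "(?D has_integral \<phi> b - \<phi> a) {a..b}"
    by (rule lipschitz_has_integral_derivative[OF L\<phi> N'']) (use N'(2) ab in auto)
  moreover have "((\<lambda>s. if s \<in> ?N then 0 else \<mu> s) has_integral I) {a..b}"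
    using \<mu> by (rule has_integral_spike[OF N'', rotated]) simp
  ultimately have "\<phi> b - \<phi> a \<le> I"
  proof (rule has_integral_le)
    fix s assume s: "s \<in> {a..b}"
    show "?D s \<le> (if s \<in> ?N then 0 else \<mu> s)"
    proof (cases "s \<in> ?N")
      case False
      let ?d = "vector_derivative \<phi> (at s)"
      have d\<phi>: "(\<phi> has_vector_derivative ?d) (at s)" using False s N'(2) by simp
      have df: "(f has_vector_derivative f' s) (at s)" using False s der by simp
      have "?d \<le> q (f' s)"
      proof (rule tendsto_le[OF _ _ right_difference_quotient_tendsto[OF d\<phi>]])
        have "isCont q (f' s)" using gauge_fun_continuous[OF fd q, of UNIV]
          by (simp add: continuous_on_eq_continuous_at)
        then show "((\<lambda>y. q ((f y - f s) /\<^sub>R (y - s))) \<longlongrightarrow> q (f' s)) (at_right s)"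
          by (rule isCont_tendsto_compose) (rule right_difference_quotient_tendsto[OF df])
        show "eventually (\<lambda>y. (\<phi> y - \<phi> s) /\<^sub>R (y - s) \<le> q ((f y - f s) /\<^sub>R (y - s))) (at_right s)"
          using eventually_at_right_less[of s]
        proof eventually_elim
          case (elim y)
          then have "q ((f y - f s) /\<^sub>R (y - s)) = inverse (y - s) * q (f y - f s)"
            by (intro gauge_funD(4)[OF q]) simp
          moreover have "\<phi> y - \<phi> s \<le> q (f y - f s)"
            using gauge_funD(3)[OF q, of "f y - f s" "f s - f a"] by (simp add: \<phi>_def)
          ultimately show ?case using elim by simp
        qed
      qed simp
      then show ?thesis using le[of s] False s by simp
    qed simp
  qed
  moreover have "\<phi> a = 0" using gauge_funD(4)[OF q, of 0 0] by (simp add: \<phi>_def)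
  ultimately show ?thesis by (simp add: \<phi>_def)
qed

section \<open>Dissipation potentials and the contact potential\<close>

lemma superlinear_dissipationD:
  assumes "superlinear_dissipation \<Psi>"
  shows "0 \<le> \<Psi> v" "convex_on UNIV \<Psi>" "\<Psi> 0 = 0"
  using assms by (auto simp: superlinear_dissipation_def)

lemma scaled_dissipation_mono:
  assumes \<Psi>: "superlinear_dissipation \<Psi>" and de: "0 < \<delta>" "\<delta> \<le> \<epsilon>"
  shows "scaled_dissipation \<Psi> \<delta> v \<le> scaled_dissipation \<Psi> \<epsilon> v"
proof -
  note \<Psi>D = superlinear_dissipationD[OF \<Psi>]
  let ?l = "\<delta> / \<epsilon>"
  have l: "0 \<le> ?l" "?l \<le> 1" using de by auto
  have "\<Psi> ((1 - ?l) *\<^sub>R 0 + ?l *\<^sub>R (\<epsilon> *\<^sub>R v)) \<le> (1 - ?l) * \<Psi> 0 + ?l * \<Psi> (\<epsilon> *\<^sub>R v)"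
    by (rule convex_onD[OF \<Psi>D(2)]) (use l in auto)
  then have "\<Psi> (\<delta> *\<^sub>R v) \<le> ?l * \<Psi> (\<epsilon> *\<^sub>R v)" using \<Psi>D(3) de by simp
  then show ?thesis using de by (simp add: scaled_dissipation_def field_simps)
qed

text \<open>
  By convexity and \<open>\<Psi> 0 = 0\<close> the scaled potentials decrease as \<open>\<epsilon>\<close> decreases to 0.
\<close>

lemma limit_dissipation_le_scaled:
  assumes \<Psi>: "superlinear_dissipation \<Psi>"
    and lim: "((\<lambda>\<delta>. scaled_dissipation \<Psi> \<delta> z) \<longlongrightarrow> l) (at_right 0)" and \<epsilon>: "0 < \<epsilon>"
  shows "l \<le> scaled_dissipation \<Psi> \<epsilon> z"
proof (rule tendsto_upperbound[OF lim])
  show "eventually (\<lambda>\<delta>. scaled_dissipation \<Psi> \<delta> z \<le> scaled_dissipation \<Psi> \<epsilon> z) (at_right 0)"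
    unfolding eventually_at_right_field
    by (intro exI[of _ \<epsilon>] conjI allI impI \<epsilon> scaled_dissipation_mono[OF \<Psi>]) auto
qed simp

text \<open>
  A real-valued version of the conjugate of \<open>\<Psi>\<close>, which superlinear growth makes finite.
\<close>

definition conjugate_value :: "('x::real_normed_vector \<Rightarrow> real) \<Rightarrow> ('x \<Rightarrow>\<^sub>L real) \<Rightarrow> real" where
  "conjugate_value \<Psi> w = (SUP z. blinfun_apply w z - \<Psi> z)"

lemma bdd_above_conjugate:
  assumes \<Psi>: "superlinear_dissipation \<Psi>"
  shows "bdd_above (range (\<lambda>z. blinfun_apply w z - \<Psi> z))"
proof -
  note \<Psi>D = superlinear_dissipationD[OF \<Psi>]
  have "filterlim (\<lambda>v. \<Psi> v / norm v) at_top at_infinity"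
    using \<Psi> by (simp add: superlinear_dissipation_def)
  then have "eventually (\<lambda>v. norm w \<le> \<Psi> v / norm v) at_infinity" by (simp add: filterlim_at_top)
  then obtain R where R: "\<And>v. R \<le> norm v \<Longrightarrow> norm w \<le> \<Psi> v / norm v"
    unfolding eventually_at_infinity by blast
  have wn: "blinfun_apply w v \<le> norm w * norm v" for v
    using norm_blinfun[of w v] by simp
  have "blinfun_apply w v - \<Psi> v \<le> norm w * \<bar>R\<bar>" for v
  proof (cases "R \<le> norm v \<and> v \<noteq> 0")
    case True
    then have "norm w * norm v \<le> \<Psi> v" using R[of v] by (simp add: field_simps)
    moreover have "0 \<le> norm w * \<bar>R\<bar>" by simp
    ultimately show ?thesis using wn[of v] by linarith
  next
    case False
    then have "norm v \<le> \<bar>R\<bar>" by auto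
    then have "norm w * norm v \<le> norm w * \<bar>R\<bar>" by (intro mult_left_mono) auto
    then show ?thesis using wn[of v] \<Psi>D(1)[of v] by linarith
  qed
  then show ?thesis by (intro bdd_aboveI[of _ "norm w * \<bar>R\<bar>"]) auto
qed

lemma conjugate_value_upper:
  assumes "superlinear_dissipation \<Psi>"
  shows "blinfun_apply w z - \<Psi> z \<le> conjugate_value \<Psi> w"
  unfolding conjugate_value_def by (rule cSUP_upper[OF _ bdd_above_conjugate[OF assms]]) simp

lemma conjugate_value_nonneg:
  assumes "superlinear_dissipation \<Psi>"
  shows "0 \<le> conjugate_value \<Psi> w"
  using conjugate_value_upper[OF assms, of w 0] superlinear_dissipationD(3)[OF assms] by simp

lemma less_conjugate_valueE:
  assumes "superlinear_dissipation \<Psi>" "c < conjugate_value \<Psi> w"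
  obtains z where "c < blinfun_apply w z - \<Psi> z"
  using assms(2) unfolding conjugate_value_def less_cSUP_iff[OF UNIV_not_empty bdd_above_conjugate[OF assms(1)]]
  by blast

lemma legendre_conjugate_scaled:
  assumes \<Psi>: "superlinear_dissipation \<Psi>" and \<epsilon>: "0 < \<epsilon>"
  shows "legendre_conjugate (scaled_dissipation \<Psi> \<epsilon>) w = ereal (conjugate_value \<Psi> w / \<epsilon>)"
proof (rule antisym)
  show "legendre_conjugate (scaled_dissipation \<Psi> \<epsilon>) w \<le> ereal (conjugate_value \<Psi> w / \<epsilon>)"
    unfolding legendre_conjugate_def
  proof (rule SUP_least)
    fix v show "ereal (blinfun_apply w v - scaled_dissipation \<Psi> \<epsilon> v) \<le> ereal (conjugate_value \<Psi> w / \<epsilon>)"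
      using divide_right_mono[OF conjugate_value_upper[OF \<Psi>, of w "\<epsilon> *\<^sub>R v"], of \<epsilon>] \<epsilon>
      by (simp add: scaled_dissipation_def blinfun.scaleR_right diff_divide_distrib)
  qed
  show "ereal (conjugate_value \<Psi> w / \<epsilon>) \<le> legendre_conjugate (scaled_dissipation \<Psi> \<epsilon>) w"
  proof (rule ereal_le_epsilon2)
    fix e :: real assume e: "0 < e"
    have "conjugate_value \<Psi> w - e * \<epsilon> < conjugate_value \<Psi> w" using e \<epsilon> by simp
    then obtain z where z: "conjugate_value \<Psi> w - e * \<epsilon> < blinfun_apply w z - \<Psi> z"
      by (rule less_conjugate_valueE[OF \<Psi>])
    let ?v = "z /\<^sub>R \<epsilon>"
    have "(conjugate_value \<Psi> w - e * \<epsilon>) / \<epsilon> \<le> (blinfun_apply w z - \<Psi> z) / \<epsilon>"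
      using z \<epsilon> by (intro divide_right_mono) auto
    moreover have "(conjugate_value \<Psi> w - e * \<epsilon>) / \<epsilon> = conjugate_value \<Psi> w / \<epsilon> - e"
      using \<epsilon> by (simp add: diff_divide_distrib)
    moreover have "(blinfun_apply w z - \<Psi> z) / \<epsilon> = blinfun_apply w ?v - scaled_dissipation \<Psi> \<epsilon> ?v"
      using \<epsilon> by (simp add: scaled_dissipation_def blinfun.scaleR_right right_diff_distrib divide_inverse_commute)
    ultimately have "conjugate_value \<Psi> w / \<epsilon> - e \<le> blinfun_apply w ?v - scaled_dissipation \<Psi> \<epsilon> ?v"
      by simp
    then have "ereal (conjugate_value \<Psi> w / \<epsilon> - e) \<le> ereal (blinfun_apply w ?v - scaled_dissipation \<Psi> \<epsilon> ?v)"
      by simp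
    also have "\<dots> \<le> legendre_conjugate (scaled_dissipation \<Psi> \<epsilon>) w"
      unfolding legendre_conjugate_def by (rule SUP_upper) simp
    finally have "ereal (conjugate_value \<Psi> w / \<epsilon> - e) + ereal e \<le> legendre_conjugate (scaled_dissipation \<Psi> \<epsilon>) w + ereal e"
      by (rule add_right_mono)
    then show "ereal (conjugate_value \<Psi> w / \<epsilon>) \<le> legendre_conjugate (scaled_dissipation \<Psi> \<epsilon>) w + ereal e"
      by simp
  qed
qed

text \<open>
  The contact potential with the conjugate at the force replaced by a free constant \<open>c\<close>. This
  decouples the two arguments: for fixed \<open>c\<close> one obtains a gauge of the velocity.
\<close>

definition contact_gauge :: "('x::real_normed_vector \<Rightarrow> real) \<Rightarrow> real \<Rightarrow> 'x \<Rightarrow> real" where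
  "contact_gauge \<Psi> c v = (INF \<delta>\<in>{0<..}. (\<Psi> (\<delta> *\<^sub>R v) + c) / \<delta>)"

lemma contact_gauge_lower:
  assumes "superlinear_dissipation \<Psi>" "0 \<le> c" "0 < \<delta>"
  shows "contact_gauge \<Psi> c v \<le> (\<Psi> (\<delta> *\<^sub>R v) + c) / \<delta>"
  unfolding contact_gauge_def
proof (rule cINF_lower)
  show "bdd_below ((\<lambda>\<delta>. (\<Psi> (\<delta> *\<^sub>R v) + c) / \<delta>) ` {0<..})"
    using superlinear_dissipationD(1)[OF assms(1)] assms(2) by (intro bdd_belowI[of _ 0]) auto
qed (use assms in simp)

lemma contact_gauge_greatest:
  assumes "\<And>\<delta>. 0 < \<delta> \<Longrightarrow> x \<le> (\<Psi> (\<delta> *\<^sub>R v) + c) / \<delta>"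
  shows "x \<le> contact_gauge \<Psi> c v"
  unfolding contact_gauge_def by (rule cINF_greatest) (use assms in auto)

lemma vv_contact_potential_eq:
  assumes \<Psi>: "superlinear_dissipation \<Psi>"
  shows "vv_contact_potential \<Psi> v w = ereal (contact_gauge \<Psi> (conjugate_value \<Psi> w) v)"
proof -
  let ?c = "conjugate_value \<Psi> w"
  have c: "0 \<le> ?c" by (rule conjugate_value_nonneg[OF \<Psi>])
  have eq: "ereal (scaled_dissipation \<Psi> \<epsilon> v) + legendre_conjugate (scaled_dissipation \<Psi> \<epsilon>) w
      = ereal ((\<Psi> (\<epsilon> *\<^sub>R v) + ?c) / \<epsilon>)" if "0 < \<epsilon>" for \<epsilon>
    using legendre_conjugate_scaled[OF \<Psi> that] by (simp add: scaled_dissipation_def add_divide_distrib)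
  show ?thesis
  proof (rule antisym)
    show "vv_contact_potential \<Psi> v w \<le> ereal (contact_gauge \<Psi> ?c v)"
    proof (rule ereal_le_epsilon2)
      fix e :: real assume e: "0 < e"
      have "\<exists>\<delta>>0. (\<Psi> (\<delta> *\<^sub>R v) + ?c) / \<delta> < contact_gauge \<Psi> ?c v + e"
      proof (rule ccontr)
        assume n: "\<not> ?thesis"
        have "contact_gauge \<Psi> ?c v + e \<le> contact_gauge \<Psi> ?c v"
        proof (rule contact_gauge_greatest)
          show "contact_gauge \<Psi> ?c v + e \<le> (\<Psi> (\<delta> *\<^sub>R v) + ?c) / \<delta>" if "0 < \<delta>" for \<delta>
            using n that by (meson not_less)
        qed
        then show False using e by simp
      qed
      then obtain \<delta> where \<delta>: "0 < \<delta>" "(\<Psi> (\<delta> *\<^sub>R v) + ?c) / \<delta> < contact_gauge \<Psi> ?c v + e" by blast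
      have "vv_contact_potential \<Psi> v w \<le> ereal ((\<Psi> (\<delta> *\<^sub>R v) + ?c) / \<delta>)"
        unfolding vv_contact_potential_def eq[OF \<delta>(1), symmetric]
        by (rule INF_lower) (use \<delta> in simp)
      also have "\<dots> \<le> ereal (contact_gauge \<Psi> ?c v) + ereal e" using \<delta>(2) by simp
      finally show "vv_contact_potential \<Psi> v w \<le> ereal (contact_gauge \<Psi> ?c v) + ereal e" .
    qed
    show "ereal (contact_gauge \<Psi> ?c v) \<le> vv_contact_potential \<Psi> v w"
      unfolding vv_contact_potential_def
    proof (rule INF_greatest)
      fix \<epsilon> :: real assume "\<epsilon> \<in> {0<..}"
      then have \<epsilon>: "0 < \<epsilon>" by simp
      show "ereal (contact_gauge \<Psi> ?c v) \<le>
          ereal (scaled_dissipation \<Psi> \<epsilon> v) + legendre_conjugate (scaled_dissipation \<Psi> \<epsilon>) w"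
        unfolding eq[OF \<epsilon>] ereal_less_eq by (rule contact_gauge_lower[OF \<Psi> c \<epsilon>])
    qed
  qed
qed

lemma contact_gauge_ge_pairing:
  assumes \<Psi>: "superlinear_dissipation \<Psi>"
  shows "blinfun_apply w v \<le> contact_gauge \<Psi> (conjugate_value \<Psi> w) v"
proof (rule contact_gauge_greatest)
  fix \<delta> :: real assume "0 < \<delta>"
  then show "blinfun_apply w v \<le> (\<Psi> (\<delta> *\<^sub>R v) + conjugate_value \<Psi> w) / \<delta>"
    using conjugate_value_upper[OF \<Psi>, of w "\<delta> *\<^sub>R v"] by (simp add: blinfun.scaleR_right field_simps)
qed

lemma contact_gauge_0_le:
  assumes \<Psi>: "superlinear_dissipation \<Psi>"
    and lim: "((\<lambda>\<delta>. scaled_dissipation \<Psi> \<delta> v) \<longlongrightarrow> l) (at_right 0)"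
  shows "contact_gauge \<Psi> 0 v \<le> l"
proof (rule tendsto_lowerbound[OF lim])
  show "eventually (\<lambda>\<delta>. contact_gauge \<Psi> 0 v \<le> scaled_dissipation \<Psi> \<delta> v) (at_right 0)"
    using eventually_at_right_less[of 0]
  proof eventually_elim
    case (elim \<delta>)
    then show ?case using contact_gauge_lower[OF \<Psi>, of 0 \<delta> v] by (simp add: scaled_dissipation_def)
  qed
qed simp

text \<open>
  Left-continuity in \<open>c\<close>, in the only form needed.
\<close>

lemma contact_gauge_scale_constant:
  assumes \<Psi>: "superlinear_dissipation \<Psi>" and c: "0 < c" "c \<le> d"
  shows "contact_gauge \<Psi> d v \<le> (d / c) * contact_gauge \<Psi> c v"
proof -
  have "(c / d) * contact_gauge \<Psi> d v \<le> contact_gauge \<Psi> c v"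
  proof (rule contact_gauge_greatest)
    fix \<delta> :: real assume \<delta>: "0 < \<delta>"
    have "(c / d) * contact_gauge \<Psi> d v \<le> (c / d) * ((\<Psi> (\<delta> *\<^sub>R v) + d) / \<delta>)"
      by (rule mult_left_mono[OF contact_gauge_lower[OF \<Psi> _ \<delta>]]) (use c in auto)
    also have "\<dots> = ((c / d) * \<Psi> (\<delta> *\<^sub>R v) + c) / \<delta>" using c by (simp add: field_simps)
    also have "\<dots> \<le> (\<Psi> (\<delta> *\<^sub>R v) + c) / \<delta>"
      using \<delta> c superlinear_dissipationD(1)[OF \<Psi>, of "\<delta> *\<^sub>R v"]
      by (intro divide_right_mono add_right_mono mult_left_le_one_le) auto
    finally show "(c / d) * contact_gauge \<Psi> d v \<le> (\<Psi> (\<delta> *\<^sub>R v) + c) / \<delta>" .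
  qed
  then show ?thesis using c by (simp add: field_simps)
qed

text \<open>
  Positivity is inherited from \<open>\<Psi>0\<close>. For subadditivity, parameters \<open>a\<close> for \<open>v\<close> and \<open>b\<close> for \<open>w\<close> are
  combined into \<open>\<delta>\<close> with \<open>1 / \<delta> = 1 / a + 1 / b\<close>; then \<open>\<delta> (v + w)\<close> is a convex combination of
  \<open>a v\<close> and \<open>b w\<close>, and the constants \<open>c / a\<close>, \<open>c / b\<close> add up to \<open>c / \<delta>\<close>.
\<close>

lemma gauge_fun_contact_gauge:
  assumes \<Psi>: "superlinear_dissipation \<Psi>" and g: "gauge_fun \<Psi>0" and c: "0 \<le> c"
    and lim: "\<And>z. ((\<lambda>\<delta>. scaled_dissipation \<Psi> \<delta> z) \<longlongrightarrow> \<Psi>0 z) (at_right 0)"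
  shows "gauge_fun (contact_gauge \<Psi> c)"
proof -
  note \<Psi>D = superlinear_dissipationD[OF \<Psi>]
  let ?q = "contact_gauge \<Psi> c"
  have low: "\<Psi>0 v \<le> ?q v" for v
  proof (rule contact_gauge_greatest)
    fix \<delta> :: real assume \<delta>: "0 < \<delta>"
    have "\<Psi>0 v \<le> \<Psi> (\<delta> *\<^sub>R v) / \<delta>"
      using limit_dissipation_le_scaled[OF \<Psi> lim[of v] \<delta>] by (simp add: scaled_dissipation_def)
    also have "\<dots> \<le> (\<Psi> (\<delta> *\<^sub>R v) + c) / \<delta>" using \<delta> c by (intro divide_right_mono) auto
    finally show "\<Psi>0 v \<le> (\<Psi> (\<delta> *\<^sub>R v) + c) / \<delta>" .
  qed
  have sub: "?q (v + w) \<le> ?q v + ?q w" for v w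
  proof -
    have two: "?q (v + w) \<le> (\<Psi> (a *\<^sub>R v) + c) / a + (\<Psi> (b *\<^sub>R w) + c) / b" if ab: "0 < a" "0 < b" for a b
    proof -
      define l where "l = a / (a + b)"
      have l: "0 \<le> l" "l \<le> 1" using ab by (auto simp: l_def)
      define \<delta> where "\<delta> = (a * b) / (a + b)"
      have \<delta>: "0 < \<delta>" using ab by (simp add: \<delta>_def)
      have nz: "a \<noteq> 0" "b \<noteq> 0" "a + b \<noteq> 0" using ab by auto
      have l': "1 - l = b / (a + b)" using nz by (simp add: l_def field_simps)
      have e: "(1 - l) * a = \<delta>" "l * b = \<delta>" unfolding l' unfolding l_def \<delta>_def by simp_all
      have "\<delta> *\<^sub>R (v + w) = (1 - l) *\<^sub>R (a *\<^sub>R v) + l *\<^sub>R (b *\<^sub>R w)"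
        by (simp add: e scaleR_add_right)
      moreover have "\<Psi> ((1 - l) *\<^sub>R (a *\<^sub>R v) + l *\<^sub>R (b *\<^sub>R w)) \<le> (1 - l) * \<Psi> (a *\<^sub>R v) + l * \<Psi> (b *\<^sub>R w)"
        by (rule convex_onD[OF \<Psi>D(2) l]) auto
      ultimately have "?q (v + w) \<le> ((1 - l) * \<Psi> (a *\<^sub>R v) + l * \<Psi> (b *\<^sub>R w) + c) / \<delta>"
        using contact_gauge_lower[OF \<Psi> c \<delta>, of "v + w"] \<delta>
        by (elim order_trans) (intro divide_right_mono, auto)
      also have "\<dots> = (\<Psi> (a *\<^sub>R v) + c) / a + (\<Psi> (b *\<^sub>R w) + c) / b"
      proof -
        have "(1 - l) / \<delta> = 1 / a" "l / \<delta> = 1 / b" using e nz \<delta> by (simp_all add: field_simps)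
        moreover from this have "1 / \<delta> = 1 / a + 1 / b"
          using add_divide_distrib[of "1 - l" l \<delta>] by simp
        moreover have "((1 - l) * \<Psi> (a *\<^sub>R v) + l * \<Psi> (b *\<^sub>R w) + c) / \<delta>
            = ((1 - l) / \<delta>) * \<Psi> (a *\<^sub>R v) + (l / \<delta>) * \<Psi> (b *\<^sub>R w) + (1 / \<delta>) * c"
          by (simp add: add_divide_distrib)
        ultimately show ?thesis by (simp add: add_divide_distrib algebra_simps)
      qed
      finally show ?thesis .
    qed
    have "?q (v + w) - (\<Psi> (b *\<^sub>R w) + c) / b \<le> ?q v" if "0 < b" for b
      by (rule contact_gauge_greatest) (use two that in \<open>simp add: algebra_simps\<close>)
    then have "?q (v + w) - ?q v \<le> ?q w"
      by (intro contact_gauge_greatest) (simp add: algebra_simps)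
    then show ?thesis by simp
  qed
  have hom_le: "?q (t *\<^sub>R v) \<le> t * ?q v" if t: "0 < t" for t v
  proof -
    have "?q (t *\<^sub>R v) / t \<le> ?q v"
    proof (rule contact_gauge_greatest)
      fix \<delta> :: real assume \<delta>: "0 < \<delta>"
      have "?q (t *\<^sub>R v) \<le> (\<Psi> ((\<delta> / t) *\<^sub>R (t *\<^sub>R v)) + c) / (\<delta> / t)"
        using \<delta> t by (intro contact_gauge_lower[OF \<Psi> c]) simp
      then show "?q (t *\<^sub>R v) / t \<le> (\<Psi> (\<delta> *\<^sub>R v) + c) / \<delta>" using \<delta> t by (simp add: field_simps)
    qed
    then show ?thesis using t by (simp add: field_simps)
  qed
  have hom: "?q (t *\<^sub>R v) = t * ?q v" if t: "0 < t" for t v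
  proof (rule antisym[OF hom_le[OF t]])
    have "?q (inverse t *\<^sub>R (t *\<^sub>R v)) \<le> inverse t * ?q (t *\<^sub>R v)" using t by (intro hom_le) simp
    then show "t * ?q v \<le> ?q (t *\<^sub>R v)" using t by (simp add: field_simps)
  qed
  have zero: "?q 0 = 0"
    using hom[of 2 0] by simp
  show ?thesis
    unfolding gauge_fun_def
  proof (intro conjI allI impI)
    show "0 \<le> ?q v" for v using low[of v] gauge_funD(1)[OF g, of v] by simp
    show "0 < ?q v" if "v \<noteq> 0" for v using low[of v] gauge_funD(2)[OF g that] by simp
    show "?q (v + w) \<le> ?q v + ?q w" for v w by (rule sub)
    show "?q (t *\<^sub>R v) = t * ?q v" if "0 \<le> t" for t v
      using hom[of t v] zero that by (cases "t = 0") auto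
  qed
qed

text \<open>
  The Fenchel equality for the subgradient \<open>w\<close>: the supremum defining the conjugate is attained at
  \<open>v /\<^sub>R a\<close>.
\<close>

lemma viscous_space_time_potential_eq:
  assumes w: "w \<in> subdifferential (scaled_dissipation \<Psi> \<epsilon>) (v /\<^sub>R a)" and a: "0 < a"
  shows "viscous_space_time_potential \<Psi> \<epsilon> a v p w = ereal (blinfun_apply w v + a * p)"
proof -
  let ?f = "scaled_dissipation \<Psi> \<epsilon>"
  have "legendre_conjugate ?f w = ereal (blinfun_apply w (v /\<^sub>R a) - ?f (v /\<^sub>R a))"
  proof (rule antisym)
    show "legendre_conjugate ?f w \<le> ereal (blinfun_apply w (v /\<^sub>R a) - ?f (v /\<^sub>R a))"
      unfolding legendre_conjugate_def
    proof (rule SUP_least)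
      fix z
      have "?f (v /\<^sub>R a) + blinfun_apply w (z - v /\<^sub>R a) \<le> ?f z" using w unfolding subdifferential_def by blast
      then show "ereal (blinfun_apply w z - ?f z) \<le> ereal (blinfun_apply w (v /\<^sub>R a) - ?f (v /\<^sub>R a))"
        by (simp add: blinfun.diff_right)
    qed
    show "ereal (blinfun_apply w (v /\<^sub>R a) - ?f (v /\<^sub>R a)) \<le> legendre_conjugate ?f w"
      unfolding legendre_conjugate_def by (rule SUP_upper) simp
  qed
  then have "viscous_space_time_potential \<Psi> \<epsilon> a v p w
      = ereal (a * ?f (v /\<^sub>R a) + a * (blinfun_apply w (v /\<^sub>R a) - ?f (v /\<^sub>R a)) + a * p)"
    by (simp add: viscous_space_time_potential_def)
  also have "a * ?f (v /\<^sub>R a) + a * (blinfun_apply w (v /\<^sub>R a) - ?f (v /\<^sub>R a)) = blinfun_apply w v"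
    using a by (simp add: blinfun.scaleR_right algebra_simps)
  finally show ?thesis .
qed

text \<open>
  The subgradient inequality tested at \<open>z / \<epsilon>\<close> and multiplied by \<open>a\<close>. The left-hand side has the
  form of the infimum in \<open>contact_gauge\<close>, with parameter \<open>\<epsilon> / a\<close>.
\<close>

lemma viscous_force_power_ge:
  assumes \<Psi>: "superlinear_dissipation \<Psi>"
    and w: "w \<in> subdifferential (scaled_dissipation \<Psi> \<epsilon>) (v /\<^sub>R a)" and a: "0 < a" and \<epsilon>: "0 < \<epsilon>"
  shows "(\<Psi> ((\<epsilon> / a) *\<^sub>R v) + (blinfun_apply w z - \<Psi> z)) / (\<epsilon> / a) \<le> blinfun_apply w v"
proof -
  have "scaled_dissipation \<Psi> \<epsilon> (v /\<^sub>R a) + blinfun_apply w (z /\<^sub>R \<epsilon> - v /\<^sub>R a) \<le> scaled_dissipation \<Psi> \<epsilon> (z /\<^sub>R \<epsilon>)"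
    using w unfolding subdifferential_def by blast
  then have "\<Psi> ((\<epsilon> / a) *\<^sub>R v) / \<epsilon> + blinfun_apply w z / \<epsilon> - blinfun_apply w v / a \<le> \<Psi> z / \<epsilon>"
    using \<epsilon> by (simp add: scaled_dissipation_def blinfun.diff_right blinfun.scaleR_right divide_inverse mult_ac)
  then have "(\<Psi> ((\<epsilon> / a) *\<^sub>R v) + (blinfun_apply w z - \<Psi> z)) / \<epsilon> \<le> blinfun_apply w v / a"
    by (simp add: add_divide_distrib diff_divide_distrib)
  from mult_left_mono[OF this, of a] show ?thesis using a by (simp add: mult.commute)
qed

lemma viscous_force_power_ge_gauge:
  assumes \<Psi>: "superlinear_dissipation \<Psi>" and g: "gauge_fun \<Psi>0"
    and lim: "\<And>z. ((\<lambda>\<delta>. scaled_dissipation \<Psi> \<delta> z) \<longlongrightarrow> \<Psi>0 z) (at_right 0)"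
    and w: "w \<in> subdifferential (scaled_dissipation \<Psi> \<epsilon>) (v /\<^sub>R a)" and a: "0 < a" and \<epsilon>: "0 < \<epsilon>"
  shows "\<Psi>0 v \<le> blinfun_apply w v"
proof -
  have "\<Psi>0 v \<le> scaled_dissipation \<Psi> (\<epsilon> / a) v"
    using a \<epsilon> by (intro limit_dissipation_le_scaled[OF \<Psi> lim]) simp
  also have "\<dots> \<le> blinfun_apply w v"
    using viscous_force_power_ge[OF \<Psi> w a \<epsilon>, of 0] superlinear_dissipationD(3)[OF \<Psi>]
    by (simp add: scaled_dissipation_def)
  finally show ?thesis .
qed

section \<open>The energy along curves\<close>

lemma C1_energyD:
  assumes "C1_energy T E dE DE"
  shows "t \<in> {0..T} \<Longrightarrow> ((\<lambda>(r, x). E r x) has_derivative (\<lambda>(h, v). h * dE t u + blinfun_apply (DE t u) v))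
      (at (t, u) within {0..T} \<times> UNIV)"
    "continuous_on ({0..T} \<times> UNIV) (\<lambda>(t, u). dE t u)"
    "continuous_on ({0..T} \<times> UNIV) (\<lambda>(t, u). DE t u)"
  using assms by (simp_all add: C1_energy_def)

lemma C1_energy_chain_rule:
  fixes \<tau> :: "real \<Rightarrow> real" and u :: "real \<Rightarrow> 'x::real_normed_vector"
  assumes E: "C1_energy T E dE DE" and s: "0 < s" "s < S" and sub: "\<tau> ` {0..S} \<subseteq> {0..T}"
    and \<tau>: "(\<tau> has_vector_derivative \<tau>') (at s)" and u: "(u has_vector_derivative u') (at s)"
  shows "((\<lambda>s. E (\<tau> s) (u s)) has_vector_derivative
      \<tau>' * dE (\<tau> s) (u s) + blinfun_apply (DE (\<tau> s) (u s)) u') (at s)"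
proof -
  let ?f = "\<lambda>s. (\<tau> s, u s)" and ?I = "{0..S}"
  have "\<tau> s \<in> {0..T}" by (rule subsetD[OF sub imageI]) (use s in simp)
  then have dE: "((\<lambda>(r, x). E r x) has_derivative (\<lambda>(h, v). h * dE (\<tau> s) (u s) + blinfun_apply (DE (\<tau> s) (u s)) v))
      (at (?f s) within {0..T} \<times> UNIV)"
    by (rule C1_energyD(1)[OF E])
  have df: "(?f has_derivative (\<lambda>h. (h *\<^sub>R \<tau>', h *\<^sub>R u'))) (at s within ?I)"
    by (rule has_derivative_Pair[OF has_derivative_at_withinI has_derivative_at_withinI])
       (rule \<tau>[unfolded has_vector_derivative_def] u[unfolded has_vector_derivative_def])+
  have "?f ` ?I \<subseteq> {0..T} \<times> UNIV" using sub by auto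
  then have "((\<lambda>s. (\<lambda>(r, x). E r x) (?f s)) has_derivative
      (\<lambda>h. (\<lambda>(h, v). h * dE (\<tau> s) (u s) + blinfun_apply (DE (\<tau> s) (u s)) v) (h *\<^sub>R \<tau>', h *\<^sub>R u'))) (at s within ?I)"
    by (rule has_derivative_in_compose[OF df has_derivative_subset[OF dE]])
  moreover have "at s within ?I = at s" using s by (intro at_within_interior) (simp add: interior_atLeastAtMost_real)
  ultimately show ?thesis
    unfolding has_vector_derivative_def by (simp add: blinfun.scaleR_right algebra_simps)
qed

text \<open>
  Both partial derivatives are bounded on the compact convex set \<open>{0..T} \<times> cball 0 R\<close>.
\<close>

lemma C1_energy_lipschitz_on_bounded:
  fixes E :: "real \<Rightarrow> 'x::real_normed_vector \<Rightarrow> real"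
  assumes fd: "\<exists>B :: 'x set. finite B \<and> span B = UNIV" and E: "C1_energy T E dE DE"
  shows "\<exists>L\<ge>0. \<forall>t\<in>{0..T}. \<forall>u\<in>cball 0 R. \<forall>t'\<in>{0..T}. \<forall>u'\<in>cball 0 R.
      \<bar>E t u - E t' u'\<bar> \<le> L * (\<bar>t - t'\<bar> + norm (u - u'))"
proof -
  let ?K = "{0..T} \<times> cball (0::'x) R"
  have K: "compact ?K" by (intro compact_Times compact_Icc finite_dim_compact_cball[OF fd])
  have cont: "continuous_on ?K (\<lambda>(t, u). dE t u)" "continuous_on ?K (\<lambda>(t, u). DE t u)"
    by (rule continuous_on_subset[OF C1_energyD(2)[OF E]] continuous_on_subset[OF C1_energyD(3)[OF E]]; blast)+
  have "bounded ((\<lambda>(t, u). dE t u) ` ?K)" "bounded ((\<lambda>(t, u). DE t u) ` ?K)"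
    by (intro compact_imp_bounded compact_continuous_image cont K)+
  then obtain M1 M2 where M: "\<And>p. p \<in> ?K \<Longrightarrow> norm (dE (fst p) (snd p)) \<le> M1"
      "\<And>p. p \<in> ?K \<Longrightarrow> norm (DE (fst p) (snd p)) \<le> M2"
    unfolding bounded_iff by (metis (no_types, lifting) image_eqI split_beta)
  define L where "L = \<bar>M1\<bar> + \<bar>M2\<bar>"
  have "\<bar>E t u - E t' u'\<bar> \<le> L * (\<bar>t - t'\<bar> + norm (u - u'))"
    if p: "t \<in> {0..T}" "u \<in> cball 0 R" "t' \<in> {0..T}" "u' \<in> cball 0 R" for t u t' u'
  proof -
    have "norm ((\<lambda>(r, x). E r x) (t, u) - (\<lambda>(r, x). E r x) (t', u')) \<le> L * norm ((t, u) - (t', u'))"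
    proof (rule differentiable_bound[where S="?K"])
      show "convex ?K" by (intro convex_Times) auto
      show "((\<lambda>(r, x). E r x) has_derivative (\<lambda>(h, v). h * dE (fst p) (snd p) + blinfun_apply (DE (fst p) (snd p)) v))
          (at p within ?K)" if "p \<in> ?K" for p
      proof (rule has_derivative_subset[of _ _ _ "{0..T} \<times> UNIV"])
        show "((\<lambda>(r, x). E r x) has_derivative (\<lambda>(h, v). h * dE (fst p) (snd p) + blinfun_apply (DE (fst p) (snd p)) v))
          (at p within {0..T} \<times> UNIV)"
          using C1_energyD(1)[OF E, of "fst p" "snd p"] that unfolding prod.collapse by auto
      qed blast
      fix p assume p: "p \<in> ?K"
      show "onorm (\<lambda>(h, v). h * dE (fst p) (snd p) + blinfun_apply (DE (fst p) (snd p)) v) \<le> L"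
      proof (rule onorm_bound)
        fix q :: "real \<times> 'x"
        obtain h v where q: "q = (h, v)" by fastforce
        have "norm (h * dE (fst p) (snd p) + blinfun_apply (DE (fst p) (snd p)) v)
            \<le> norm h * \<bar>M1\<bar> + \<bar>M2\<bar> * norm v"
        proof (rule norm_triangle_le, rule add_mono)
          show "norm (h * dE (fst p) (snd p)) \<le> norm h * \<bar>M1\<bar>"
            using M(1)[OF p] unfolding norm_mult by (intro mult_left_mono) auto
          have "norm (blinfun_apply (DE (fst p) (snd p)) v) \<le> norm (DE (fst p) (snd p)) * norm v"
            by (rule norm_blinfun)
          also have "\<dots> \<le> \<bar>M2\<bar> * norm v" using M(2)[OF p] by (intro mult_right_mono) auto
          finally show "norm (blinfun_apply (DE (fst p) (snd p)) v) \<le> \<bar>M2\<bar> * norm v" .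
        qed
        also have "\<dots> \<le> norm q * \<bar>M1\<bar> + \<bar>M2\<bar> * norm q"
          using norm_fst_le[of h v] norm_snd_le[of v h] unfolding q
          by (intro add_mono mult_right_mono mult_left_mono) auto
        finally show "norm (case q of (h, v) \<Rightarrow> h * dE (fst p) (snd p) + blinfun_apply (DE (fst p) (snd p)) v) \<le> L * norm q"
          by (simp add: q L_def algebra_simps)
      qed (simp add: L_def)
    qed (use p in auto)
    also have "norm ((t, u) - (t', u')) \<le> \<bar>t - t'\<bar> + norm (u - u')"
      using norm_Pair_le[of "t - t'" "u - u'"] by simp
    finally show ?thesis by (simp add: L_def mult_left_mono)
  qed
  moreover have "0 \<le> L" by (simp add: L_def)
  ultimately show ?thesis by blast
qed

lemma C1_energy_lipschitz_along_curve:
  fixes E :: "real \<Rightarrow> 'x::real_normed_vector \<Rightarrow> real" and \<tau> :: "real \<Rightarrow> real" and u :: "real \<Rightarrow> 'x"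
  assumes fd: "\<exists>B :: 'x set. finite B \<and> span B = UNIV" and E: "C1_energy T E dE DE"
    and \<tau>: "L-lipschitz_on {0..S} \<tau>" and sub: "\<tau> ` {0..S} \<subseteq> {0..T}" and u: "M-lipschitz_on {0..S} u"
  shows "\<exists>K. K-lipschitz_on {0..S} (\<lambda>s. E (\<tau> s) (u s))"
proof -
  have "compact (u ` {0..S})"
    by (rule compact_continuous_image[OF lipschitz_on_continuous_on[OF u] compact_Icc])
  then have "bounded (u ` {0..S})" by (rule compact_imp_bounded)
  then obtain R where R: "u ` {0..S} \<subseteq> cball 0 R"
    unfolding bounded_iff subset_eq mem_cball_0 by blast
  obtain K where K: "0 \<le> K" "\<And>t x t' x'. t \<in> {0..T} \<Longrightarrow> x \<in> cball 0 R \<Longrightarrow> t' \<in> {0..T} \<Longrightarrow> x' \<in> cball 0 R \<Longrightarrow>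
      \<bar>E t x - E t' x'\<bar> \<le> K * (\<bar>t - t'\<bar> + norm (x - x'))"
    using C1_energy_lipschitz_on_bounded[OF fd E, of R] by blast
  have "(K * (L + M))-lipschitz_on {0..S} (\<lambda>s. E (\<tau> s) (u s))"
  proof (rule lipschitz_onI)
    fix x y assume xy: "x \<in> {0..S}" "y \<in> {0..S}"
    have "dist (E (\<tau> x) (u x)) (E (\<tau> y) (u y)) \<le> K * (dist (\<tau> x) (\<tau> y) + dist (u x) (u y))"
      unfolding dist_norm real_norm_def
      by (intro K(2) subsetD[OF sub] subsetD[OF R] imageI xy)
    also have "\<dots> \<le> K * (L * dist x y + M * dist x y)"
      using lipschitz_onD[OF \<tau> xy] lipschitz_onD[OF u xy] K(1) by (intro mult_left_mono add_mono)
    finally show "dist (E (\<tau> x) (u x)) (E (\<tau> y) (u y)) \<le> K * (L + M) * dist x y"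
      by (simp add: algebra_simps)
  qed (use K(1) lipschitz_on_nonneg[OF \<tau>] lipschitz_on_nonneg[OF u] in simp)
  then show ?thesis by blast
qed

section \<open>Rescaled viscous solutions\<close>

definition viscous_regular_time ::
  "(real \<Rightarrow> 'x::real_normed_vector \<Rightarrow> ('x \<Rightarrow>\<^sub>L real)) \<Rightarrow> ('x \<Rightarrow> real) \<Rightarrow> real \<Rightarrow> real \<Rightarrow>
   (real \<Rightarrow> real) \<Rightarrow> (real \<Rightarrow> 'x) \<Rightarrow> real \<Rightarrow> bool" where
  "viscous_regular_time DE \<Psi> \<epsilon> S \<tau> u s \<longleftrightarrow> 0 < s \<and> s < S \<and>
     (\<tau> has_vector_derivative vector_derivative \<tau> (at s)) (at s) \<and> 0 < vector_derivative \<tau> (at s) \<and>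
     (u has_vector_derivative vector_derivative u (at s)) (at s) \<and>
     - DE (\<tau> s) (u s) \<in> subdifferential (scaled_dissipation \<Psi> \<epsilon>)
         (vector_derivative u (at s) /\<^sub>R vector_derivative \<tau> (at s))"

text \<open>
  The inclusion holds at almost every time \<open>r\<close>, but is needed at \<open>r = \<tau> s\<close> for almost every \<open>s\<close>.
  The preimage under \<open>\<tau>\<close> of a null set is null on the set where \<open>\<tau>\<close> has a nonzero derivative. Then
  the chain rule gives \<open>u' / \<tau>' = v'\<close>.
\<close>

lemma viscous_rescaled_ae:
  fixes v u :: "real \<Rightarrow> 'x::real_normed_vector" and \<tau> :: "real \<Rightarrow> real"
  assumes fd: "\<exists>B :: 'x set. finite B \<and> span B = UNIV"
    and v: "viscous_solution T DE \<Psi> \<epsilon> v"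
    and L: "L-lipschitz_on {0..S} \<tau>" and surj: "\<tau> ` {0..S} = {0..T}"
    and pos: "AE s in lebesgue. s \<in> {0<..<S} \<longrightarrow> 0 < vector_derivative \<tau> (at s)"
    and u: "\<And>s. s \<in> {0..S} \<Longrightarrow> u s = v (\<tau> s)"
  shows "\<exists>N. negligible N \<and> (\<forall>s\<in>{0..S} - N. viscous_regular_time DE \<Psi> \<epsilon> S \<tau> u s)"
proof -
  obtain N1 where N1: "negligible N1" "\<And>s. s \<in> {0..S} - N1 \<Longrightarrow> 0 < s \<and> s < S \<and>
      (\<tau> has_vector_derivative vector_derivative \<tau> (at s)) (at s)"
    using lipschitz_differentiable_ae[OF finite_dim_real L] by blast
  define N2 where "N2 = {s. \<not> (s \<in> {0<..<S} \<longrightarrow> 0 < vector_derivative \<tau> (at s))}"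
  have N2: "negligible N2" using pos unfolding AE_lebesgue_iff_negligible N2_def .
  define Z1 where "Z1 = {r. 0 < r \<and> r < T \<and> \<not> v differentiable (at r)}"
  define incl where "incl r \<longleftrightarrow> 0 \<in> (\<lambda>\<xi>. \<xi> + DE r (v r)) `
      subdifferential (scaled_dissipation \<Psi> \<epsilon>) (vector_derivative v (at r))" for r
  define Z2 where "Z2 = {r. \<not> (r \<in> {0<..<T} \<longrightarrow> incl r)}"
  have Z1: "negligible Z1"
    unfolding Z1_def using v by (intro abs_continuous_curve_differentiable_ae[OF fd]) (simp add: viscous_solution_def)
  have Z2: "negligible Z2"
    using v unfolding viscous_solution_def AE_lebesgue_iff_negligible Z2_def incl_def by simp
  \<comment> \<open>the end times are excluded as well, since neither \<open>Z1\<close> nor \<open>Z2\<close> says anything about them\<close>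
  define Z where "Z = Z1 \<union> Z2 \<union> {0, T}"
  have Z: "negligible Z" unfolding Z_def using Z1 Z2 negligible_finite[of "{0, T}"] by (simp add: negligible_Un)
  define A where "A = {0..S} - N1 - N2"
  have A: "0 < s \<and> s < S \<and> (\<tau> has_vector_derivative vector_derivative \<tau> (at s)) (at s) \<and>
      0 < vector_derivative \<tau> (at s)" if "s \<in> A" for s
    using that N1(2)[of s] by (auto simp: A_def N2_def)
  define N3 where "N3 = {s \<in> A. \<tau> s \<in> Z}"
  have N3: "negligible N3"
    unfolding N3_def
  proof (rule negligible_differentiable_vimage[OF Z, where f'="\<lambda>s h. h *\<^sub>R vector_derivative \<tau> (at s)"])
    show "inj (\<lambda>h. h *\<^sub>R vector_derivative \<tau> (at s))" if "s \<in> A" for s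
      using A[OF that] by (auto simp: inj_on_def)
    show "(\<tau> has_derivative (\<lambda>h. h *\<^sub>R vector_derivative \<tau> (at s))) (at s within A)" if "s \<in> A" for s
      by (rule has_derivative_at_withinI) (use A[OF that] in \<open>simp add: has_vector_derivative_def\<close>)
  qed
  show ?thesis
    unfolding viscous_regular_time_def
  proof (intro exI[of _ "N1 \<union> N2 \<union> N3"] conjI ballI)
    show "negligible (N1 \<union> N2 \<union> N3)" using N1(1) N2 N3 by simp
    fix s assume s: "s \<in> {0..S} - (N1 \<union> N2 \<union> N3)"
    then have sA: "s \<in> A" by (simp add: A_def)
    note As = A[OF sA]
    show "0 < s" "s < S" "(\<tau> has_vector_derivative vector_derivative \<tau> (at s)) (at s)"
      "0 < vector_derivative \<tau> (at s)" using As by auto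
    have "\<tau> s \<in> {0..T}" unfolding surj[symmetric] using s by (intro imageI) simp
    moreover have nZ: "\<tau> s \<notin> Z" using s sA by (simp add: N3_def)
    ultimately have r: "0 < \<tau> s" "\<tau> s < T" by (auto simp: Z_def less_le)
    have dv: "(v has_vector_derivative vector_derivative v (at (\<tau> s))) (at (\<tau> s))"
      using nZ r by (simp add: Z_def Z1_def vector_derivative_works)
    have "((v \<circ> \<tau>) has_vector_derivative vector_derivative \<tau> (at s) *\<^sub>R vector_derivative v (at (\<tau> s))) (at s)"
      using As dv by (intro vector_diff_chain_at) auto
    then have du: "(u has_vector_derivative vector_derivative \<tau> (at s) *\<^sub>R vector_derivative v (at (\<tau> s))) (at s)"
      by (rule has_vector_derivative_transform_within_open[of _ _ _ "{0<..<S}"]) (use As u in auto)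
    then have eq: "vector_derivative u (at s) = vector_derivative \<tau> (at s) *\<^sub>R vector_derivative v (at (\<tau> s))"
      by (rule vector_derivative_at)
    show "(u has_vector_derivative vector_derivative u (at s)) (at s)" unfolding eq by (rule du)
    have "incl (\<tau> s)" using nZ r by (simp add: Z_def Z2_def)
    then obtain \<xi> where \<xi>: "\<xi> \<in> subdifferential (scaled_dissipation \<Psi> \<epsilon>) (vector_derivative v (at (\<tau> s)))"
      "0 = \<xi> + DE (\<tau> s) (v (\<tau> s))"
      unfolding incl_def by blast
    have "- DE (\<tau> s) (u s) = \<xi>" using \<xi>(2) u[of s] s by (simp add: minus_unique add.commute)
    moreover have "vector_derivative u (at s) /\<^sub>R vector_derivative \<tau> (at s) = vector_derivative v (at (\<tau> s))"
      unfolding eq using As by simp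
    ultimately show "- DE (\<tau> s) (u s) \<in> subdifferential (scaled_dissipation \<Psi> \<epsilon>)
          (vector_derivative u (at s) /\<^sub>R vector_derivative \<tau> (at s))"
      using \<xi>(1) by simp
  qed
qed

section \<open>The vanishing viscosity limit\<close>

text \<open>
  Equi-Lipschitz continuity upgrades pointwise convergence to convergence along \<open>n\<close> and \<open>s\<close>
  jointly, which allows data to be frozen at \<open>s0\<close> in the localization arguments below.
\<close>

lemma equi_lipschitz_continuous_convergence:
  fixes \<tau>n :: "nat \<Rightarrow> real \<Rightarrow> real" and un :: "nat \<Rightarrow> real \<Rightarrow> 'x::real_normed_vector"
    and G :: "real \<times> 'x \<Rightarrow> 'y::metric_space"
  assumes L: "\<And>n. L-lipschitz_on {0..S} (\<tau>n n)" and M: "\<And>n. M-lipschitz_on {0..S} (un n)"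
    and sub: "\<And>n. \<tau>n n ` {0..S} \<subseteq> {0..T}" and s0: "s0 \<in> {0..S}"
    and lim: "(\<lambda>n. \<tau>n n s0) \<longlonglongrightarrow> t0" "(\<lambda>n. un n s0) \<longlonglongrightarrow> u0" and t0: "t0 \<in> {0..T}"
    and G: "continuous_on ({0..T} \<times> UNIV) G" and \<omega>: "0 < \<omega>"
  shows "\<exists>d>0. \<exists>k. \<forall>n\<ge>k. \<forall>s\<in>{0..S}. \<bar>s - s0\<bar> \<le> d \<longrightarrow> dist (G (\<tau>n n s, un n s)) (G (t0, u0)) < \<omega>"
proof -
  obtain \<eta> where \<eta>: "0 < \<eta>" "\<And>p. p \<in> {0..T} \<times> UNIV \<Longrightarrow> dist p (t0, u0) < \<eta> \<Longrightarrow> dist (G p) (G (t0, u0)) < \<omega>"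
    using G t0 \<omega> unfolding continuous_on_iff by (metis UNIV_I mem_Sigma_iff)
  define d where "d = \<eta> / (4 * (L + M + 1))"
  have LM: "0 \<le> L" "0 \<le> M" using lipschitz_on_nonneg[OF L[of 0]] lipschitz_on_nonneg[OF M[of 0]] by auto
  have d: "0 < d" "(L + M) * d < \<eta> / 2"
  proof -
    define q where "q = L + M + 1"
    have q: "0 < q" "d = \<eta> / (4 * q)" using LM by (auto simp: q_def d_def)
    show "0 < d" unfolding q(2) using \<eta>(1) q(1) by simp
    then have "(L + M) * d \<le> q * d" by (intro mult_right_mono) (auto simp: q_def)
    also have "\<dots> = \<eta> / 4" using q by simp
    also have "\<dots> < \<eta> / 2" using \<eta>(1) by simp
    finally show "(L + M) * d < \<eta> / 2" .
  qed
  have "eventually (\<lambda>n. dist (\<tau>n n s0) t0 < \<eta> / 4 \<and> dist (un n s0) u0 < \<eta> / 4) sequentially"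
    using tendstoD[OF lim(1), of "\<eta> / 4"] tendstoD[OF lim(2), of "\<eta> / 4"] \<eta>(1) by (simp add: eventually_conj_iff)
  then obtain k where k: "\<And>n. k \<le> n \<Longrightarrow> dist (\<tau>n n s0) t0 < \<eta> / 4 \<and> dist (un n s0) u0 < \<eta> / 4"
    unfolding eventually_sequentially by blast
  have "dist (G (\<tau>n n s, un n s)) (G (t0, u0)) < \<omega>" if n: "k \<le> n" and s: "s \<in> {0..S}" "\<bar>s - s0\<bar> \<le> d" for n s
  proof (rule \<eta>(2))
    show "(\<tau>n n s, un n s) \<in> {0..T} \<times> UNIV"
      using subsetD[OF sub imageI[OF s(1)]] by (intro SigmaI) auto
    have "dist (\<tau>n n s) (\<tau>n n s0) \<le> L * d"
      using lipschitz_onD[OF L s(1) s0] mult_left_mono[OF s(2) LM(1)] by (simp add: dist_real_def) (meson order_trans)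
    moreover have "dist (un n s) (un n s0) \<le> M * d"
      using lipschitz_onD[OF M s(1) s0] mult_left_mono[OF s(2) LM(2)] by (simp add: dist_real_def) (meson order_trans)
    ultimately have "dist (\<tau>n n s) t0 + dist (un n s) u0 < \<eta>"
      using k[OF n] d(2) dist_triangle[of "\<tau>n n s" t0 "\<tau>n n s0"] dist_triangle[of "un n s" u0 "un n s0"]
      by (simp add: distrib_right)
    moreover have "dist (\<tau>n n s, un n s) (t0, u0) \<le> dist (\<tau>n n s) t0 + dist (un n s) u0"
      unfolding dist_prod_def by (simp add: sqrt_sum_squares_le_sum)
    ultimately show "dist (\<tau>n n s, un n s) (t0, u0) < \<eta>" by simp
  qed
  then show ?thesis using d(1) by blast
qed

lemma ereal_integral_eq_integral:
  fixes f :: "real \<Rightarrow> real"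
  assumes f: "(f has_integral I) {a..b}" and bd: "\<And>x. x \<in> {a..b} \<Longrightarrow> \<bar>f x\<bar> \<le> C" and N: "negligible N"
    and g: "\<And>x. x \<in> {a..b} - N \<Longrightarrow> g x = ereal (f x)"
  shows "ereal_integral (lebesgue_on {a..b}) g = ereal I"
proof -
  have "f absolutely_integrable_on {a..b}"
    by (rule absolutely_integrable_integrable_bound[where g="\<lambda>_. C"]) (use f bd in auto)
  then have int: "integrable (lebesgue_on {a..b}) f"
    by (simp add: absolutely_integrable_on_iff_nonneg integrable_restrict_space set_integrable_def)
  have I: "integral\<^sup>L (lebesgue_on {a..b}) f = I"
    using lebesgue_integral_eq_integral[OF int] f by (simp add: integral_unique)
  have "AE x in lebesgue_on {a..b}. g x = ereal (f x)"
  proof -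
    have "AE x in lebesgue. x \<notin> N" using N unfolding AE_lebesgue_iff_negligible by simp
    then have "AE x in lebesgue_on {a..b}. x \<notin> N" by (subst AE_restrict_space_iff) auto
    moreover have "AE x in lebesgue_on {a..b}. x \<in> {a..b}" by (rule AE_I2) simp
    ultimately show ?thesis by eventually_elim (use g in auto)
  qed
  then have "(\<integral>\<^sup>+ x. e2ennreal (g x) \<partial>lebesgue_on {a..b}) = (\<integral>\<^sup>+ x. ennreal (f x) \<partial>lebesgue_on {a..b})"
      "(\<integral>\<^sup>+ x. e2ennreal (- g x) \<partial>lebesgue_on {a..b}) = (\<integral>\<^sup>+ x. ennreal (- f x) \<partial>lebesgue_on {a..b})"
    by (intro nn_integral_cong_AE; eventually_elim; simp)+
  then have eq: "ereal_integral (lebesgue_on {a..b}) g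
      = enn2ereal (\<integral>\<^sup>+ x. ennreal (f x) \<partial>lebesgue_on {a..b}) - enn2ereal (\<integral>\<^sup>+ x. ennreal (- f x) \<partial>lebesgue_on {a..b})"
    by (simp add: ereal_integral_def)
  have fin: "(\<integral>\<^sup>+ x. ennreal (f x) \<partial>lebesgue_on {a..b}) \<noteq> \<infinity>" "(\<integral>\<^sup>+ x. ennreal (- f x) \<partial>lebesgue_on {a..b}) \<noteq> \<infinity>"
    using real_integrable_def int by blast+
  obtain p q where pq: "0 \<le> p" "0 \<le> q" "(\<integral>\<^sup>+ x. ennreal (f x) \<partial>lebesgue_on {a..b}) = ennreal p"
      "(\<integral>\<^sup>+ x. ennreal (- f x) \<partial>lebesgue_on {a..b}) = ennreal q"
    using fin by (metis ennreal_cases infinity_ennreal_def)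
  have "I = p - q" using real_lebesgue_integral_def[OF int] pq I by simp
  then show ?thesis using eq pq by simp
qed

lemma has_integral_le_ae:
  fixes f g :: "real \<Rightarrow> real"
  assumes "(f has_integral i) A" "(g has_integral j) A" "negligible N"
    and "\<And>x. x \<in> A - N \<Longrightarrow> f x \<le> g x"
  shows "i \<le> j"
proof (rule has_integral_le)
  show "((\<lambda>x. if x \<in> N then 0 else f x) has_integral i) A"
    using assms(1) by (rule has_integral_spike[OF assms(3), rotated]) simp
  show "((\<lambda>x. if x \<in> N then 0 else g x) has_integral j) A"
    using assms(2) by (rule has_integral_spike[OF assms(3), rotated]) simp
qed (use assms(4) in auto)

lemma lipschitz_on_pointwise_limit:
  fixes f :: "nat \<Rightarrow> real \<Rightarrow> 'x::real_normed_vector"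
  assumes "\<And>n. L-lipschitz_on A (f n)" "\<And>s. s \<in> A \<Longrightarrow> (\<lambda>n. f n s) \<longlonglongrightarrow> g s"
  shows "L-lipschitz_on A g"
proof (rule lipschitz_onI)
  fix x y assume xy: "x \<in> A" "y \<in> A"
  have "(\<lambda>n. dist (f n x) (f n y)) \<longlonglongrightarrow> dist (g x) (g y)" by (intro tendsto_dist assms(2) xy)
  then show "dist (g x) (g y) \<le> L * dist x y"
    by (rule LIMSEQ_le_const2) (use lipschitz_onD[OF assms(1) xy] in auto)
qed (rule lipschitz_on_nonneg[OF assms(1)[of 0]])

text \<open>
  The situation of the theorem after all null sets have been collected into one set \<open>N\<close>, with
  \<open>\<mu> n\<close> for the real-valued version of the potentials \<open>m\<^sub>n\<close>.
\<close>

locale viscous_limit =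
  fixes T S L M C :: real
    and \<Psi>0 \<Psi> :: "'x::real_normed_vector \<Rightarrow> real"
    and E dE :: "real \<Rightarrow> 'x \<Rightarrow> real"
    and DE :: "real \<Rightarrow> 'x \<Rightarrow> ('x \<Rightarrow>\<^sub>L real)"
    and \<epsilon> :: "nat \<Rightarrow> real"
    and tn :: "nat \<Rightarrow> real \<Rightarrow> real"
    and un :: "nat \<Rightarrow> real \<Rightarrow> 'x"
    and \<mu> :: "nat \<Rightarrow> real \<Rightarrow> real"
    and t m :: "real \<Rightarrow> real"
    and u :: "real \<Rightarrow> 'x"
    and N :: "real set"
  assumes fd: "\<exists>B :: 'x set. finite B \<and> span B = UNIV"
    and gauge: "gauge_fun \<Psi>0"
    and energy: "C1_energy T E dE DE"
    and dissipation: "superlinear_dissipation \<Psi>"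
    and dissipation_lim: "\<And>z. ((\<lambda>\<delta>. scaled_dissipation \<Psi> \<delta> z) \<longlongrightarrow> \<Psi>0 z) (at_right 0)"
    and eps_pos: "\<And>n. 0 < \<epsilon> n"
    and eps_lim: "\<epsilon> \<longlonglongrightarrow> 0"
    and tn_lip: "\<And>n. L-lipschitz_on {0..S} (tn n)"
    and un_lip: "\<And>n. M-lipschitz_on {0..S} (un n)"
    and tn_mono: "\<And>n. mono_on {0..S} (tn n)"
    and tn_range: "\<And>n. tn n ` {0..S} \<subseteq> {0..T}"
    and N: "negligible N"
    and regular: "\<And>n s. s \<in> {0..S} - N \<Longrightarrow> viscous_regular_time DE \<Psi> (\<epsilon> n) S (tn n) (un n) s"
    and \<mu>_eq: "\<And>n s. s \<in> {0..S} - N \<Longrightarrow> \<mu> n s =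
          blinfun_apply (- DE (tn n s) (un n s)) (vector_derivative (un n) (at s)) + vector_derivative (tn n) (at s)"
    and \<mu>_le: "\<And>n s. s \<in> {0..S} - N \<Longrightarrow> \<mu> n s \<le> C"
    and C_nonneg: "0 \<le> C"
    and \<mu>_lim: "\<And>s. s \<in> {0..S} - N \<Longrightarrow> (\<lambda>n. \<mu> n s) \<longlonglongrightarrow> m s"
    and t_lim: "\<And>s. s \<in> {0..S} \<Longrightarrow> (\<lambda>n. tn n s) \<longlonglongrightarrow> t s"
    and u_lim: "\<And>s. s \<in> {0..S} \<Longrightarrow> (\<lambda>n. un n s) \<longlonglongrightarrow> u s"
begin

abbreviation td where "td n s \<equiv> vector_derivative (tn n) (at s)"
abbreviation ud where "ud n s \<equiv> vector_derivative (un n) (at s)"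
abbreviation force where "force n s \<equiv> - DE (tn n s) (un n s)"
abbreviation limit_force where "limit_force s \<equiv> - DE (t s) (u s)"

lemma interior: "s \<in> {0..S} - N \<Longrightarrow> 0 < s \<and> s < S"
  using regular[of s 0] by (simp add: viscous_regular_time_def)

lemma
  assumes "s \<in> {0..S} - N"
  shows tn_der: "(tn n has_vector_derivative td n s) (at s)" and tn_pos: "0 < td n s"
    and un_der: "(un n has_vector_derivative ud n s) (at s)"
    and flow: "force n s \<in> subdifferential (scaled_dissipation \<Psi> (\<epsilon> n)) (ud n s /\<^sub>R td n s)"
  using regular[OF assms, of n] by (simp_all add: viscous_regular_time_def)

lemma t_lip: "L-lipschitz_on {0..S} t"
  using tn_lip t_lim by (rule lipschitz_on_pointwise_limit)

lemma u_lip: "M-lipschitz_on {0..S} u"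
  using un_lip u_lim by (rule lipschitz_on_pointwise_limit)

lemma t_range: "t ` {0..S} \<subseteq> {0..T}"
proof (rule image_subsetI)
  fix s assume s: "s \<in> {0..S}"
  have tns: "tn n s \<in> {0..T}" for n by (rule subsetD[OF tn_range imageI[OF s]])
  have "0 \<le> t s" by (rule LIMSEQ_le_const[OF t_lim[OF s]]) (use tns in simp)
  moreover have "t s \<le> T" by (rule LIMSEQ_le_const2[OF t_lim[OF s]]) (use tns in simp)
  ultimately show "t s \<in> {0..T}" by simp
qed

lemma t_mono: "mono_on {0..S} t"
proof (rule mono_onI)
  fix r s assume rs: "r \<in> {0..S}" "s \<in> {0..S}" "r \<le> s"
  have "tn n r \<le> tn n s" for n using mono_onD[OF tn_mono rs] .
  then show "t r \<le> t s" by (intro LIMSEQ_le[OF t_lim[OF rs(1)] t_lim[OF rs(2)]]) auto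
qed

lemma power_nonneg: "s \<in> {0..S} - N \<Longrightarrow> \<Psi>0 (ud n s) + td n s \<le> \<mu> n s"
  using viscous_force_power_ge_gauge[OF dissipation gauge dissipation_lim flow tn_pos eps_pos, of s n] \<mu>_eq
  by simp

lemma td_le: "s \<in> {0..S} - N \<Longrightarrow> td n s \<le> \<mu> n s"
  using power_nonneg[of s n] gauge_funD(1)[OF gauge, of "ud n s"] by simp

lemma tn_has_integral:
  assumes "0 \<le> a" "a \<le> b" "b \<le> S"
  shows "(td n has_integral tn n b - tn n a) {a..b}"
  by (rule lipschitz_has_integral_derivative[OF tn_lip N tn_der assms])

lemma energy_has_integral:
  assumes ab: "0 \<le> a" "a \<le> b" "b \<le> S"
  shows "((\<lambda>s. td n s * (dE (tn n s) (un n s) + 1) - \<mu> n s) has_integral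
      E (tn n b) (un n b) - E (tn n a) (un n a)) {a..b}"
proof -
  obtain K where K: "K-lipschitz_on {0..S} (\<lambda>s. E (tn n s) (un n s))"
    using C1_energy_lipschitz_along_curve[OF fd energy tn_lip tn_range un_lip] by blast
  show ?thesis
  proof (rule lipschitz_has_integral_derivative[OF K N _ ab])
    fix s assume s: "s \<in> {0..S} - N"
    have "((\<lambda>s. E (tn n s) (un n s)) has_vector_derivative
        td n s * dE (tn n s) (un n s) + blinfun_apply (DE (tn n s) (un n s)) (ud n s)) (at s)"
      using interior[OF s] by (intro C1_energy_chain_rule[OF energy _ _ tn_range] tn_der un_der s) auto
    moreover have "td n s * dE (tn n s) (un n s) + blinfun_apply (DE (tn n s) (un n s)) (ud n s)
        = td n s * (dE (tn n s) (un n s) + 1) - \<mu> n s"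
      using \<mu>_eq[OF s] by (simp add: blinfun.minus_left algebra_simps)
    ultimately show "((\<lambda>s. E (tn n s) (un n s)) has_vector_derivative
        td n s * (dE (tn n s) (un n s) + 1) - \<mu> n s) (at s)" by simp
  qed
qed

lemma \<mu>_integrable:
  assumes ab: "0 \<le> a" "a \<le> b" "b \<le> S"
  shows "\<mu> n integrable_on {a..b}"
proof -
  let ?g = "\<lambda>s. dE (tn n s) (un n s) + 1"
  \<comment> \<open>setting the derivative to 0 on \<open>N\<close>, where its sign is unknown, makes it nonnegative everywhere\<close>
  let ?f = "\<lambda>s. if s \<in> N then 0 else td n s"
  have sub: "{a..b} \<subseteq> {0..S}" using ab by auto
  have "(?f has_integral tn n b - tn n a) {a..b}"
    using tn_has_integral[OF ab] by (rule has_integral_spike[OF N, rotated]) simp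
  then have f: "?f absolutely_integrable_on {a..b}"
    using tn_pos sub by (intro nonnegative_absolutely_integrable_1) (auto intro: less_imp_le)
  have "continuous_on {a..b} (\<lambda>s. (tn n s, un n s))"
    by (intro continuous_on_Pair continuous_on_subset[OF lipschitz_on_continuous_on[OF tn_lip] sub]
        continuous_on_subset[OF lipschitz_on_continuous_on[OF un_lip] sub])
  moreover have "(\<lambda>s. (tn n s, un n s)) ` {a..b} \<subseteq> {0..T} \<times> UNIV" using sub tn_range[of n] by fast
  ultimately have "continuous_on {a..b} (\<lambda>s. (\<lambda>(t, u). dE t u) (tn n s, un n s))"
    by (rule continuous_on_compose2[OF C1_energyD(2)[OF energy]])
  then have g: "continuous_on {a..b} ?g" by (intro continuous_intros) simp
  have "(\<lambda>s. ?g s * ?f s) absolutely_integrable_on {a..b}"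
  proof (rule absolutely_integrable_bounded_measurable_product_real[OF _ _ _ f])
    show "?g \<in> borel_measurable (lebesgue_on {a..b})"
      using g by (intro continuous_imp_measurable_on_sets_lebesgue) auto
    show "bounded (?g ` {a..b})"
      by (rule compact_imp_bounded[OF compact_continuous_image[OF g compact_Icc]])
  qed simp
  then have "(\<lambda>s. ?g s * ?f s) integrable_on {a..b}" by (rule set_lebesgue_integral_eq_integral(1))
  then have "(\<lambda>s. td n s * ?g s) integrable_on {a..b}"
    by (rule integrable_spike[OF _ N]) (simp add: mult.commute)
  from integrable_diff[OF this has_integral_integrable[OF energy_has_integral[OF ab, of n]]]
  show ?thesis by simp
qed

lemma m_integral:
  assumes ab: "0 \<le> a" "a \<le> b" "b \<le> S"
  shows "m integrable_on {a..b}" "(\<lambda>n. integral {a..b} (\<mu> n)) \<longlonglongrightarrow> integral {a..b} m"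
proof -
  let ?f = "\<lambda>n s. if s \<in> N then 0 else \<mu> n s" and ?g = "\<lambda>s. if s \<in> N then 0 else m s"
  have f: "?f n integrable_on {a..b}" for n
    by (rule integrable_spike[OF \<mu>_integrable[OF ab] N]) simp
  have bd: "norm (?f n s) \<le> C" if "s \<in> {a..b}" for n s
  proof (cases "s \<in> N")
    case False
    with that ab have s: "s \<in> {0..S} - N" by auto
    then show ?thesis using td_le[OF s, of n] tn_pos[OF s, of n] \<mu>_le[OF s, of n] False by simp
  qed (use C_nonneg in simp)
  have lim: "(\<lambda>n. ?f n s) \<longlonglongrightarrow> ?g s" if "s \<in> {a..b}" for s
    using \<mu>_lim[of s] that ab by (cases "s \<in> N") auto
  note dc = dominated_convergence[where f="?f" and g="?g" and h="\<lambda>_. C", OF f integrable_const_ivl bd lim]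
  show "m integrable_on {a..b}" by (rule integrable_spike[OF dc(1) N]) auto
  have "integral {a..b} (?f n) = integral {a..b} (\<mu> n)" for n
    by (rule integral_spike[OF N]) simp
  moreover have "integral {a..b} ?g = integral {a..b} m" by (rule integral_spike[OF N]) simp
  ultimately show "(\<lambda>n. integral {a..b} (\<mu> n)) \<longlonglongrightarrow> integral {a..b} m" using dc(2) by simp
qed

definition dissipated :: "real \<Rightarrow> real" where "dissipated s = integral {0..s} m"

lemma dissipated_diff:
  assumes ab: "0 \<le> a" "a \<le> b" "b \<le> S"
  shows "dissipated b - dissipated a = integral {a..b} m"
proof -
  have "integral {0..a} m + integral {a..b} m = integral {0..b} m"
    using ab by (intro Henstock_Kurzweil_Integration.integral_combine m_integral(1)) auto
  then show ?thesis by (simp add: dissipated_def)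
qed

lemma energy_lim:
  assumes s: "s \<in> {0..S}"
  shows "(\<lambda>n. E (tn n s) (un n s)) \<longlonglongrightarrow> E (t s) (u s)"
proof -
  have ts: "t s \<in> {0..T}" by (rule subsetD[OF t_range imageI[OF s]])
  have tns: "tn n s \<in> {0..T}" for n by (rule subsetD[OF tn_range imageI[OF s]])
  have "continuous (at (t s, u s) within {0..T} \<times> UNIV) (\<lambda>(r, x). E r x)"
    using C1_energyD(1)[OF energy ts] by (rule has_derivative_continuous)
  then have "(\<lambda>n. (\<lambda>(r, x). E r x) (tn n s, un n s)) \<longlonglongrightarrow> (\<lambda>(r, x). E r x) (t s, u s)"
  proof (rule continuous_within_tendsto_compose')
    show "(tn n s, un n s) \<in> {0..T} \<times> UNIV" for n using tns by (intro SigmaI) auto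
    show "(\<lambda>n. (tn n s, un n s)) \<longlonglongrightarrow> (t s, u s)" by (intro tendsto_Pair t_lim u_lim s)
  qed
  then show ?thesis by simp
qed

lemma near_dE:
  assumes s0: "s0 \<in> {0..S}" and \<omega>: "0 < \<omega>"
  shows "\<exists>d>0. \<exists>k. \<forall>n\<ge>k. \<forall>s\<in>{0..S}. \<bar>s - s0\<bar> \<le> d \<longrightarrow>
      \<bar>dE (tn n s) (un n s) - dE (t s0) (u s0)\<bar> < \<omega>"
  using equi_lipschitz_continuous_convergence[OF tn_lip un_lip tn_range s0 t_lim[OF s0] u_lim[OF s0]
      subsetD[OF t_range imageI[OF s0]] C1_energyD(2)[OF energy] \<omega>]
  by (simp add: dist_real_def)

lemma near_DE:
  assumes s0: "s0 \<in> {0..S}" and \<omega>: "0 < \<omega>"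
  shows "\<exists>d>0. \<exists>k. \<forall>n\<ge>k. \<forall>s\<in>{0..S}. \<bar>s - s0\<bar> \<le> d \<longrightarrow>
      norm (DE (tn n s) (un n s) - DE (t s0) (u s0)) < \<omega>"
  using equi_lipschitz_continuous_convergence[OF tn_lip un_lip tn_range s0 t_lim[OF s0] u_lim[OF s0]
      subsetD[OF t_range imageI[OF s0]] C1_energyD(3)[OF energy] \<omega>]
  by (simp add: dist_norm)

text \<open>
  Lower semicontinuity of the conjugate, with the competitor \<open>z\<close> kept explicit.
\<close>

lemma near_conjugate:
  assumes s0: "s0 \<in> {0..S}" and c: "c < blinfun_apply (limit_force s0) z - \<Psi> z"
  shows "\<exists>d>0. \<exists>k. \<forall>n\<ge>k. \<forall>s\<in>{0..S}. \<bar>s - s0\<bar> \<le> d \<longrightarrow>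
      c < blinfun_apply (force n s) z - \<Psi> z"
proof -
  define g where "g = blinfun_apply (limit_force s0) z - \<Psi> z - c"
  define \<omega> where "\<omega> = g / (norm z + 1)"
  have pos: "0 < norm z + 1" by (rule add_nonneg_pos) auto
  have \<omega>: "0 < \<omega>" unfolding \<omega>_def using c pos by (intro divide_pos_pos) (auto simp: g_def)
  obtain d k where d: "0 < d" "\<forall>n\<ge>k. \<forall>s\<in>{0..S}. \<bar>s - s0\<bar> \<le> d \<longrightarrow>
      norm (DE (tn n s) (un n s) - DE (t s0) (u s0)) < \<omega>"
    using near_DE[OF s0 \<omega>] by blast
  have "c < blinfun_apply (force n s) z - \<Psi> z"
    if ns: "k \<le> n" "s \<in> {0..S}" "\<bar>s - s0\<bar> \<le> d" for n s
  proof -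
    let ?D = "DE (tn n s) (un n s) - DE (t s0) (u s0)"
    have nD: "norm ?D < \<omega>" using d(2) ns by simp
    have "blinfun_apply ?D z \<le> norm ?D * norm z" using norm_blinfun[of ?D z] by simp
    also have "\<dots> \<le> \<omega> * norm z" using nD by (intro mult_right_mono) auto
    also have "\<dots> < \<omega> * (norm z + 1)" using \<omega> by (intro mult_strict_left_mono) auto
    also have "\<dots> = g" using pos by (simp add: \<omega>_def)
    finally show ?thesis by (simp add: g_def blinfun.diff_left blinfun.minus_left)
  qed
  then show ?thesis using d(1) by blast
qed

lemma right_neighbourhood:
  assumes "s0 < S" "0 < d" "\<And>b. s0 < b \<Longrightarrow> b \<le> S \<Longrightarrow> b - s0 \<le> d \<Longrightarrow> P b"
  shows "eventually P (at_right s0)"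
  unfolding eventually_at_right_field
  by (rule exI[of _ "min S (s0 + d)"]) (use assms in auto)

text \<open>
  The function \<open>\<Phi> b = E (t b) (u b) - g * t b + dissipated b\<close>, with \<open>g\<close> the value of \<open>dE + 1\<close> at
  \<open>s0\<close>, has derivative 0 at \<open>s0\<close>: for the approximations the increment of its analogue is the
  integral of \<open>td n\<close> times the small variation of \<open>dE\<close>. The chain rule computes the same derivative.
\<close>

lemma limit_energy_balance:
  assumes s0: "0 < s0" "s0 < S"
    and dt: "(t has_vector_derivative t') (at s0)" and du: "(u has_vector_derivative u') (at s0)"
    and dm: "(dissipated has_vector_derivative m s0) (at s0)"
  shows "m s0 = blinfun_apply (limit_force s0) u' + t'"
proof -
  have s0': "s0 \<in> {0..S}" using s0 by simp
  define g where "g = dE (t s0) (u s0) + 1"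
  define \<Phi> where "\<Phi> b = E (t b) (u b) - g * t b + dissipated b" for b
  let ?D = "(t' * dE (t s0) (u s0) + blinfun_apply (DE (t s0) (u s0)) u') - g * t' + m s0"
  have dE: "((\<lambda>s. E (t s) (u s)) has_vector_derivative
      t' * dE (t s0) (u s0) + blinfun_apply (DE (t s0) (u s0)) u') (at s0)"
    by (rule C1_energy_chain_rule[OF energy s0 t_range dt du])
  have d\<Phi>: "(\<Phi> has_vector_derivative ?D) (at s0)"
    unfolding \<Phi>_def
    by (intro has_vector_derivative_add has_vector_derivative_diff dE dm has_vector_derivative_mult_right dt)
  have small: "eventually (\<lambda>b. \<bar>\<Phi> b - \<Phi> s0\<bar> \<le> \<omega> * (b - s0)) (at_right s0)" if \<omega>: "0 < \<omega>" for \<omega>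
  proof -
    \<comment> \<open>\<open>C\<close> bounds \<open>td n\<close>, so this makes the error rate \<open>C * \<omega>'\<close> at most \<open>\<omega>\<close>\<close>
    define \<omega>' where "\<omega>' = \<omega> / (C + 1)"
    have \<omega>': "0 < \<omega>'" "C * \<omega>' \<le> \<omega>" using \<omega> C_nonneg by (auto simp: \<omega>'_def field_simps)
    obtain d k where d: "0 < d" "\<forall>n\<ge>k. \<forall>s\<in>{0..S}. \<bar>s - s0\<bar> \<le> d \<longrightarrow>
        \<bar>dE (tn n s) (un n s) - dE (t s0) (u s0)\<bar> < \<omega>'"
      using near_dE[OF s0' \<omega>'(1)] by blast
    show ?thesis
    proof (rule right_neighbourhood[OF s0(2) d(1)])
      fix b assume b: "s0 < b" "b \<le> S" "b - s0 \<le> d"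
      have ab: "0 \<le> s0" "s0 \<le> b" "b \<le> S" using s0 b by auto
      have b': "b \<in> {0..S}" using ab by auto
      let ?\<Phi> = "\<lambda>n. E (tn n b) (un n b) - E (tn n s0) (un n s0) - g * (tn n b - tn n s0) + integral {s0..b} (\<mu> n)"
      have "\<bar>?\<Phi> n\<bar> \<le> \<omega> * (b - s0)" if n: "k \<le> n" for n
      proof -
        let ?h = "\<lambda>s. if s \<in> N then 0 else td n s * (dE (tn n s) (un n s) - dE (t s0) (u s0))"
        have "((\<lambda>s. td n s * (dE (tn n s) (un n s) + 1) - \<mu> n s - g * td n s + \<mu> n s) has_integral ?\<Phi> n) {s0..b}"
          by (intro has_integral_add has_integral_diff energy_has_integral[OF ab] tn_has_integral[OF ab]
              has_integral_mult_right integrable_integral \<mu>_integrable[OF ab])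
        then have "(?h has_integral ?\<Phi> n) (cbox s0 b)"
          unfolding box_real
          by (rule has_integral_spike[OF N, rotated]) (simp add: g_def algebra_simps)
        then have "norm (?\<Phi> n) \<le> \<omega> * measure lborel (cbox s0 b)"
        proof (rule has_integral_bound[rotated])
          fix s assume s: "s \<in> cbox s0 b"
          show "norm (?h s) \<le> \<omega>"
          proof (cases "s \<in> N")
            case False
            have sS: "s \<in> {0..S} - N" "\<bar>s - s0\<bar> \<le> d" using s b s0 False by auto
            have "\<bar>td n s * (dE (tn n s) (un n s) - dE (t s0) (u s0))\<bar> \<le> C * \<omega>'"
              unfolding abs_mult
            proof (rule mult_mono)
              show "\<bar>td n s\<bar> \<le> C" using tn_pos[OF sS(1), of n] td_le[OF sS(1), of n] \<mu>_le[OF sS(1), of n] by simp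
              show "\<bar>dE (tn n s) (un n s) - dE (t s0) (u s0)\<bar> \<le> \<omega>'" using d(2) n sS by (simp add: less_imp_le)
            qed (use C_nonneg in auto)
            then show ?thesis using \<omega>'(2) False by simp
          qed (use \<omega> in simp)
        qed (use \<omega> in simp)
        then show ?thesis using b by simp
      qed
      moreover have "(\<lambda>n. \<bar>?\<Phi> n\<bar>) \<longlonglongrightarrow> \<bar>E (t b) (u b) - E (t s0) (u s0) - g * (t b - t s0) + integral {s0..b} m\<bar>"
        by (intro tendsto_rabs tendsto_add tendsto_diff tendsto_mult tendsto_const
            energy_lim t_lim m_integral(2)[OF ab] b' s0')
      ultimately have "\<bar>E (t b) (u b) - E (t s0) (u s0) - g * (t b - t s0) + integral {s0..b} m\<bar> \<le> \<omega> * (b - s0)"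
        by (intro LIMSEQ_le_const2) auto
      then show "\<bar>\<Phi> b - \<Phi> s0\<bar> \<le> \<omega> * (b - s0)"
        unfolding dissipated_diff[OF ab, symmetric] by (simp add: \<Phi>_def algebra_simps)
    qed
  qed
  have "?D \<le> 0"
  proof (rule field_le_epsilon)
    fix \<omega> :: real assume \<omega>: "0 < \<omega>"
    have "?D \<le> \<omega>"
      by (rule derivative_le_if_right_increments_le[OF d\<Phi>], rule eventually_mono[OF small[OF \<omega>]]) simp
    then show "?D \<le> 0 + \<omega>" by simp
  qed
  moreover have "- ?D \<le> 0"
  proof (rule field_le_epsilon)
    fix \<omega> :: real assume \<omega>: "0 < \<omega>"
    have "((\<lambda>b. - \<Phi> b) has_vector_derivative - ?D) (at s0)" by (rule has_vector_derivative_minus[OF d\<Phi>])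
    then have "- ?D \<le> \<omega>"
      by (rule derivative_le_if_right_increments_le, rule_tac eventually_mono[OF small[OF \<omega>]]) simp
    then show "- ?D \<le> 0 + \<omega>" by simp
  qed
  ultimately have "?D = 0" by simp
  then show ?thesis by (simp add: g_def blinfun.minus_left algebra_simps)
qed

lemma limit_gauge_le:
  assumes q: "gauge_fun q" and s0: "0 < s0" "s0 < S"
    and dt: "(t has_vector_derivative t') (at s0)" and du: "(u has_vector_derivative u') (at s0)"
    and dm: "(dissipated has_vector_derivative m s0) (at s0)"
    and d: "0 < d" and le: "\<And>n s. k \<le> n \<Longrightarrow> s \<in> {0..S} - N \<Longrightarrow> \<bar>s - s0\<bar> \<le> d \<Longrightarrow>
        q (ud n s) \<le> blinfun_apply (force n s) (ud n s)"
  shows "q u' + t' \<le> m s0"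
proof -
  have "((\<lambda>s. dissipated s - t s) has_vector_derivative m s0 - t') (at s0)"
    by (intro has_vector_derivative_diff dm dt)
  moreover have "eventually (\<lambda>b. q (u b - u s0) \<le> (dissipated b - t b) - (dissipated s0 - t s0)) (at_right s0)"
  proof (rule right_neighbourhood[OF s0(2) d])
    fix b assume b: "s0 < b" "b \<le> S" "b - s0 \<le> d"
    have ab: "0 \<le> s0" "s0 \<le> b" "b \<le> S" and b': "b \<in> {0..S}" and s0': "s0 \<in> {0..S}" using s0 b by auto
    have sub: "{s0..b} \<subseteq> {0..S}" using ab by auto
    have "q (un n b - un n s0) \<le> integral {s0..b} (\<mu> n) - (tn n b - tn n s0)" if n: "k \<le> n" for n
    proof (rule gauge_increment_le_integral[OF fd q lipschitz_on_subset[OF un_lip sub] ab(2) N])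
      show "((\<lambda>s. \<mu> n s - td n s) has_integral integral {s0..b} (\<mu> n) - (tn n b - tn n s0)) {s0..b}"
        by (intro has_integral_diff tn_has_integral[OF ab] integrable_integral \<mu>_integrable[OF ab])
      fix s assume s: "s \<in> {s0..b} - N"
      then have s': "s \<in> {0..S} - N" "\<bar>s - s0\<bar> \<le> d" using sub b by auto
      show "(un n has_vector_derivative ud n s) (at s)" by (rule un_der[OF s'(1)])
      show "q (ud n s) \<le> \<mu> n s - td n s" using le[OF n s'] \<mu>_eq[OF s'(1)] by simp
    qed
    moreover have "isCont q (u b - u s0)"
      using gauge_fun_continuous[OF fd q, of UNIV] by (simp add: continuous_on_eq_continuous_at)
    then have "(\<lambda>n. q (un n b - un n s0)) \<longlonglongrightarrow> q (u b - u s0)"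
      by (rule isCont_tendsto_compose) (intro tendsto_diff u_lim b' s0')
    moreover have "(\<lambda>n. integral {s0..b} (\<mu> n) - (tn n b - tn n s0)) \<longlonglongrightarrow> integral {s0..b} m - (t b - t s0)"
      by (intro tendsto_diff m_integral(2)[OF ab] t_lim b' s0')
    ultimately have "q (u b - u s0) \<le> integral {s0..b} m - (t b - t s0)"
      by (intro LIMSEQ_le) auto
    then show "q (u b - u s0) \<le> (dissipated b - t b) - (dissipated s0 - t s0)"
      unfolding dissipated_diff[OF ab, symmetric] by simp
  qed
  ultimately have "q u' \<le> m s0 - t'"
    by (rule gauge_derivative_le_if_right_increments_le[OF fd q du])
  then show ?thesis by simp
qed

text \<open>
  Otherwise some \<open>y\<close> makes the conjugate exceed \<open>\<eta> > 0\<close> for all forces near \<open>s0\<close>, and then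
  \<open>viscous_force_power_ge\<close> yields \<open>\<eta> * td n / \<epsilon> n \<le> C\<close>. So \<open>t\<close> does not increase to the right of
  \<open>s0\<close>.
\<close>

lemma limit_local_stability:
  assumes s0: "0 < s0" "s0 < S" and dt: "(t has_vector_derivative t') (at s0)" and t': "0 < t'"
  shows "blinfun_apply (limit_force s0) z \<le> \<Psi>0 z"
proof (rule ccontr)
  let ?w = "limit_force s0"
  have s0': "s0 \<in> {0..S}" using s0 by simp
  assume "\<not> blinfun_apply ?w z \<le> \<Psi>0 z"
  then have "eventually (\<lambda>\<delta>. scaled_dissipation \<Psi> \<delta> z < blinfun_apply ?w z) (at_right 0)"
    using order_tendstoD(2)[OF dissipation_lim, of z "blinfun_apply ?w z"] by simp
  then obtain \<delta>0 where "0 < \<delta>0" "\<And>\<delta>. 0 < \<delta> \<Longrightarrow> \<delta> < \<delta>0 \<Longrightarrow> scaled_dissipation \<Psi> \<delta> z < blinfun_apply ?w z"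
    unfolding eventually_at_right_field by blast
  then have "0 < \<delta>0 / 2" "scaled_dissipation \<Psi> (\<delta>0 / 2) z < blinfun_apply ?w z" by simp_all
  then obtain \<delta> where \<delta>: "0 < \<delta>" "scaled_dissipation \<Psi> \<delta> z < blinfun_apply ?w z" by blast
  define y where "y = \<delta> *\<^sub>R z"
  have "0 < blinfun_apply ?w y - \<Psi> y"
    using \<delta> by (simp add: y_def scaled_dissipation_def blinfun.scaleR_right field_simps)
  then obtain \<eta> where \<eta>: "0 < \<eta>" "\<eta> < blinfun_apply ?w y - \<Psi> y" using dense by blast
  obtain d k where d: "0 < d" "\<forall>n\<ge>k. \<forall>s\<in>{0..S}. \<bar>s - s0\<bar> \<le> d \<longrightarrow>
      \<eta> < blinfun_apply (force n s) y - \<Psi> y"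
    using near_conjugate[OF s0' \<eta>(2)] by blast
  have "eventually (\<lambda>b. t b - t s0 \<le> 0 * (b - s0)) (at_right s0)"
  proof (rule right_neighbourhood[OF s0(2) d(1)])
    fix b assume b: "s0 < b" "b \<le> S" "b - s0 \<le> d"
    have ab: "0 \<le> s0" "s0 \<le> b" "b \<le> S" and b': "b \<in> {0..S}" using s0 b by auto
    have "tn n b - tn n s0 \<le> (C / \<eta> * \<epsilon> n) * (b - s0)" if n: "k \<le> n" for n
    proof (rule has_integral_le_ae[OF tn_has_integral[OF ab] _ N])
      show "((\<lambda>_. C / \<eta> * \<epsilon> n) has_integral (C / \<eta> * \<epsilon> n) * (b - s0)) {s0..b}"
        using has_integral_const_real[of "C / \<eta> * \<epsilon> n" s0 b] b by (simp add: mult.commute)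
      fix s assume "s \<in> {s0..b} - N"
      then have s: "s \<in> {0..S} - N" "\<bar>s - s0\<bar> \<le> d" using ab b by auto
      let ?wn = "force n s"
      have "\<eta> < blinfun_apply ?wn y - \<Psi> y" using d(2) n s by simp
      then have "\<eta> / (\<epsilon> n / td n s) \<le> (\<Psi> ((\<epsilon> n / td n s) *\<^sub>R ud n s) + (blinfun_apply ?wn y - \<Psi> y)) / (\<epsilon> n / td n s)"
        using superlinear_dissipationD(1)[OF dissipation, of "(\<epsilon> n / td n s) *\<^sub>R ud n s"]
          tn_pos[OF s(1), of n] eps_pos[of n] by (intro divide_right_mono) auto
      also have "\<dots> \<le> blinfun_apply ?wn (ud n s)"
        by (rule viscous_force_power_ge[OF dissipation flow[OF s(1)] tn_pos[OF s(1)] eps_pos])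
      also have "\<dots> \<le> C" using \<mu>_eq[OF s(1), of n] \<mu>_le[OF s(1), of n] tn_pos[OF s(1), of n] by simp
      finally show "td n s \<le> C / \<eta> * \<epsilon> n" using \<eta>(1) eps_pos[of n] by (simp add: field_simps)
    qed
    moreover have "(\<lambda>n. tn n b - tn n s0) \<longlonglongrightarrow> t b - t s0" by (intro tendsto_diff t_lim b' s0')
    moreover have "(\<lambda>n. (C / \<eta> * \<epsilon> n) * (b - s0)) \<longlonglongrightarrow> (C / \<eta> * 0) * (b - s0)"
      by (intro tendsto_mult tendsto_const eps_lim)
    ultimately have "t b - t s0 \<le> (C / \<eta> * 0) * (b - s0)" by (intro LIMSEQ_le) auto
    then show "t b - t s0 \<le> 0 * (b - s0)" by simp
  qed
  then have "t' \<le> 0" by (rule derivative_le_if_right_increments_le[OF dt])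
  then show False using t' by simp
qed

text \<open>
  For \<open>c\<close> strictly below the conjugate the bound follows from \<open>limit_gauge_le\<close>, and
  \<open>contact_gauge_scale_constant\<close> lets \<open>c\<close> approach it. If the conjugate is 0 there is no room
  below, but then \<open>\<Psi>0\<close> serves instead.
\<close>

lemma limit_contact_gauge_le:
  assumes s0: "0 < s0" "s0 < S"
    and dt: "(t has_vector_derivative t') (at s0)" and du: "(u has_vector_derivative u') (at s0)"
    and dm: "(dissipated has_vector_derivative m s0) (at s0)"
  shows "contact_gauge \<Psi> (conjugate_value \<Psi> (limit_force s0)) u' + t' \<le> m s0"
proof -
  let ?w = "limit_force s0"
  let ?c = "conjugate_value \<Psi> ?w"
  have s0': "s0 \<in> {0..S}" using s0 by simp
  have \<Psi>0le: "\<Psi>0 u' + t' \<le> m s0"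
    by (rule limit_gauge_le[OF gauge s0 dt du dm zero_less_one, of 0])
       (rule viscous_force_power_ge_gauge[OF dissipation gauge dissipation_lim flow tn_pos eps_pos])
  show ?thesis
  proof (cases "?c = 0")
    case True
    then show ?thesis using contact_gauge_0_le[OF dissipation dissipation_lim[of u']] \<Psi>0le by simp
  next
    case False
    then have c: "0 < ?c" using conjugate_value_nonneg[OF dissipation, of ?w] by simp
    have sub: "contact_gauge \<Psi> c u' + t' \<le> m s0" if cc: "0 < c" "c < ?c" for c
    proof -
      obtain z where z: "c < blinfun_apply ?w z - \<Psi> z" by (rule less_conjugate_valueE[OF dissipation cc(2)])
      obtain d k where d: "0 < d" "\<forall>n\<ge>k. \<forall>s\<in>{0..S}. \<bar>s - s0\<bar> \<le> d \<longrightarrow>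
          c < blinfun_apply (force n s) z - \<Psi> z"
        using near_conjugate[OF s0' z] by blast
      have q: "gauge_fun (contact_gauge \<Psi> c)"
        by (rule gauge_fun_contact_gauge[OF dissipation gauge less_imp_le[OF cc(1)] dissipation_lim])
      show ?thesis
      proof (rule limit_gauge_le[OF q s0 dt du dm d(1), of k])
        fix n s assume ns: "k \<le> n" "s \<in> {0..S} - N" "\<bar>s - s0\<bar> \<le> d"
        let ?wn = "force n s" and ?\<delta> = "\<epsilon> n / td n s"
        have \<delta>: "0 < ?\<delta>" using tn_pos[OF ns(2)] eps_pos by simp
        have "contact_gauge \<Psi> c (ud n s) \<le> (\<Psi> (?\<delta> *\<^sub>R ud n s) + c) / ?\<delta>"
          by (rule contact_gauge_lower[OF dissipation less_imp_le[OF cc(1)] \<delta>])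
        also have "\<dots> \<le> (\<Psi> (?\<delta> *\<^sub>R ud n s) + (blinfun_apply ?wn z - \<Psi> z)) / ?\<delta>"
          using d(2) ns \<delta> by (intro divide_right_mono add_left_mono) (auto intro: less_imp_le)
        also have "\<dots> \<le> blinfun_apply ?wn (ud n s)"
          by (rule viscous_force_power_ge[OF dissipation flow[OF ns(2)] tn_pos[OF ns(2)] eps_pos])
        finally show "contact_gauge \<Psi> c (ud n s) \<le> blinfun_apply ?wn (ud n s)" .
      qed
    qed
    show ?thesis
    proof -
      let ?q = "contact_gauge \<Psi> ?c u'"
      have "\<theta> * ?q \<le> m s0 - t'" if \<theta>: "0 < \<theta>" "\<theta> < 1" for \<theta>
      proof -
        have "?q \<le> (?c / (\<theta> * ?c)) * contact_gauge \<Psi> (\<theta> * ?c) u'"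
          using \<theta> c by (intro contact_gauge_scale_constant[OF dissipation]) auto
        also have "\<dots> = contact_gauge \<Psi> (\<theta> * ?c) u' / \<theta>" using c by simp
        finally have "\<theta> * ?q \<le> contact_gauge \<Psi> (\<theta> * ?c) u'" using \<theta> by (simp add: field_simps)
        also have "\<dots> \<le> m s0 - t'" using sub[of "\<theta> * ?c"] \<theta> c by simp
        finally show ?thesis .
      qed
      then have "?q \<le> m s0 - t'" by (rule field_le_mult_one_interval)
      then show ?thesis by simp
    qed
  qed
qed

text \<open>
  Stated for general \<open>p\<close>, as the energy inequality uses \<open>p = - dE\<close> and the normalization
  \<open>p = 1\<close>; both branches of the potential are affine in \<open>p\<close> with slope \<open>t'\<close>.
\<close>

lemma limit_potential_eq:
  assumes s0: "0 < s0" "s0 < S"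
    and dt: "(t has_vector_derivative t') (at s0)" and du: "(u has_vector_derivative u') (at s0)"
    and dm: "(dissipated has_vector_derivative m s0) (at s0)"
  shows "augmented_potential \<Psi>0 \<Psi> t' u' p (limit_force s0) = ereal (m s0 + t' * (p - 1))" and "0 \<le> t'"
proof -
  let ?w = "limit_force s0"
  show t': "0 \<le> t'"
  proof -
    have "((\<lambda>s. - t s) has_vector_derivative - t') (at s0)" by (rule has_vector_derivative_minus[OF dt])
    moreover have "eventually (\<lambda>b. - t b - - t s0 \<le> 0 * (b - s0)) (at_right s0)"
    proof (rule right_neighbourhood[OF s0(2) zero_less_one])
      fix b assume "s0 < b" "b \<le> S"
      then show "- t b - - t s0 \<le> 0 * (b - s0)" using mono_onD[OF t_mono, of s0 b] s0 by simp
    qed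
    ultimately have "- t' \<le> 0" by (rule derivative_le_if_right_increments_le)
    then show ?thesis by simp
  qed
  have bal: "m s0 = blinfun_apply ?w u' + t'" by (rule limit_energy_balance[OF s0 dt du dm])
  have le: "contact_gauge \<Psi> (conjugate_value \<Psi> ?w) u' + t' \<le> m s0"
    by (rule limit_contact_gauge_le[OF s0 dt du dm])
  show "augmented_potential \<Psi>0 \<Psi> t' u' p ?w = ereal (m s0 + t' * (p - 1))"
  proof (cases "0 < t'")
    case True
    have stab: "blinfun_apply ?w z \<le> \<Psi>0 z" for z by (rule limit_local_stability[OF s0 dt True])
    have "\<Psi>0 0 = 0" using gauge_funD(4)[OF gauge, of 0 0] by simp
    then have "?w \<in> subdifferential \<Psi>0 0" using stab by (simp add: subdifferential_def)
    moreover have "\<Psi>0 u' + t' \<le> m s0"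
      by (rule limit_gauge_le[OF gauge s0 dt du dm zero_less_one, of 0])
         (rule viscous_force_power_ge_gauge[OF dissipation gauge dissipation_lim flow tn_pos eps_pos])
    then have "\<Psi>0 u' = m s0 - t'" using bal stab[of u'] by simp
    ultimately show ?thesis using True
      by (simp add: augmented_potential_def convex_indicator_def algebra_simps)
  next
    case False
    then have "t' = 0" using t' by simp
    moreover have "contact_gauge \<Psi> (conjugate_value \<Psi> ?w) u' = m s0"
      using bal le contact_gauge_ge_pairing[OF dissipation, of ?w u'] \<open>t' = 0\<close> by simp
    ultimately show ?thesis
      by (simp add: augmented_potential_def vv_contact_potential_eq[OF dissipation])
  qed
qed

lemma limit_regular_points:
  "\<exists>N'. negligible N' \<and> N \<subseteq> N' \<and> (\<forall>s\<in>{0..S} - N'. 0 < s \<and> s < S \<and>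
     (t has_vector_derivative vector_derivative t (at s)) (at s) \<and>
     (u has_vector_derivative vector_derivative u (at s)) (at s) \<and>
     (dissipated has_vector_derivative m s) (at s))"
proof (cases "0 \<le> S")
  case True
  obtain N1 where N1: "negligible N1" "\<And>s. s \<in> {0..S} - N1 \<Longrightarrow> 0 < s \<and> s < S \<and>
      (t has_vector_derivative vector_derivative t (at s)) (at s)"
    using lipschitz_differentiable_ae[OF finite_dim_real t_lip] by blast
  obtain N2 where N2: "negligible N2" "\<And>s. s \<in> {0..S} - N2 \<Longrightarrow> 0 < s \<and> s < S \<and>
      (u has_vector_derivative vector_derivative u (at s)) (at s)"
    using lipschitz_differentiable_ae[OF fd u_lip] by blast
  let ?N3 = "{s. 0 < s \<and> s < S \<and> \<not> ((\<lambda>r. integral {0..r} m) has_real_derivative m s) (at s)}"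
  have N3: "negligible ?N3"
    using m_integral(1)[of 0 S] True by (intro indefinite_integral_has_derivative_ae) simp
  show ?thesis
  proof (intro exI[of _ "N \<union> N1 \<union> N2 \<union> ?N3"] conjI ballI)
    show "negligible (N \<union> N1 \<union> N2 \<union> ?N3)" by (rule negligible_Un[OF negligible_Un[OF negligible_Un[OF N N1(1)] N2(1)] N3])
    fix s assume s: "s \<in> {0..S} - (N \<union> N1 \<union> N2 \<union> ?N3)"
    then show i: "0 < s" "s < S" and "(t has_vector_derivative vector_derivative t (at s)) (at s)"
        and "(u has_vector_derivative vector_derivative u (at s)) (at s)"
      using N1(2)[of s] N2(2)[of s] by auto
    have "((\<lambda>r. integral {0..r} m) has_real_derivative m s) (at s)" using s i by simp
    then show "(dissipated has_vector_derivative m s) (at s)"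
      unfolding dissipated_def has_real_derivative_iff_has_vector_derivative .
  qed blast
next
  case False
  then show ?thesis using N by (intro exI[of _ N]) auto
qed

lemma limit_solution_properties:
  assumes \<alpha>: "0 < \<alpha>" "\<And>n s. s \<in> {0..S} - N \<Longrightarrow> \<alpha> \<le> \<mu> n s"
  shows "parametrized_solution T E dE DE (augmented_potential \<Psi>0 \<Psi>) 0 S t u"
    and "nondegenerate_curve \<Psi>0 0 S t u"
    and "AE s in lebesgue. s \<in> {0<..<S} \<longrightarrow>
       augmented_potential \<Psi>0 \<Psi> (vector_derivative t (at s)) (vector_derivative u (at s)) 1 (limit_force s) = ereal (m s)"
proof -
  obtain N' where N': "negligible N'" "N \<subseteq> N'" and reg: "\<And>s. s \<in> {0..S} - N' \<Longrightarrow> 0 < s \<and> s < S \<and>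
     (t has_vector_derivative vector_derivative t (at s)) (at s) \<and>
     (u has_vector_derivative vector_derivative u (at s)) (at s) \<and>
     (dissipated has_vector_derivative m s) (at s)"
    using limit_regular_points by blast
  let ?t = "\<lambda>s. vector_derivative t (at s)" and ?u = "\<lambda>s. vector_derivative u (at s)"
  have pot: "augmented_potential \<Psi>0 \<Psi> (?t s) (?u s) p (limit_force s) = ereal (m s + ?t s * (p - 1))"
    and t'nonneg: "0 \<le> ?t s" if "s \<in> {0..S} - N'" for s p
    using limit_potential_eq(1)[of s "?t s" "?u s" p] limit_potential_eq(2)[of s "?t s" "?u s"] reg[OF that]
    by auto
  have m_bounds: "\<alpha> \<le> m s" if "s \<in> {0..S} - N" for s
    using \<mu>_lim[OF that] by (rule LIMSEQ_le_const) (use \<alpha>(2)[OF that] in auto)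
  show "AE s in lebesgue. s \<in> {0<..<S} \<longrightarrow>
       augmented_potential \<Psi>0 \<Psi> (?t s) (?u s) 1 (limit_force s) = ereal (m s)"
    unfolding AE_lebesgue_iff_negligible
  proof (rule negligible_subset[OF N'(1)], rule subsetI, rule ccontr)
    fix s assume "s \<in> {s. \<not> (s \<in> {0<..<S} \<longrightarrow>
       augmented_potential \<Psi>0 \<Psi> (?t s) (?u s) 1 (limit_force s) = ereal (m s))}" "s \<notin> N'"
    then show False using pot[of s 1] by auto
  qed
  show "nondegenerate_curve \<Psi>0 0 S t u"
    unfolding nondegenerate_curve_def AE_lebesgue_iff_negligible
  proof (rule negligible_subset[OF N'(1)], rule subsetI, rule ccontr)
    fix s assume s: "s \<in> {s. \<not> (s \<in> {0<..<S} \<longrightarrow> 0 < ?t s + \<Psi>0 (?u s))}" "s \<notin> N'"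
    then have sS: "s \<in> {0..S} - N'" and le: "?t s + \<Psi>0 (?u s) \<le> 0" by auto
    have "?t s = 0" "\<Psi>0 (?u s) = 0"
      using le t'nonneg[OF sS] gauge_funD(1)[OF gauge, of "?u s"] by auto
    then have "?u s = 0" using gauge_funD(2)[OF gauge, of "?u s"] by auto
    moreover have "m s = blinfun_apply (limit_force s) (?u s) + ?t s"
      using reg[OF sS] by (intro limit_energy_balance) auto
    ultimately have "m s = 0" using \<open>?t s = 0\<close> by simp
    then show False using m_bounds[of s] sS N'(2) \<alpha>(1) by auto
  qed
  show "parametrized_solution T E dE DE (augmented_potential \<Psi>0 \<Psi>) 0 S t u"
    unfolding parametrized_solution_def
  proof (intro conjI allI impI)
    have "(sqrt (L\<^sup>2 + M\<^sup>2))-lipschitz_on {0..S} (\<lambda>s. (t s, u s))"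
      by (rule lipschitz_on_Pair[OF t_lip u_lip])
    then show "\<exists>L. L-lipschitz_on {0..S} (\<lambda>s. (t s, u s))" by blast
    show "t ` {0..S} \<subseteq> {0..T}" by (rule t_range)
    show "mono_on {0..S} t" by (rule t_mono)
    fix a b assume ab: "0 \<le> a \<and> a \<le> b \<and> b \<le> S"
    define e where "e s = E (t s) (u s)" for s
    obtain K where K: "K-lipschitz_on {0..S} e"
      using C1_energy_lipschitz_along_curve[OF fd energy t_lip t_range u_lip] unfolding e_def by blast
    define e' where "e' s = - (m s + ?t s * (- dE (t s) (u s) - 1))" for s
    have de: "(e has_vector_derivative e' s) (at s)" if s: "s \<in> {0..S} - N'" for s
    proof -
      note r = reg[OF s]
      have "(e has_vector_derivative ?t s * dE (t s) (u s) + blinfun_apply (DE (t s) (u s)) (?u s)) (at s)"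
        unfolding e_def using r by (intro C1_energy_chain_rule[OF energy _ _ t_range]) auto
      moreover have "m s = blinfun_apply (limit_force s) (?u s) + ?t s"
        using r by (intro limit_energy_balance) auto
      then have "?t s * dE (t s) (u s) + blinfun_apply (DE (t s) (u s)) (?u s) = e' s"
        by (simp add: e'_def blinfun.minus_left algebra_simps)
      ultimately show ?thesis by simp
    qed
    let ?f = "\<lambda>s. if s \<in> N' then 0 else - e' s"
    have "(e' has_integral e b - e a) {a..b}"
      by (rule lipschitz_has_integral_derivative[OF K N'(1) de]) (use ab in auto)
    then have "((\<lambda>s. - e' s) has_integral - (e b - e a)) {a..b}" by (rule has_integral_neg)
    then have f: "(?f has_integral - (e b - e a)) {a..b}"
      by (rule has_integral_spike[OF N'(1), rotated]) simp
    have "\<bar>?f s\<bar> \<le> K" if s: "s \<in> {a..b}" for s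
    proof (cases "s \<in> N'")
      case False
      then have sS: "s \<in> {0..S} - N'" using s ab by auto
      have lim: "((\<lambda>y. norm ((e y - e s) /\<^sub>R (y - s))) \<longlongrightarrow> norm (e' s)) (at_right s)"
        by (intro tendsto_norm right_difference_quotient_tendsto[OF de[OF sS]])
      have "norm (e' s) \<le> K"
      proof (rule tendsto_upperbound[OF lim])
        show "eventually (\<lambda>y. norm ((e y - e s) /\<^sub>R (y - s)) \<le> K) (at_right s)"
        proof (rule right_neighbourhood[OF _ zero_less_one])
          show "s < S" using reg[OF sS] by simp
          fix y assume y: "s < y" "y \<le> S"
          then have "dist (e y) (e s) \<le> K * dist y s" using sS by (intro lipschitz_onD[OF K]) auto
          then show "norm ((e y - e s) /\<^sub>R (y - s)) \<le> K" using y by (simp add: dist_real_def abs_mult field_simps)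
        qed
      qed simp
      then show ?thesis using False by simp
    qed (use lipschitz_on_nonneg[OF K] in simp)
    then have "ereal_integral (lebesgue_on {a..b}) (\<lambda>s. augmented_potential \<Psi>0 \<Psi> (?t s) (?u s)
        (- dE (t s) (u s)) (limit_force s)) = ereal (- (e b - e a))"
    proof (rule ereal_integral_eq_integral[OF f _ N'(1)])
      fix s assume "s \<in> {a..b} - N'"
      then have "s \<in> {0..S} - N'" "s \<notin> N'" using ab by auto
      then show "augmented_potential \<Psi>0 \<Psi> (?t s) (?u s) (- dE (t s) (u s)) (limit_force s) = ereal (?f s)"
        using pot by (simp add: e'_def)
    qed
    then show "ereal_integral (lebesgue_on {a..b}) (\<lambda>s. augmented_potential \<Psi>0 \<Psi> (?t s) (?u s)
        (- dE (t s) (u s)) (limit_force s)) + ereal (E (t b) (u b)) \<le> ereal (E (t a) (u a))"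
      by (simp add: e_def)
  qed
qed

end

theorem theorem5p6:
  fixes T S \<alpha> :: real
    and \<Psi>0 \<Psi> :: "'x::real_normed_vector \<Rightarrow> real"
    and E dE :: "real \<Rightarrow> 'x \<Rightarrow> real"
    and DE :: "real \<Rightarrow> 'x \<Rightarrow> ('x \<Rightarrow>\<^sub>L real)"
    and \<epsilon> :: "nat \<Rightarrow> real"
    and v :: "nat \<Rightarrow> real \<Rightarrow> 'x"
    and tn :: "nat \<Rightarrow> real \<Rightarrow> real"
    and un :: "nat \<Rightarrow> real \<Rightarrow> 'x"
    and mn :: "nat \<Rightarrow> real \<Rightarrow> ereal"
    and t m :: "real \<Rightarrow> real"
    and u :: "real \<Rightarrow> 'x"
  assumes finite_dim: "\<exists>B :: 'x set. finite B \<and> span B = UNIV"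
    and T_pos: "0 < T"
    and gauge: "gauge_fun \<Psi>0"
    and energy_C1: "C1_energy T E dE DE"
    and energy_bds: "energy_bounds T E dE"
    and dissipation: "superlinear_dissipation \<Psi>"
    and dissipation_lim: "\<And>z. ((\<lambda>\<delta>. scaled_dissipation \<Psi> \<delta> z) \<longlongrightarrow> \<Psi>0 z) (at_right 0)"
    and eps_pos: "\<And>n. 0 < \<epsilon> n"
    and eps_lim: "\<epsilon> \<longlonglongrightarrow> 0"
    and viscous: "\<And>n. viscous_solution T DE \<Psi> (\<epsilon> n) (v n)"
    and tn_lipschitz: "\<exists>L. \<forall>n. L-lipschitz_on {0..S} (tn n)"
    and tn_mono: "\<And>n. mono_on {0..S} (tn n)"
    and tn_surj: "\<And>n. tn n ` {0..S} = {0..T}"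
    and tn_deriv_pos: "\<And>n. AE s in lebesgue. s \<in> {0<..<S} \<longrightarrow> 0 < vector_derivative (tn n) (at s)"
    and un_def: "\<And>n s. s \<in> {0..S} \<Longrightarrow> un n s = v n (tn n s)"
    and mn_def: "\<And>n s. s \<in> {0<..<S} \<Longrightarrow> mn n s =
           viscous_space_time_potential \<Psi> (\<epsilon> n)
             (vector_derivative (tn n) (at s)) (vector_derivative (un n) (at s))
             1 (- DE (tn n s) (un n s))"
    and \<alpha>_pos: "0 < \<alpha>"
    and mn_bounds: "\<And>n. AE s in lebesgue. s \<in> {0<..<S} \<longrightarrow> mn n s \<in> {ereal \<alpha>..ereal (inverse \<alpha>)}"
    and tn_lim: "\<And>s. s \<in> {0..S} \<Longrightarrow> (\<lambda>n. tn n s) \<longlonglongrightarrow> t s"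
    and un_lim: "\<And>s. s \<in> {0..S} \<Longrightarrow> (\<lambda>n. un n s) \<longlonglongrightarrow> u s"
    and mn_lim: "AE s in lebesgue. s \<in> {0<..<S} \<longrightarrow> (\<lambda>n. mn n s) \<longlonglongrightarrow> ereal (m s)"
  shows "parametrized_solution T E dE DE (augmented_potential \<Psi>0 \<Psi>) 0 S t u \<and>
         nondegenerate_curve \<Psi>0 0 S t u \<and>
         surjective_curve T 0 S t \<and>
         (AE s in lebesgue. s \<in> {0<..<S} \<longrightarrow>
            augmented_potential \<Psi>0 \<Psi> (vector_derivative t (at s)) (vector_derivative u (at s))
              1 (- DE (t s) (u s)) = ereal (m s))"
proof -
  obtain L where L: "\<And>n. L-lipschitz_on {0..S} (tn n)" using tn_lipschitz by blast
  have "tn 0 ` {0..S} \<noteq> {}" using tn_surj[of 0] T_pos by simp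
  then have S0: "0 \<le> S" by simp
  have tn_range: "tn n ` {0..S} \<subseteq> {0..T}" for n using tn_surj by simp
  have tn_0: "tn n 0 = 0" and tn_S: "tn n S = T" for n
  proof -
    have rng: "0 \<in> tn n ` {0..S}" "T \<in> tn n ` {0..S}" using tn_surj[of n] T_pos by auto
    obtain r where r: "r \<in> {0..S}" "tn n r = 0" using rng(1) by (elim imageE) simp
    have "tn n 0 \<le> tn n r" using r(1) S0 by (intro mono_onD[OF tn_mono]) auto
    moreover have "tn n 0 \<in> {0..T}" by (rule subsetD[OF tn_range imageI]) (use S0 in simp)
    ultimately show "tn n 0 = 0" using r(2) by simp
    obtain r where r: "r \<in> {0..S}" "tn n r = T" using rng(2) by (elim imageE) simp
    have "tn n r \<le> tn n S" using r(1) S0 by (intro mono_onD[OF tn_mono]) auto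
    moreover have "tn n S \<in> {0..T}" by (rule subsetD[OF tn_range imageI]) (use S0 in simp)
    ultimately show "tn n S = T" using r(2) by simp
  qed
  let ?td = "\<lambda>n s. vector_derivative (tn n) (at s)" and ?ud = "\<lambda>n s. vector_derivative (un n) (at s)"
  define \<mu> where "\<mu> n s = blinfun_apply (- DE (tn n s) (un n s)) (?ud n s) + ?td n s" for n s
  have "\<exists>N. negligible N \<and> (\<forall>s\<in>{0..S} - N. viscous_regular_time DE \<Psi> (\<epsilon> n) S (tn n) (un n) s)" for n
    by (rule viscous_rescaled_ae[OF finite_dim viscous L tn_surj tn_deriv_pos un_def])
  then have "\<exists>Nf. \<forall>n. negligible (Nf n) \<and>
      (\<forall>s\<in>{0..S} - Nf n. viscous_regular_time DE \<Psi> (\<epsilon> n) S (tn n) (un n) s)"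
    by (intro choice allI)
  then obtain Nf where Nf: "\<And>n. negligible (Nf n)"
    and reg: "\<And>n s. s \<in> {0..S} - Nf n \<Longrightarrow> viscous_regular_time DE \<Psi> (\<epsilon> n) S (tn n) (un n) s"
    by blast
  define Nb where "Nb n = {s. \<not> (s \<in> {0<..<S} \<longrightarrow> mn n s \<in> {ereal \<alpha>..ereal (inverse \<alpha>)})}" for n
  define Nl where "Nl = {s. \<not> (s \<in> {0<..<S} \<longrightarrow> (\<lambda>n. mn n s) \<longlonglongrightarrow> ereal (m s))}"
  have Nb: "negligible (Nb n)" for n
    using mn_bounds[of n] unfolding AE_lebesgue_iff_negligible Nb_def .
  have Nl: "negligible Nl" using mn_lim unfolding AE_lebesgue_iff_negligible Nl_def .
  define N where "N = (\<Union>n. Nf n) \<union> (\<Union>n. Nb n) \<union> Nl"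
  have N: "negligible N"
  proof -
    have "negligible (\<Union>n. Nf n)" "negligible (\<Union>n. Nb n)"
      by (rule negligible_countable_Union; use Nf Nb in auto)+
    then show ?thesis unfolding N_def using Nl by (intro negligible_Un)
  qed
  have regular: "viscous_regular_time DE \<Psi> (\<epsilon> n) S (tn n) (un n) s" if "s \<in> {0..S} - N" for n s
    by (rule reg) (use that in \<open>auto simp: N_def\<close>)
  note N_reg = regular[unfolded viscous_regular_time_def]
  have mn_eq: "mn n s = ereal (\<mu> n s)" if "s \<in> {0..S} - N" for n s
    using N_reg[OF that, of n] viscous_space_time_potential_eq[where w="- DE (tn n s) (un n s)" and \<Psi>=\<Psi>
        and \<epsilon>="\<epsilon> n" and v="?ud n s" and a="?td n s" and p=1]
    by (simp add: mn_def \<mu>_def)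
  have \<mu>_bounds: "\<alpha> \<le> \<mu> n s" "\<mu> n s \<le> inverse \<alpha>" if s: "s \<in> {0..S} - N" for n s
  proof -
    have "s \<notin> Nb n" using s by (auto simp: N_def)
    then have "mn n s \<in> {ereal \<alpha>..ereal (inverse \<alpha>)}" using N_reg[OF s] by (simp add: Nb_def)
    then show "\<alpha> \<le> \<mu> n s" "\<mu> n s \<le> inverse \<alpha>" unfolding mn_eq[OF s] by simp_all
  qed
  have \<mu>_lim: "(\<lambda>n. \<mu> n s) \<longlonglongrightarrow> m s" if s: "s \<in> {0..S} - N" for s
  proof -
    have "s \<notin> Nl" using s by (simp add: N_def)
    then have "(\<lambda>n. mn n s) \<longlonglongrightarrow> ereal (m s)" using N_reg[OF s] by (simp add: Nl_def)
    then show ?thesis unfolding mn_eq[OF s] by simp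
  qed
  \<comment> \<open>the upper bound on \<open>\<mu>\<close> controls \<open>\<Psi>0\<close> of the velocity, which is equivalent to the norm\<close>
  obtain c where c: "0 < c" "\<And>x. norm x \<le> c * \<Psi>0 x"
    using gauge_fun_lower_bound[OF finite_dim gauge] by blast
  have un_lip: "(c * inverse \<alpha>)-lipschitz_on {0..S} (un n)" for n
  proof (rule lipschitz_on_if_ae_derivative_bounded[OF _ N])
    have "abs_continuous_curve 0 T (v n)" using viscous[of n] by (simp add: viscous_solution_def)
    then have "abs_continuous_curve 0 S (\<lambda>s. v n (tn n s))"
      by (rule abs_continuous_curve_compose_mono_lipschitz[OF _ L tn_mono tn_range])
    then show "abs_continuous_curve 0 S (un n)"
      by (rule abs_continuous_curve_if_norm_le[of _ _ _ _ 1]) (simp add: un_def)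
    show "0 \<le> c * inverse \<alpha>" using c(1) \<alpha>_pos by simp
    fix s assume s: "s \<in> {0..S} - N"
    note r = N_reg[OF s, of n]
    show "(un n has_vector_derivative ?ud n s) (at s)" using r by simp
    have "\<Psi>0 (?ud n s) \<le> blinfun_apply (- DE (tn n s) (un n s)) (?ud n s)"
      using r by (intro viscous_force_power_ge_gauge[OF dissipation gauge dissipation_lim _ _ eps_pos]) auto
    also have "\<dots> \<le> inverse \<alpha>" using r \<mu>_bounds(2)[OF s, of n] by (simp add: \<mu>_def)
    finally have "c * \<Psi>0 (?ud n s) \<le> c * inverse \<alpha>" using c(1) by simp
    then show "norm (?ud n s) \<le> c * inverse \<alpha>" using c(2)[of "?ud n s"] by simp
  qed
  interpret viscous_limit T S L "c * inverse \<alpha>" "inverse \<alpha>" \<Psi>0 \<Psi> E dE DE \<epsilon> tn un \<mu> t m u N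
  proof
    show "0 \<le> inverse \<alpha>" using \<alpha>_pos by simp
    show "\<mu> n s = blinfun_apply (- DE (tn n s) (un n s)) (?ud n s) + ?td n s" for n s by (simp add: \<mu>_def)
  qed (fact finite_dim gauge energy_C1 dissipation dissipation_lim eps_pos eps_lim L un_lip tn_mono tn_range N regular
      \<mu>_bounds(2) \<mu>_lim tn_lim un_lim)+
  have "t 0 = 0" "t S = T"
    using tn_lim[of 0] tn_lim[of S] S0 by (simp_all add: tn_0 tn_S LIMSEQ_const_iff)
  then have "surjective_curve T 0 S t" by (simp add: surjective_curve_def)
  then show ?thesis
    using limit_solution_properties[OF \<alpha>_pos \<mu>_bounds(1)] by blast
qed

end
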